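(* Let $l\ge 2$ and $k\ge1$ be integers. If $N=2k$ is even, the algebra $\mathrm{End}_{Pin(2k)}(S^{\otimes l})$ is a quotient of $U(l,k)$. If $N=2k+1$ is odd, the algebra $\mathrm{End}_{Spin(2k+1)}(S^{\otimes l})$ is a quotient of $Uo(l,k+1)$.
   Context: All algebras are over $\mathbb{C}$. For $N=2k$, $S$ is the $2^k$-dimensional spinor representation of $Pin(2k)$ (the two-fold cover of $O(2k)$), i.e. the simple module of the Clifford algebra $Cl(2k)$, on which $Pin(2k)$ acts so that conjugation by a lift of $g\in O(2k)$ induces the automorphism of $Cl(2k)\cong \mathrm{End}(S)$ given by $g$ on the generating vector space. For $N=2k+1$, $S$ is the $2^k$-dimensional irreducible spinor representation of $Spin(2k+1)$ (the two-fold cover of $SO(2k+1)$). For positive integers $l,m$: the algebra $U(l,m)$ is defined by generators $D_1,\dots,D_{l-1}$ and relations $[D_i,[D_i,D_{i\pm1}]]=D_{i\pm 1}$, $[D_i,D_j]=0$ if $|i-j|>1$, and $\prod_{j=-m}^m(D_i-j)=0$. The algebra $Uo(l,m)$ is the subalgebra generated by $D_1^2,\dots,D_{l-1}^2$ of the algebra with generators $D_1,\dots,D_{l-1}$ and relations $[D_i,[D_i,D_{i\pm1}]]=D_{i\pm1}$, $[D_i,D_j]=0$ if $|i-j|>1$, and $\prod_{j=-m+1}^{m}(D_i-j+\frac12)=0$. *)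

theory Defs
  imports "HOL-Analysis.Analysis" "HOL-Algebra.Module" "HOL-Algebra.QuotRing" "HOL-Algebra.Generated_Groups"
    "HOL-Library.Poly_Mapping"
begin

text \<open>
  Associative unital algebras over the complex numbers are represented by records of type
  \<open>(complex, 'a) module\<close>, i.e. a ring together with a scalar multiplication. (The locale
  \<open>algebra\<close> of HOL-Algebra is not applicable, since it is restricted to commutative algebras.)
\<close>

definition alg_hom :: "(complex, 'a) module \<Rightarrow> (complex, 'b) module \<Rightarrow> ('a \<Rightarrow> 'b) set" where
  "alg_hom A B = {h \<in> ring_hom A B.
     \<forall>c. \<forall>x \<in> carrier A. h (c \<odot>\<^bsub>A\<^esub> x) = c \<odot>\<^bsub>B\<^esub> h x}"

definition quot_alg :: "(complex, 'a) module \<Rightarrow> 'a set \<Rightarrow> (complex, 'a set) module" where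
  "quot_alg A I = ring.extend (A Quot I)
     (module.fields (\<lambda>c X. \<Union>x\<in>X. I +>\<^bsub>A\<^esub> (c \<odot>\<^bsub>A\<^esub> x)))"

definition is_quotient_of :: "(complex, 'b) module \<Rightarrow> (complex, 'a) module \<Rightarrow> bool" where
  "is_quotient_of B A \<longleftrightarrow>
     (\<exists>I h. ideal I A \<and> h \<in> alg_hom (quot_alg A I) B
        \<and> bij_betw h (carrier (quot_alg A I)) (carrier B))"

definition subalgebra_of :: "'a set \<Rightarrow> (complex, 'a) module \<Rightarrow> bool" where
  "subalgebra_of B A \<longleftrightarrow> B \<subseteq> carrier A \<and> \<one>\<^bsub>A\<^esub> \<in> B
     \<and> (\<forall>x\<in>B. \<forall>y\<in>B. x \<oplus>\<^bsub>A\<^esub> y \<in> B \<and> x \<otimes>\<^bsub>A\<^esub> y \<in> B)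
     \<and> (\<forall>c. \<forall>x\<in>B. c \<odot>\<^bsub>A\<^esub> x \<in> B)"

definition generated_subalgebra ::
    "(complex, 'a) module \<Rightarrow> 'a set \<Rightarrow> (complex, 'a) module" where
  "generated_subalgebra A G = A\<lparr>carrier := \<Inter>{B. subalgebra_of B A \<and> G \<subseteq> B}\<rparr>"


section \<open>Algebras given by generators and relations\<close>

datatype word = Word (letters: "nat list")

instantiation word :: monoid_add
begin

definition "0 = Word []"

definition "u + v = Word (letters u @ letters v)"

instance
  by standard (auto simp: zero_word_def plus_word_def)

end

text \<open>
  The product of \<open>word \<Rightarrow>\<^sub>0 complex\<close> is convolution along concatenation of words, i.e. the
  product of noncommutative polynomials.
\<close>

type_synonym nc_poly = "word \<Rightarrow>\<^sub>0 complex"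

definition gen :: "nat \<Rightarrow> nc_poly" where
  "gen i = Poly_Mapping.single (Word [i]) 1"

definition scal :: "complex \<Rightarrow> nc_poly" where
  "scal c = Poly_Mapping.single 0 c"

definition commutator :: "'a::ring \<Rightarrow> 'a \<Rightarrow> 'a" where
  "commutator a b = a * b - b * a"

definition free_alg :: "nat set \<Rightarrow> (complex, nc_poly) module" where
  "free_alg X =
     \<lparr>carrier = {p. \<forall>w \<in> Poly_Mapping.keys p. set (letters w) \<subseteq> X},
      monoid.mult = (*), one = 1, zero = 0, add = (+), smult = (\<lambda>c p. scal c * p)\<rparr>"

definition presented_alg :: "nat set \<Rightarrow> nc_poly set \<Rightarrow> (complex, nc_poly set) module" where
  "presented_alg X R = quot_alg (free_alg X) (Idl\<^bsub>free_alg X\<^esub> R)"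

definition presented_class :: "nat set \<Rightarrow> nc_poly set \<Rightarrow> nc_poly \<Rightarrow> nc_poly set" where
  "presented_class X R p = (Idl\<^bsub>free_alg X\<^esub> R) +>\<^bsub>free_alg X\<^esub> p"

text \<open>\<open>Idl\<close> is only meaningful over a ring, hence the following facts.\<close>

lemma free_alg_mult_closed:
  assumes "p \<in> carrier (free_alg X)" "q \<in> carrier (free_alg X)"
  shows "p * q \<in> carrier (free_alg X)"
proof -
  have "set (letters w) \<subseteq> X" if w: "w \<in> Poly_Mapping.keys (p * q)" for w
  proof -
    obtain u v where "u \<in> Poly_Mapping.keys p" "v \<in> Poly_Mapping.keys q" "w = u + v"
      using w keys_mult[of p q] by blast
    then show ?thesis
      using assms by (auto simp: free_alg_def plus_word_def)
  qed
  then show ?thesis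
    by (auto simp: free_alg_def)
qed

lemma ring_free_alg: "ring (free_alg X)"
proof (rule ringI)
  show "abelian_group (free_alg X)"
  proof (rule abelian_groupI)
    fix x y assume "x \<in> carrier (free_alg X)" "y \<in> carrier (free_alg X)"
    then show "x \<oplus>\<^bsub>free_alg X\<^esub> y \<in> carrier (free_alg X)"
      using Poly_Mapping.keys_add[of x y] by (auto simp: free_alg_def)
  next
    fix x assume "x \<in> carrier (free_alg X)"
    then show "\<exists>y\<in>carrier (free_alg X). y \<oplus>\<^bsub>free_alg X\<^esub> x = \<zero>\<^bsub>free_alg X\<^esub>"
      by (intro bexI[of _ "- x"]) (auto simp: free_alg_def)
  qed (auto simp: free_alg_def algebra_simps)
  show "Group.monoid (free_alg X)"
  proof (rule monoidI)
    show "\<one>\<^bsub>free_alg X\<^esub> \<in> carrier (free_alg X)"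
      by (auto simp: free_alg_def zero_word_def simp flip: single_one)
    fix x y assume "x \<in> carrier (free_alg X)" "y \<in> carrier (free_alg X)"
    then show "x \<otimes>\<^bsub>free_alg X\<^esub> y \<in> carrier (free_alg X)"
      using free_alg_mult_closed[of x X y] by (simp add: free_alg_def)
  qed (auto simp: free_alg_def mult.assoc)
qed (auto simp: free_alg_def algebra_simps)

lemma ring_presented_alg:
  assumes "R \<subseteq> carrier (free_alg X)"
  shows "ring (free_alg X Quot (Idl\<^bsub>free_alg X\<^esub> R))"
  by (rule ideal.quotient_is_ring, rule ring.genideal_ideal[OF ring_free_alg assms])


section \<open>The algebras U(l, m) and Uo(l, m)\<close>

text \<open>
  \<open>D_i\<close> is \<open>gen i\<close> for \<open>1 \<le> i \<le> l - 1\<close>, and \<open>zs\<close> lists the roots of the polynomial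
  relation imposed on each \<open>D_i\<close>.
\<close>

definition D_rels :: "nat \<Rightarrow> complex list \<Rightarrow> nc_poly set" where
  "D_rels l zs =
     {commutator (gen i) (commutator (gen i) (gen j)) - gen j | i j.
        i \<in> {1..<l} \<and> j \<in> {1..<l} \<and> (j = i + 1 \<or> i = j + 1)}
   \<union> {commutator (gen i) (gen j) | i j.
        i \<in> {1..<l} \<and> j \<in> {1..<l} \<and> \<bar>int i - int j\<bar> > 1}
   \<union> {prod_list (map (\<lambda>z. gen i - scal z) zs) | i. i \<in> {1..<l}}"

definition D_alg :: "nat \<Rightarrow> complex list \<Rightarrow> (complex, nc_poly set) module" where
  "D_alg l zs = presented_alg {1..<l} (D_rels l zs)"

definition U_alg :: "nat \<Rightarrow> nat \<Rightarrow> (complex, nc_poly set) module" where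
  "U_alg l m = D_alg l (map of_int [- int m..int m])"

definition half_roots :: "nat \<Rightarrow> complex list" where
  "half_roots m = map (\<lambda>j. of_int j - 1/2) [- int m + 1..int m]"

definition Uo_alg :: "nat \<Rightarrow> nat \<Rightarrow> (complex, nc_poly set) module" where
  "Uo_alg l m = generated_subalgebra (D_alg l (half_roots m))
     {presented_class {1..<l} (D_rels l (half_roots m)) (gen i ^ 2) | i. i \<in> {1..<l}}"


section \<open>Clifford algebra, Pin and Spin\<close>

definition clifford_rels :: "nat \<Rightarrow> nc_poly set" where
  "clifford_rels N =
     {gen i * gen j + gen j * gen i - scal (if i = j then 2 else 0) | i j.
        i \<in> {1..N} \<and> j \<in> {1..N}}"

definition Cl :: "nat \<Rightarrow> (complex, nc_poly set) module" where
  "Cl N = presented_alg {1..N} (clifford_rels N)"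

text \<open>The unit sphere of the real span of the generators.\<close>

definition unit_vectors :: "nat \<Rightarrow> nc_poly set set" where
  "unit_vectors N =
     {presented_class {1..N} (clifford_rels N) (\<Sum>i = 1..N. scal (of_real (x i)) * gen i)
        | x :: nat \<Rightarrow> real. (\<Sum>i = 1..N. (x i)\<^sup>2) = 1}"

text \<open>
  Conjugation by a unit vector \<open>v\<close> sends a vector \<open>x\<close> to \<open>- r_v x\<close>, where \<open>r_v\<close> is the
  reflection in the hyperplane orthogonal to \<open>v\<close>. For even \<open>N\<close> the maps \<open>- r_v\<close> generate
  \<open>O(N)\<close>, and conjugation is the two-fold covering from \<open>Pin N\<close> to \<open>O(N)\<close>: a lift of \<open>g\<close>
  acts on the generating vector space of \<open>Cl N\<close> as \<open>g\<close>. Likewise conjugation is the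
  two-fold covering from \<open>Spin N\<close> to \<open>SO(N)\<close>, for every \<open>N \<ge> 2\<close>.
\<close>

definition Pin :: "nat \<Rightarrow> nc_poly set set" where
  "Pin N = generate (units_of (Cl N)) (unit_vectors N)"

definition Spin :: "nat \<Rightarrow> nc_poly set set" where
  "Spin N = generate (units_of (Cl N))
     {v \<otimes>\<^bsub>Cl N\<^esub> w | v w. v \<in> unit_vectors N \<and> w \<in> unit_vectors N}"


section \<open>Spinor representation and its tensor powers\<close>

definition cmat_alg :: "(complex, complex^'n^'n) module" where
  "cmat_alg = \<lparr>carrier = UNIV, monoid.mult = (**), one = mat 1, zero = 0, add = (+),
     smult = (\<lambda>c A. \<chi> i j. c * A $ i $ j)\<rparr>"

definition simple_rep :: "(complex, 'a) module \<Rightarrow> ('a \<Rightarrow> complex^'n^'n) \<Rightarrow> bool" where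
  "simple_rep A \<rho> \<longleftrightarrow> \<rho> \<in> alg_hom A cmat_alg \<and>
     (\<forall>W. vec.subspace W \<and> (\<forall>x\<in>carrier A. \<forall>w\<in>W. \<rho> x *v w \<in> W)
        \<longrightarrow> W = {0} \<or> W = UNIV)"

text \<open>
  With \<open>V = complex^'n\<close>, the tensor power of \<open>V\<close> whose factors are indexed by the finite
  type \<open>'l\<close> has the basis of elementary tensors of basis vectors, which is indexed by
  \<open>'l \<Rightarrow> 'n\<close>. The following is the matrix, in this basis, of the tensor power of an
  operator on \<open>V\<close>.
\<close>

definition tensor_power :: "complex^'n^'n \<Rightarrow> complex^('l::finite \<Rightarrow> 'n)^('l \<Rightarrow> 'n)" where
  "tensor_power A = (\<chi> f g. \<Prod>a\<in>UNIV. A $ f a $ g a)"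

definition End_tensor_power ::
    "'g set \<Rightarrow> ('g \<Rightarrow> complex^'n^'n) \<Rightarrow> (complex, complex^('l::finite \<Rightarrow> 'n)^('l \<Rightarrow> 'n)) module"
  where
  "End_tensor_power G \<rho> =
     cmat_alg\<lparr>carrier := {X. \<forall>g\<in>G. X ** tensor_power (\<rho> g) = tensor_power (\<rho> g) ** X}\<rparr>"

end

theory Submission
  imports Defs
begin

text \<open>
  Let \<open>e\<^sub>1, \<dots>, e\<^sub>N\<close> be the Clifford generators acting on the spinors and put
  \<open>C\<^sub>a\<^sub>b = \<Sum>\<^sub>i e\<^sub>i \<otimes> e\<^sub>i\<close>, acting in the tensor factors \<open>a\<close> and \<open>b\<close>. The main point is that these
  operators generate the commutant of the Pin (for odd \<open>N\<close>: Spin) group. Products of the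
  generators identify the operators on the tensor power with a tensor product of exterior algebras,
  on which the orthogonal group acts, and one needs the first fundamental theorem there. It is proved
  by a Casimir argument: for an invariant \<open>f\<close> that is annihilated by all contractions between
  different factors, \<open>\<Sum>\<^sub>i\<^sub>j \<parallel>E\<^sub>i\<^sub>j f\<parallel>\<^sup>2 = \<Sum>\<^sub>i \<langle>E\<^sub>i\<^sub>i f, f\<rangle>\<close>, while invariance under sign changes makes
  the eigenvalues of the number operators \<open>E\<^sub>i\<^sub>i\<close> even, so that \<open>E\<^sub>i\<^sub>i\<^sup>2 \<ge> 2 E\<^sub>i\<^sub>i\<close>; hence \<open>f\<close> is a
  multiple of the vacuum.

  The operators \<open>C\<^sub>a\<^sub>b / 2\<close> do not satisfy the relations of the \<open>D\<^sub>i\<close> themselves, since different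
  tensor factors commute. For even \<open>N\<close> one multiplies every other one of them by the product of the
  commuting involutions \<open>e\<^sub>i \<otimes> e\<^sub>i\<close>, which is a polynomial in \<open>C\<^sub>a\<^sub>b\<close>. For odd \<open>N\<close> that product is a
  scalar; then \<open>C\<^sub>a\<^sub>b\<close> is a polynomial in its square, and an auxiliary tensor factor supplies the
  signs without affecting the squares.
\<close>

section \<open>Creation and annihilation operators\<close>

text \<open>The passage from the harmonic case to all invariants is a degree argument:
  \<open>C_ab\<close> is the double creation operator of the factors \<open>a\<close> and
  \<open>b\<close> plus terms that do not raise the degree. The part of an invariant orthogonal to
  everything already generated is therefore killed by all contractions between different factors,
  hence a multiple of the vacuum. The obstacle is odd \<open>N\<close>: there the monomials in the
  generators are linearly dependent, so operators are written in monomials of even length. This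
  normal form also supplies the parity that the Casimir argument needs and that products of two
  generators alone do not give. The factor 1/2 in \<open>C_ab / 2\<close> makes half a sum of
  \<open>N\<close> commuting involutions, with eigenvalues among
  \<open>N/2, N/2 - 1, ..., -N/2\<close>, the roots prescribed for \<open>U\<close> and
  \<open>Uo\<close>; the double commutator relation asks for the same normalization. Neighbouring
  factors suffice, because the anticommutator of \<open>C_ab\<close> and \<open>C_bc\<close> is
  \<open>2 C_ac\<close>.\<close>

class complex_alg = ring_1 +
  fixes of_complex :: "complex \<Rightarrow> 'a"
  assumes of_complex_add: "of_complex (c + d) = of_complex c + of_complex d"
    and of_complex_mult: "of_complex (c * d) = of_complex c * of_complex d"
    and of_complex_1 [simp]: "of_complex 1 = 1"
    and of_complex_commute: "of_complex c * x = x * of_complex c"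
begin

lemma of_complex_0 [simp]: "of_complex 0 = 0"
  using of_complex_add[of 0 0] by simp

lemma of_complex_minus: "of_complex (- c) = - of_complex c"
  using of_complex_add[of c "- c"] by (simp add: eq_neg_iff_add_eq_0 add.commute)

lemma of_complex_minus_1 [simp]: "of_complex (- 1) = - 1"
  by (simp add: of_complex_minus)

lemma of_complex_diff: "of_complex (c - d) = of_complex c - of_complex d"
  using of_complex_add[of c "- d"] by (simp add: of_complex_minus)

lemma of_complex_left_commute: "x * (of_complex c * y) = of_complex c * (x * y)"
  by (metis mult.assoc of_complex_commute)

lemma of_complex_inverse_cancel: "c \<noteq> 0 \<Longrightarrow> of_complex (inverse c) * (of_complex c * x) = x"
  by (simp flip: mult.assoc of_complex_mult)

end

lemma of_complex_sum: "of_complex (sum f I) = (\<Sum>i\<in>I. of_complex (f i) :: 'a::complex_alg)"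
  by (induction I rule: infinite_finite_induct) (auto simp: of_complex_add)

lemma of_complex_2 [simp]: "of_complex 2 = (2 :: 'a::complex_alg)"
  using of_complex_add[of 1 1, where 'a='a] by simp

section \<open>Linear operators on coefficient functions\<close>

typedef 'a endo = "{F :: ('a \<Rightarrow> complex) \<Rightarrow> 'a \<Rightarrow> complex.
    (\<forall>f g. F (\<lambda>x. f x + g x) = (\<lambda>x. F f x + F g x)) \<and> (\<forall>c f. F (\<lambda>x. c * f x) = (\<lambda>x. c * F f x))}"
  morphisms act Abs_endo
  by (rule exI[of _ id]) auto

setup_lifting type_definition_endo

instantiation endo :: (type) complex_alg
begin

lift_definition zero_endo :: "'a endo" is "\<lambda>f x. 0" by simp
lift_definition one_endo :: "'a endo" is "\<lambda>f. f" by simp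
lift_definition plus_endo :: "'a endo \<Rightarrow> 'a endo \<Rightarrow> 'a endo" is "\<lambda>F G f x. F f x + G f x"
  by (auto simp: fun_eq_iff algebra_simps)
lift_definition minus_endo :: "'a endo \<Rightarrow> 'a endo \<Rightarrow> 'a endo" is "\<lambda>F G f x. F f x - G f x"
  by (auto simp: fun_eq_iff algebra_simps)
lift_definition uminus_endo :: "'a endo \<Rightarrow> 'a endo" is "\<lambda>F f x. - F f x"
  by (auto simp: fun_eq_iff algebra_simps)
lift_definition times_endo :: "'a endo \<Rightarrow> 'a endo \<Rightarrow> 'a endo" is "\<lambda>F G f. F (G f)"
  by auto
lift_definition of_complex_endo :: "complex \<Rightarrow> 'a endo" is "\<lambda>c f x. c * f x"
  by (auto simp: fun_eq_iff algebra_simps)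

instance
proof
  show "(0 :: 'a endo) \<noteq> 1"
    by transfer (metis zero_neq_one)
qed (transfer; auto simp: fun_eq_iff algebra_simps)+

end

lemma act_add: "act F (\<lambda>x. f x + g x) = (\<lambda>x. act F f x + act F g x)"
  by transfer auto

lemma act_scale: "act F (\<lambda>x. c * f x) = (\<lambda>x. c * act F f x)"
  by transfer auto

lemma act_zero: "act F (\<lambda>x. 0) = (\<lambda>x. 0)"
  using act_scale[of F 0 "\<lambda>x. 0"] by simp

lemma act_simps [simp]:
  "act 0 f = (\<lambda>x. 0)" "act 1 f = f"
  "act (F + G) f = (\<lambda>x. act F f x + act G f x)"
  "act (F - G) f = (\<lambda>x. act F f x - act G f x)"
  "act (- F) f = (\<lambda>x. - act F f x)"
  "act (F * G) f = act F (act G f)"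
  "act (of_complex c) f = (\<lambda>x. c * f x)"
  by (transfer, simp)+

lemma act_sum: "act (\<Sum>i\<in>I. F i) f = (\<lambda>x. \<Sum>i\<in>I. act (F i) f x)"
  by (induction I rule: infinite_finite_induct) auto

lemma endo_eqI: "(\<And>f x. act F f x = act G f x) \<Longrightarrow> F = G"
  by (metis act_inject ext)

section \<open>Clifford multiplication on the basis of subsets\<close>

definition toggle :: "nat \<Rightarrow> nat set \<Rightarrow> nat set" where
  "toggle i B = (if i \<in> B then B - {i} else insert i B)"

text \<open>The sign picked up when the generator \<open>i\<close> is moved from the left to its
  place in the increasing product over \<open>B\<close>: it passes exactly the smaller
  generators.\<close>

definition sg :: "nat \<Rightarrow> nat set \<Rightarrow> complex" where
  "sg i B = (-1) ^ card {j \<in> B. j < i}"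

text \<open>
  The coefficient functions \<open>f :: ('l \<Rightarrow> nat set) \<Rightarrow> complex\<close> stand for elements of the tensor
  product of \<open>'l\<close> copies of an exterior algebra; \<open>cliff a i\<close> is left Clifford multiplication
  by the generator \<open>i\<close> in the tensor factor \<open>a\<close>. Different factors commute.
\<close>

lift_definition cliff :: "'l \<Rightarrow> nat \<Rightarrow> ('l \<Rightarrow> nat set) endo" is
  "\<lambda>a i f A. sg i (A a) * f (A(a := toggle i (A a)))"
  by (auto simp: fun_eq_iff algebra_simps)

lift_definition num :: "'l \<Rightarrow> nat \<Rightarrow> ('l \<Rightarrow> nat set) endo" is
  "\<lambda>a i f A. if i \<in> A a then f A else 0"
  by (auto simp: fun_eq_iff algebra_simps)

lemma act_cliff: "act (cliff a i) f A = sg i (A a) * f (A(a := toggle i (A a)))"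
  by transfer simp

lemma act_num: "act (num a i) f A = (if i \<in> A a then f A else 0)"
  by transfer simp

lemma toggle_toggle [simp]: "toggle i (toggle i B) = B"
  by (auto simp: toggle_def)

lemma toggle_commute: "toggle i (toggle j B) = toggle j (toggle i B)"
  by (auto simp: toggle_def)

lemma mem_toggle [simp]: "j \<in> toggle i B \<longleftrightarrow> (if i = j then j \<notin> B else j \<in> B)"
  by (auto simp: toggle_def)

lemma sg_toggle_same [simp]: "sg i (toggle i B) = sg i B"
  unfolding sg_def toggle_def by (rule arg_cong[where f="\<lambda>S. (-1) ^ card S"]) auto

lemma sg_sq [simp]: "sg i B * sg i B = 1"
  by (simp add: sg_def flip: power_add mult_2)

lemma sg_toggle_less: assumes "j < i" shows "sg i (toggle j B) = - sg i B"
proof -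
  have fin: "finite {k \<in> B. k < i}" by simp
  show ?thesis
  proof (cases "j \<in> B")
    case True
    have "{k \<in> B. k < i} = insert j {k \<in> toggle j B. k < i}"
      using True assms by (auto simp: toggle_def)
    moreover have "finite {k \<in> toggle j B. k < i}" by simp
    ultimately have "card {k \<in> B. k < i} = Suc (card {k \<in> toggle j B. k < i})"
      using True by (metis (no_types, lifting) card_insert_disjoint mem_Collect_eq mem_toggle)
    then show ?thesis by (simp add: sg_def)
  next
    case False
    have "{k \<in> toggle j B. k < i} = insert j {k \<in> B. k < i}"
      using False assms by (auto simp: toggle_def)
    then have "card {k \<in> toggle j B. k < i} = Suc (card {k \<in> B. k < i})"
      using False fin by simp
    then show ?thesis by (simp add: sg_def)
  qed
qed

lemma sg_toggle_greater: "i < j \<Longrightarrow> sg i (toggle j B) = sg i B"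
  unfolding sg_def toggle_def by (rule arg_cong[where f="\<lambda>S. (-1) ^ card S"]) auto

text \<open>Toggling the smaller of the two indices flips the sign belonging to the larger one, and
  toggling the larger has no effect on the smaller. All anticommutation rules below come from this
  one flip.\<close>

lemma sg_anticommute:
  assumes "i \<noteq> j" shows "sg i B * sg j (toggle i B) = - (sg j B * sg i (toggle j B))"
  using assms by (cases "i < j") (auto simp: sg_toggle_less sg_toggle_greater)

lemma cliff_sq [simp]: "cliff a i * cliff a i = 1"
  by (rule endo_eqI) (simp add: act_cliff flip: mult.assoc)

lemma cliff_anticommute: "i \<noteq> j \<Longrightarrow> cliff a i * cliff a j = - (cliff a j * cliff a i)"
  by (rule endo_eqI)
    (simp add: act_cliff sg_anticommute[of i j] toggle_commute[of i j] flip: mult.assoc)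

lemma num_sq [simp]: "num a i * num a i = num a i"
  by (rule endo_eqI) (simp add: act_num)

lemma num_commute: "num a i * num b j = num b j * num a i"
  by (rule endo_eqI) (simp add: act_num)

lemma num_cliff_same: "num a i * cliff a i = cliff a i * (1 - num a i)"
  by (rule endo_eqI) (simp add: act_num act_cliff)

lemma num_cliff: "(a, i) \<noteq> (b, j) \<Longrightarrow> num a i * cliff b j = cliff b j * num a i"
  by (rule endo_eqI) (auto simp: act_num act_cliff)

text \<open>Exterior multiplication by, and contraction with, the basis vector \<open>i\<close> in
  the factor \<open>a\<close>: the parts of Clifford multiplication that raise and lower the
  degree.\<close>

definition cre :: "'l \<Rightarrow> nat \<Rightarrow> ('l \<Rightarrow> nat set) endo" where "cre a i = num a i * cliff a i"
definition ann :: "'l \<Rightarrow> nat \<Rightarrow> ('l \<Rightarrow> nat set) endo" where "ann a i = cliff a i * num a i"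

lemma cliff_eq: "cliff a i = cre a i + ann a i"
  by (simp add: cre_def ann_def num_cliff_same algebra_simps)

lemma act_cre: "act (cre a i) f A = (if i \<in> A a then sg i (A a) * f (A(a := A a - {i})) else 0)"
  by (simp add: cre_def act_num act_cliff toggle_def)

lemma act_ann: "act (ann a i) f A = (if i \<in> A a then 0 else sg i (A a) * f (A(a := insert i (A a))))"
  by (simp add: ann_def act_num act_cliff toggle_def)

text \<open>Written with \<open>toggle\<close> in place of deletion and insertion, both operators
  fall under \<open>sg_anticommute\<close>.\<close>

lemma act_cre': "act (cre a i) f A = (if i \<in> A a then sg i (A a) * f (A(a := toggle i (A a))) else 0)"
  by (simp add: cre_def act_num act_cliff)

lemma act_ann': "act (ann a i) f A = (if i \<in> A a then 0 else sg i (A a) * f (A(a := toggle i (A a))))"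
  by (simp add: ann_def act_num act_cliff)

lemma cre_ann_same: "ann a i * cre a i + cre a i * ann a i = 1"
  by (rule endo_eqI) (auto simp: act_cre' act_ann' simp flip: mult.assoc)

lemma cre_sq [simp]: "cre a i * cre a i = 0"
  by (rule endo_eqI) (auto simp: act_cre')

lemma ann_sq [simp]: "ann a i * ann a i = 0"
  by (rule endo_eqI) (auto simp: act_ann')

lemma cre_cre: "cre a i * cre a j = - (cre a j * cre a i)"
  by (cases "i = j", simp, rule endo_eqI)
    (simp add: act_cre' sg_anticommute[of i j] toggle_commute[of i j] flip: mult.assoc)

lemma ann_ann: "ann a i * ann a j = - (ann a j * ann a i)"
  by (cases "i = j", simp, rule endo_eqI)
    (simp add: act_ann' sg_anticommute[of i j] toggle_commute[of i j] flip: mult.assoc)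

lemma ann_cre: "ann a i * cre a j = (if i = j then 1 else 0) - cre a j * ann a i"
proof (cases "i = j")
  case True
  then show ?thesis using cre_ann_same[of a i] by (simp add: algebra_simps)
next
  case False
  have "ann a i * cre a j = - (cre a j * ann a i)"
    by (rule endo_eqI)
      (use False in \<open>simp add: act_ann' act_cre' sg_anticommute[of i j] toggle_commute[of i j] flip: mult.assoc\<close>)
  with False show ?thesis by simp
qed

lemma ladder_commute:
  assumes "a \<noteq> b"
  shows "cre a i * cre b j = cre b j * cre a i" "ann a i * ann b j = ann b j * ann a i"
    "cre a i * ann b j = ann b j * cre a i" "ann a i * cre b j = cre b j * ann a i"
  using assms by (auto intro!: endo_eqI simp: act_cre' act_ann' fun_upd_twist)

section \<open>Orthogonal invariants in a tensor product of exterior algebras\<close>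

text \<open>The elementary matrix \<open>E_ij\<close> of the general linear Lie algebra, acting as a
  derivation on each exterior algebra and summed over the tensor factors.\<close>

definition gl :: "nat \<Rightarrow> nat \<Rightarrow> ('l::finite \<Rightarrow> nat set) endo" where
  "gl i j = (\<Sum>a\<in>UNIV. cre a i * ann a j)"

definition so :: "nat \<Rightarrow> nat \<Rightarrow> ('l::finite \<Rightarrow> nat set) endo" where
  "so i j = gl i j - gl j i"

text \<open>The Euclidean form inserted between the factors \<open>a\<close> and \<open>b\<close>.
  Leaving \<open>X\<close> and \<open>Y\<close> open treats double creation, double contraction and
  both mixed operators at once.\<close>

definition contr :: "nat \<Rightarrow> ('l::finite \<Rightarrow> nat \<Rightarrow> ('l \<Rightarrow> nat set) endo) \<Rightarrow>
    ('l \<Rightarrow> nat \<Rightarrow> ('l \<Rightarrow> nat set) endo) \<Rightarrow> 'l \<Rightarrow> 'l \<Rightarrow> ('l \<Rightarrow> nat set) endo" where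
  "contr N X Y a b = (\<Sum>k=1..N. X a k * Y b k)"

lemma gl_cre: "gl i j * cre a k = cre a k * gl i j + (if j = k then cre a i else 0)"
proof -
  have same: "cre a i * ann a j * cre a k = cre a k * (cre a i * ann a j) + (if j = k then cre a i else 0)"
  proof -
    have "cre a i * ann a j * cre a k = (if j = k then cre a i else 0) - (cre a i * cre a k) * ann a j"
      by (simp add: mult.assoc ann_cre algebra_simps)
    also have "cre a i * cre a k = - (cre a k * cre a i)" by (rule cre_cre)
    finally show ?thesis by (simp add: algebra_simps)
  qed
  have other: "cre b i * ann b j * cre a k = cre a k * (cre b i * ann b j)" if "b \<noteq> a" for b
    using ladder_commute[OF that] by (metis mult.assoc)
  have "gl i j * cre a k = (\<Sum>b\<in>UNIV. cre b i * ann b j * cre a k)"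
    by (simp add: gl_def sum_distrib_right)
  also have "\<dots> = (\<Sum>b\<in>UNIV. cre a k * (cre b i * ann b j) + (if b = a then if j = k then cre a i else 0 else 0))"
    by (rule sum.cong) (use same other in auto)
  finally show ?thesis
    by (simp add: sum.distrib gl_def sum_distrib_left)
qed

lemma gl_ann: "gl i j * ann a k = ann a k * gl i j - (if i = k then ann a j else 0)"
proof -
  have same: "cre a i * ann a j * ann a k = ann a k * (cre a i * ann a j) - (if i = k then ann a j else 0)"
  proof -
    have "ann a k * (cre a i * ann a j) = (ann a k * cre a i) * ann a j" by (simp add: mult.assoc)
    also have "\<dots> = (if i = k then ann a j else 0) - cre a i * (ann a k * ann a j)"
      by (simp add: ann_cre algebra_simps)
    also have "ann a k * ann a j = - (ann a j * ann a k)" by (rule ann_ann)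
    finally show ?thesis by (simp add: algebra_simps)
  qed
  have other: "cre b i * ann b j * ann a k = ann a k * (cre b i * ann b j)" if "b \<noteq> a" for b
    using ladder_commute[OF that] by (metis mult.assoc)
  have "gl i j * ann a k = (\<Sum>b\<in>UNIV. cre b i * ann b j * ann a k)"
    by (simp add: gl_def sum_distrib_right)
  also have "\<dots> = (\<Sum>b\<in>UNIV. ann a k * (cre b i * ann b j) - (if b = a then if i = k then ann a j else 0 else 0))"
    by (rule sum.cong) (use same other in auto)
  finally show ?thesis
    by (simp add: sum_subtractf gl_def sum_distrib_left)
qed

text \<open>Under \<open>gl\<close> the creators transform as vectors and the annihilators as
  covectors; on the antisymmetric combinations the two laws agree, since the vector representation
  of the orthogonal Lie algebra is self-dual.\<close>

lemma so_ladder: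
  assumes "X = cre \<or> X = ann"
  shows "so i j * X a k = X a k * so i j + (if j = k then X a i else 0) - (if i = k then X a j else 0)"
  using assms by (auto simp: so_def left_diff_distrib right_diff_distrib gl_cre gl_ann)

text \<open>The correction terms arise only at \<open>k = i\<close> and \<open>k = j\<close>; they
  are equal and enter with opposite signs. This is the infinitesimal invariance of the Euclidean
  form.\<close>

lemma so_contr:
  assumes X: "X = cre \<or> X = ann" and Y: "Y = cre \<or> Y = ann" and ij: "i \<in> {1..N}" "j \<in> {1..N}"
  shows "so i j * contr N X Y a b = contr N X Y a b * so i j"
proof -
  have "so i j * (X a k * Y b k) = X a k * Y b k * so i j
      + (if k = j then X a i * Y b j + X a j * Y b i else 0)
      - (if k = i then X a j * Y b i + X a i * Y b j else 0)" for k
  proof -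
    have "so i j * (X a k * Y b k) = (so i j * X a k) * Y b k" by (simp add: mult.assoc)
    also have "\<dots> = X a k * (so i j * Y b k) + (if j = k then X a i * Y b k else 0) - (if i = k then X a j * Y b k else 0)"
      by (simp add: so_ladder[OF X] algebra_simps)
    finally show ?thesis
      by (auto simp: so_ladder[OF Y] algebra_simps)
  qed
  then show ?thesis
    using ij by (simp add: contr_def sum_distrib_left sum_distrib_right sum.distrib sum_subtractf)
qed

lemma gl_same: "act (gl i i) f A = of_nat (card {a. i \<in> A a}) * f (A :: 'l::finite \<Rightarrow> nat set)"
proof -
  have "cre a i * ann a i = num a i" for a :: 'l
    by (rule endo_eqI) (simp add: act_cre' act_ann' act_num flip: mult.assoc)
  then have "act (gl i i) f A = (\<Sum>a\<in>UNIV. if i \<in> A a then f A else 0)"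
    by (simp add: gl_def act_sum act_num)
  then show ?thesis by (simp add: sum.If_cases)
qed

text \<open>Normal ordering. Within one factor \<open>E_ji\<close> squared has two equal creators in
  a row unless \<open>i = j\<close>; between two factors the sums over \<open>i\<close> and
  \<open>j\<close> separate into a product of two contractions. Squares of \<open>E_ji\<close>
  appear, and not \<open>E_ji E_ij\<close>, because on invariants the two act alike and only the
  squares separate in this way.\<close>

lemma gl_casimir:
  "(\<Sum>i=1..N. \<Sum>j=1..N. gl j i * gl j i) =
     (\<Sum>i=1..N. gl i i) +
     (\<Sum>a\<in>UNIV. \<Sum>b\<in>UNIV - {a}. contr N cre cre a b * contr N ann ann a b)"
proof -
  have same: "cre a j * ann a i * (cre a j * ann a i) = (if i = j then cre a j * ann a i else 0)" for a :: 'l and i j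
  proof -
    have "cre a j * ann a i * (cre a j * ann a i) = cre a j * (ann a i * cre a j) * ann a i"
      by (simp add: mult.assoc)
    also have "\<dots> = (if i = j then cre a j * ann a i else 0) - (cre a j * cre a j) * (ann a i * ann a i)"
      unfolding ann_cre by (simp add: algebra_simps)
    finally show ?thesis by simp
  qed
  have other: "cre a j * ann a i * (cre b j * ann b i) = cre a j * cre b j * (ann a i * ann b i)"
    if "a \<noteq> b" for a b :: 'l and i j
    using ladder_commute[OF that] by (metis mult.assoc)
  have gg: "gl j i * gl j i = (\<Sum>a\<in>UNIV. if i = j then cre a j * ann a i else 0)
      + (\<Sum>a\<in>UNIV. \<Sum>b\<in>UNIV - {a}. cre a j * cre b j * (ann a i * ann b (i::nat)))" for i j
  proof -
    have "gl j i * gl j i = (\<Sum>a\<in>UNIV. \<Sum>b\<in>UNIV. cre a j * ann a i * (cre b j * ann b i))"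
      by (simp add: gl_def sum_product)
    also have "\<dots> = (\<Sum>a\<in>UNIV. cre a j * ann a i * (cre a j * ann a i)
        + (\<Sum>b\<in>UNIV - {a}. cre a j * ann a i * (cre b j * ann b i)))"
      by (rule sum.cong[OF refl]) (rule sum.remove; simp)
    also have "\<dots> = (\<Sum>a\<in>UNIV. (if i = j then cre a j * ann a i else 0)
        + (\<Sum>b\<in>UNIV - {a}. cre a j * cre b j * (ann a i * ann b i)))"
      by (intro sum.cong refl arg_cong2[where f="(+)"] same) (auto intro: other)
    finally show ?thesis by (simp add: sum.distrib)
  qed
  have "(\<Sum>i=1..N. \<Sum>j=1..N. \<Sum>a\<in>UNIV. \<Sum>b\<in>UNIV - {a}. cre a j * cre b j * (ann a i * ann b (i::nat)))
      = (\<Sum>a\<in>UNIV. \<Sum>i=1..N. \<Sum>j=1..N. \<Sum>b\<in>UNIV - {a}. cre a j * cre b j * (ann a i * ann b (i::nat)))"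
    by (simp add: sum.swap[of _ UNIV])
  also have "\<dots> = (\<Sum>a\<in>UNIV. \<Sum>b\<in>UNIV - {a}. \<Sum>i=1..N. \<Sum>j=1..N. cre a j * cre b j * (ann a i * ann b (i::nat)))"
    by (simp add: sum.swap[of _ "UNIV - {_}"])
  also have "\<dots> = (\<Sum>a\<in>UNIV. \<Sum>b\<in>UNIV - {a}. contr N cre cre a b * contr N ann ann a b)"
    by (intro sum.cong refl) (simp add: contr_def sum_product, rule sum.swap)
  finally have offdiag: "(\<Sum>i=1..N. \<Sum>j=1..N. \<Sum>a\<in>UNIV. \<Sum>b\<in>UNIV - {a}. cre a j * cre b j * (ann a i * ann b (i::nat)))
      = (\<Sum>a\<in>UNIV. \<Sum>b\<in>UNIV - {a}. contr N cre cre a b * contr N ann ann a b)" .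
  have diag: "(\<Sum>i=1..N. \<Sum>j=1..N. \<Sum>a\<in>UNIV. if i = j then cre a j * ann a i else 0) = (\<Sum>i=1..N. gl i i)"
  proof (intro sum.cong refl)
    fix i assume "i \<in> {1..N}"
    then show "(\<Sum>j=1..N. \<Sum>a\<in>UNIV. if i = j then cre a j * ann a i else 0) = gl i i"
      by (subst sum.swap) (simp add: gl_def)
  qed
  show ?thesis
    unfolding gg sum.distrib offdiag diag ..
qed

section \<open>Hermitian form and adjoint operators\<close>

definition configs :: "nat \<Rightarrow> ('l::finite \<Rightarrow> nat set) set" where
  "configs N = {A. \<forall>a. A a \<subseteq> {1..N}}"

lemma finite_configs [simp]: "finite (configs N :: ('l::finite \<Rightarrow> nat set) set)"
proof -
  have "(configs N :: ('l \<Rightarrow> nat set) set) = (\<Pi>\<^sub>E a\<in>UNIV. Pow {1..N})" by (auto simp: configs_def PiE_def)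
  then show ?thesis by (simp only:) (rule finite_PiE; simp)
qed

lemma configs_toggle: "A \<in> configs N \<Longrightarrow> i \<in> {1..N} \<Longrightarrow> A(a := toggle i (A a)) \<in> configs N"
  by (auto simp: configs_def toggle_def)

lemma configs_toggle_iff: "i \<in> {1..N} \<Longrightarrow> A(a := toggle i (A a)) \<in> configs N \<longleftrightarrow> A \<in> configs N"
  using configs_toggle[of A N i a] configs_toggle[of "A(a := toggle i (A a))" N i a] by auto

definition ip :: "'x set \<Rightarrow> ('x \<Rightarrow> complex) \<Rightarrow> ('x \<Rightarrow> complex) \<Rightarrow> complex" where
  "ip F f g = (\<Sum>A\<in>F. f A * cnj (g A))"

lemma ip_add_left: "ip F (\<lambda>A. f A + f' A) g = ip F f g + ip F f' g"
  and ip_add_right: "ip F f (\<lambda>A. g A + g' A) = ip F f g + ip F f g'"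
  and ip_diff_left: "ip F (\<lambda>A. f A - f' A) g = ip F f g - ip F f' g"
  and ip_diff_right: "ip F f (\<lambda>A. g A - g' A) = ip F f g - ip F f g'"
  and ip_scale_left: "ip F (\<lambda>A. c * f A) g = c * ip F f g"
  and ip_scale_right: "ip F f (\<lambda>A. c * g A) = cnj c * ip F f g"
  by (simp_all add: ip_def algebra_simps sum.distrib sum_subtractf sum_distrib_left)

lemma ip_zero [simp]: "ip F (\<lambda>A. 0) g = 0" "ip F f (\<lambda>A. 0) = 0"
  by (simp_all add: ip_def)

lemma ip_sum_right: "ip F f (\<lambda>A. \<Sum>i\<in>I. g i A) = (\<Sum>i\<in>I. ip F f (g i))"
  by (induction I rule: infinite_finite_induct) (simp_all add: ip_add_right)

lemma ip_sum_left: "ip F (\<lambda>A. \<Sum>i\<in>I. g i A) f = (\<Sum>i\<in>I. ip F (g i) f)"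
  by (induction I rule: infinite_finite_induct) (simp_all add: ip_add_left)

lemma ip_self: "ip F f f = of_real (\<Sum>A\<in>F. (cmod (f A))\<^sup>2)"
  unfolding ip_def of_real_sum by (rule sum.cong) (auto simp only: complex_norm_square)

lemma ip_self_eq_0:
  assumes "finite F" "ip F f f = 0" "A \<in> F" shows "f A = 0"
proof -
  have "(\<Sum>A\<in>F. (cmod (f A))\<^sup>2) = 0" using assms(2) unfolding ip_self of_real_eq_0_iff .
  then have "(cmod (f A))\<^sup>2 = 0"
    using assms(1,3) by (subst (asm) sum_nonneg_eq_0_iff) auto
  then show ?thesis by simp
qed

definition adjoint_pair :: "nat \<Rightarrow> ('l::finite \<Rightarrow> nat set) endo \<Rightarrow> ('l \<Rightarrow> nat set) endo \<Rightarrow> bool" where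
  "adjoint_pair N F G \<longleftrightarrow> (\<forall>f g. ip (configs N) (act F f) g = ip (configs N) f (act G g))"

lemma adjoint_num: "adjoint_pair N (num a i) (num a i)"
  by (auto simp: adjoint_pair_def ip_def act_num intro: sum.cong)

lemma cnj_sg [simp]: "cnj (sg i B) = sg i B"
  by (simp add: sg_def)

lemma adjoint_cliff:
  assumes "i \<in> {1..N}" shows "adjoint_pair N (cliff a i) (cliff a i)"
  unfolding adjoint_pair_def ip_def act_cliff
proof (intro allI)
  fix f g :: "('a \<Rightarrow> nat set) \<Rightarrow> complex"
  show "(\<Sum>A\<in>configs N. sg i (A a) * f (A(a := toggle i (A a))) * cnj (g A)) =
        (\<Sum>A\<in>configs N. f A * cnj (sg i (A a) * g (A(a := toggle i (A a)))))"
    by (rule sum.reindex_bij_witness[of _ "\<lambda>A. A(a := toggle i (A a))" "\<lambda>A. A(a := toggle i (A a))"])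
      (use assms in \<open>auto simp: configs_toggle_iff cnj_sg mult.commute\<close>)
qed

lemma adjoint_mult: "adjoint_pair N F G \<Longrightarrow> adjoint_pair N F' G' \<Longrightarrow> adjoint_pair N (F * F') (G' * G)"
  by (simp add: adjoint_pair_def)

lemma adjoint_sum: "(\<And>i. i \<in> I \<Longrightarrow> adjoint_pair N (F i) (G i)) \<Longrightarrow> adjoint_pair N (sum F I) (sum G I)"
  unfolding adjoint_pair_def act_sum ip_sum_left ip_sum_right by auto

lemma adjoint_cre: "i \<in> {1..N} \<Longrightarrow> adjoint_pair N (cre a i) (ann a i)"
  unfolding cre_def ann_def by (intro adjoint_mult adjoint_num adjoint_cliff)

lemma adjoint_ann: "i \<in> {1..N} \<Longrightarrow> adjoint_pair N (ann a i) (cre a i)"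
  unfolding cre_def ann_def by (intro adjoint_mult adjoint_num adjoint_cliff)

lemma adjoint_gl: "i \<in> {1..N} \<Longrightarrow> j \<in> {1..N} \<Longrightarrow> adjoint_pair N (gl i j) (gl j i)"
  unfolding gl_def by (intro adjoint_sum adjoint_mult adjoint_cre adjoint_ann)

text \<open>Taking adjoints reverses the two factors of each summand; the annihilators can be put
  back in order because they sit in different tensor factors.\<close>

lemma adjoint_contr:
  assumes "a \<noteq> b"
  shows "adjoint_pair N (contr N cre cre a b) (contr N ann ann a b)"
proof -
  have "adjoint_pair N (contr N cre cre a b) (\<Sum>k=1..N. ann b k * ann a k)"
    unfolding contr_def by (intro adjoint_sum adjoint_mult adjoint_cre)
  then show ?thesis
    unfolding contr_def by (simp add: ladder_commute(2)[OF assms])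
qed

text \<open>The invariants of the full orthogonal group: the parity condition is invariance under
  changing the sign of a single coordinate, the \<open>so\<close> condition is infinitesimal
  invariance under rotations.\<close>

definition invariant :: "nat \<Rightarrow> (('l::finite \<Rightarrow> nat set) \<Rightarrow> complex) \<Rightarrow> bool" where
  "invariant N f \<longleftrightarrow> (\<forall>A. f A \<noteq> 0 \<longrightarrow> A \<in> configs N \<and> (\<forall>i. even (card {a. i \<in> A a}))) \<and>
     (\<forall>i\<in>{1..N}. \<forall>j\<in>{1..N}. act (so i j) f = (\<lambda>A. 0))"

lemma harmonic_invariant:
  fixes f :: "('l::finite \<Rightarrow> nat set) \<Rightarrow> complex"
  assumes inv: "invariant N f"
    and harm: "\<And>a b. a \<noteq> b \<Longrightarrow> act (contr N ann ann a b) f = (\<lambda>A. 0)"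
    and A: "f A \<noteq> 0"
  shows "A = (\<lambda>_. {})"
proof -
  let ?C = "configs N :: ('l \<Rightarrow> nat set) set"
  let ?n = "\<lambda>i A. card {a::'l. i \<in> A a}"
  have sym: "act (gl i j) f = act (gl j i) f" if "i \<in> {1..N}" "j \<in> {1..N}" for i j
    using inv that by (auto simp: invariant_def so_def fun_eq_iff)
  have norms: "(\<Sum>i=1..N. \<Sum>j=1..N. ip ?C (act (gl i j) f) (act (gl i j) f)) = (\<Sum>i=1..N. ip ?C f (act (gl i i) f))"
  proof -
    \<comment> \<open>The adjoint of \<open>E_ij\<close> is \<open>E_ji\<close>, and
      \<open>sym\<close> replaces the remaining \<open>E_ij f\<close> by \<open>E_ji f\<close>,
      which produces the squares of \<open>gl_casimir\<close>.\<close>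
    have "(\<Sum>i=1..N. \<Sum>j=1..N. ip ?C (act (gl i j) f) (act (gl i j) f))
        = (\<Sum>i=1..N. \<Sum>j=1..N. ip ?C f (act (gl j i * gl j i) f))"
      by (intro sum.cong refl) (use adjoint_gl in \<open>force simp: adjoint_pair_def sym\<close>)
    also have "\<dots> = ip ?C f (act (\<Sum>i=1..N. \<Sum>j=1..N. gl j i * gl j i) f)"
      by (simp only: act_sum ip_sum_right)
    also have "act (\<Sum>i=1..N. \<Sum>j=1..N. gl j i * gl j i) f = act (\<Sum>i=1..N. gl i i) f"
      unfolding gl_casimir by (simp add: act_sum harm act_zero)
    also have "ip ?C f \<dots> = (\<Sum>i=1..N. ip ?C f (act (gl i i) f))"
      by (simp only: act_sum ip_sum_right)
    finally show ?thesis .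
  qed
  have "(\<Sum>i=1..N. \<Sum>A\<in>?C. (real (?n i A) * cmod (f A))\<^sup>2)
      = (\<Sum>i=1..N. Re (ip ?C (act (gl i i) f) (act (gl i i) f)))"
    by (simp add: ip_self gl_same norm_mult)
  \<comment> \<open>The off-diagonal norms are nonnegative and are dropped, so that only the number
    operators remain.\<close>
  also have "\<dots> \<le> (\<Sum>i=1..N. \<Sum>j=1..N. Re (ip ?C (act (gl i j) f) (act (gl i j) f)))"
    by (intro sum_mono member_le_sum[where f="\<lambda>j. Re (ip ?C (act (gl _ j) f) (act (gl _ j) f))"])
      (auto simp: ip_self intro: sum_nonneg)
  also have "\<dots> = Re (\<Sum>i=1..N. ip ?C f (act (gl i i) f))"
    using norms by (simp flip: Re_sum)
  also have "\<dots> = (\<Sum>i=1..N. \<Sum>A\<in>?C. real (?n i A) * (cmod (f A))\<^sup>2)"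
  proof -
    have "f A * (of_nat m * cnj (f A)) = of_real (real m * (cmod (f A))\<^sup>2)" for m A
      unfolding of_real_mult complex_norm_square by (simp add: algebra_simps)
    then show ?thesis
      by (simp only: ip_def gl_same Re_sum complex_cnj_mult complex_cnj_of_nat Re_complex_of_real)
  qed
  finally have le: "(\<Sum>i=1..N. \<Sum>A\<in>?C. (real (?n i A) * cmod (f A))\<^sup>2) \<le> (\<Sum>i=1..N. \<Sum>A\<in>?C. real (?n i A) * (cmod (f A))\<^sup>2)" .
  have "2 * (\<Sum>i=1..N. \<Sum>A\<in>?C. real (?n i A) * (cmod (f A))\<^sup>2) \<le> (\<Sum>i=1..N. \<Sum>A\<in>?C. (real (?n i A) * cmod (f A))\<^sup>2)"
    unfolding sum_distrib_left
  proof (intro sum_mono)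
    fix i A
    show "2 * (real (?n i A) * (cmod (f A))\<^sup>2) \<le> (real (?n i A) * cmod (f A))\<^sup>2"
    proof (cases "f A = 0")
      case False
      then have "even (?n i A)" using inv by (auto simp: invariant_def)
      then obtain m where m: "?n i A = 2 * m" by (elim evenE)
      have "2 * real (?n i A) \<le> (real (?n i A))\<^sup>2"
        unfolding m by (cases m) (auto simp: power2_eq_square algebra_simps)
      then show ?thesis
        using mult_right_mono[of "2 * real (?n i A)" "(real (?n i A))\<^sup>2" "(cmod (f A))\<^sup>2"]
        by (simp add: power_mult_distrib)
    qed simp
  qed
  \<comment> \<open>Twice a nonnegative sum is bounded by the sum itself, so it vanishes, and with
    it every weighted coefficient.\<close>
  with le have "(\<Sum>i=1..N. \<Sum>A\<in>?C. real (?n i A) * (cmod (f A))\<^sup>2) \<le> 0" by linarith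
  moreover have "(\<Sum>i=1..N. \<Sum>A\<in>?C. real (?n i A) * (cmod (f A))\<^sup>2) \<ge> 0" by (intro sum_nonneg) auto
  ultimately have z: "(\<Sum>i=1..N. \<Sum>A\<in>?C. real (?n i A) * (cmod (f A))\<^sup>2) = 0" by linarith
  have AC: "A \<in> ?C" using inv A by (auto simp: invariant_def)
  have "i \<notin> A a" for i a
  proof
    assume i: "i \<in> A a"
    then have "i \<in> {1..N}" using AC unfolding configs_def by blast
    then have "(\<Sum>A\<in>?C. real (?n i A) * (cmod (f A))\<^sup>2) = 0"
      using z by (subst (asm) sum_nonneg_eq_0_iff) (auto intro: sum_nonneg)
    then have "real (?n i A) * (cmod (f A))\<^sup>2 = 0"
      using AC by (subst (asm) sum_nonneg_eq_0_iff) auto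
    with A i show False by auto
  qed
  then show ?thesis by auto
qed

section \<open>Orthogonal projection\<close>

definition complex_subspace :: "('x \<Rightarrow> complex) set \<Rightarrow> bool" where
  "complex_subspace W \<longleftrightarrow> (\<lambda>x. 0) \<in> W \<and> (\<forall>f\<in>W. \<forall>g\<in>W. (\<lambda>x. f x + g x) \<in> W)
     \<and> (\<forall>c. \<forall>f\<in>W. (\<lambda>x. c * f x) \<in> W)"

lemma complex_subspace_diff:
  "complex_subspace W \<Longrightarrow> f \<in> W \<Longrightarrow> g \<in> W \<Longrightarrow> (\<lambda>x. f x - g x) \<in> W"
proof -
  assume W: "complex_subspace W" "f \<in> W" "g \<in> W"
  have "(\<lambda>x. f x + (-1) * g x) \<in> W"
    using W unfolding complex_subspace_def by fast
  then show ?thesis by simp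
qed

text \<open>Induction on the support. The vectors of \<open>W\<close> that vanish at the new point
  \<open>p\<close> form a subspace \<open>W'\<close> covered by the induction hypothesis; it has
  codimension at most one in \<open>W\<close>, and one Gram-Schmidt step supplies the missing
  direction.\<close>

lemma orthogonal_projection:
  assumes "finite F" "complex_subspace W" "\<And>w x. w \<in> W \<Longrightarrow> x \<notin> F \<Longrightarrow> w x = 0"
  shows "\<exists>w\<in>W. \<forall>y\<in>W. ip F (\<lambda>x. f x - w x) y = 0"
  using assms
proof (induction F arbitrary: f W rule: finite_induct)
  case empty
  then show ?case by (auto simp: ip_def complex_subspace_def)
next
  case (insert p F)
  note sub = insert.prems(1)
  define W' where "W' = {w \<in> W. w p = 0}"
  have sub': "complex_subspace W'"
    using sub by (auto simp: complex_subspace_def W'_def)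
  have supp': "w x = 0" if "w \<in> W'" "x \<notin> F" for w x
    using insert.prems(2)[of w x] that by (cases "x = p") (auto simp: W'_def)
  have ipF: "ip (insert p F) g y = ip F g y" if "y \<in> W'" for g y
    using insert.hyps that by (simp add: ip_def W'_def)
  have IH: "\<exists>w\<in>W'. \<forall>y\<in>W'. ip (insert p F) (\<lambda>x. g x - w x) y = 0" for g
  proof -
    obtain w where "w \<in> W'" "\<forall>y\<in>W'. ip F (\<lambda>x. g x - w x) y = 0"
      using insert.IH[of W' g] sub' supp' by blast
    then show ?thesis by (intro bexI[of _ w]) (simp_all add: ipF)
  qed
  show ?case
  proof (cases "W' = W")
    case True
    then show ?thesis using IH by simp
  next
    case False
    then obtain u where u: "u \<in> W" "u p \<noteq> 0" by (auto simp: W'_def)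
    obtain q where q: "q \<in> W'" "\<And>y. y \<in> W' \<Longrightarrow> ip (insert p F) (\<lambda>x. u x - q x) y = 0"
      using IH by blast
    \<comment> \<open>Subtracting the projection of \<open>u\<close> makes \<open>v\<close>
      orthogonal to \<open>W'\<close>, while its value at \<open>p\<close> stays nonzero.\<close>
    define v where "v = (\<lambda>x. u x - q x)"
    have v: "v \<in> W" "v p \<noteq> 0" "\<And>y. y \<in> W' \<Longrightarrow> ip (insert p F) v y = 0"
      using u q sub by (auto simp: v_def W'_def intro!: complex_subspace_diff)
    obtain r where r: "r \<in> W'" "\<And>y. y \<in> W' \<Longrightarrow> ip (insert p F) (\<lambda>x. f x - r x) y = 0"
      using IH by blast
    have vv: "ip (insert p F) v v \<noteq> 0"
      using ip_self_eq_0[of "insert p F" v p] insert.hyps v(2) by auto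
    define c where "c = ip (insert p F) (\<lambda>x. f x - r x) v / ip (insert p F) v v"
    define w where "w = (\<lambda>x. r x + c * v x)"
    have fw: "(\<lambda>x. f x - w x) = (\<lambda>x. (f x - r x) - c * v x)" by (simp add: w_def algebra_simps)
    have wW: "w \<in> W" using r(1) v(1) sub by (auto simp: w_def W'_def complex_subspace_def)
    have orth': "ip (insert p F) (\<lambda>x. f x - w x) y = 0" if "y \<in> W'" for y
      unfolding fw ip_diff_left[of _ "\<lambda>x. f x - r x"] ip_scale_left using r(2) v(3) that by simp
    have orthv: "ip (insert p F) (\<lambda>x. f x - w x) v = 0"
      unfolding fw ip_diff_left[of _ "\<lambda>x. f x - r x"] ip_scale_left using vv by (simp add: c_def)
    have "ip (insert p F) (\<lambda>x. f x - w x) y = 0" if y: "y \<in> W" for y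
    proof -
      \<comment> \<open>The multiple of \<open>v\<close> that cancels the value of \<open>y\<close>
        at \<open>p\<close>, so that the difference falls into \<open>W'\<close>.\<close>
      define d where "d = y p / v p"
      have "(\<lambda>x. y x - d * v x) \<in> W"
        using y v(1) sub complex_subspace_diff[OF sub y, of "\<lambda>x. d * v x"] by (simp add: complex_subspace_def)
      then have "(\<lambda>x. y x - d * v x) \<in> W'" using v(2) by (simp add: W'_def d_def)
      from orth'[OF this] show ?thesis by (simp add: ip_diff_right ip_scale_right orthv)
    qed
    with wW show ?thesis by blast
  qed
qed

section \<open>Degree filtration and generation of the invariants\<close>

definition degree_le :: "nat \<Rightarrow> (('l::finite \<Rightarrow> nat set) \<Rightarrow> complex) \<Rightarrow> bool" where
  "degree_le d f \<longleftrightarrow> (\<forall>A. f A \<noteq> 0 \<longrightarrow> (\<Sum>a\<in>UNIV. card (A a)) \<le> d)"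

text \<open>The number of factors containing \<open>k\<close> changes by one twice, once in each of
  the two different factors; for other indices nothing happens.\<close>

lemma card_toggles:
  assumes "a \<noteq> b"
  shows "even (card {c::'l::finite. i \<in> (A(a := toggle k (A a), b := toggle k (A b))) c})
    \<longleftrightarrow> even (card {c. i \<in> A c})"
proof (cases "i = k")
  case False
  then have "{c. i \<in> (A(a := toggle k (A a), b := toggle k (A b))) c} = {c. i \<in> A c}" by auto
  then show ?thesis by simp
next
  case True
  have *: "even (card {c. i \<in> (B(a := toggle i (B a))) c}) \<longleftrightarrow> odd (card {c. i \<in> B c})" for a and B :: "'l \<Rightarrow> nat set"
  proof (cases "i \<in> B a")
    case True
    then have "{c. i \<in> B c} = insert a {c. i \<in> (B(a := toggle i (B a))) c}" by auto
    moreover have "a \<notin> {c. i \<in> (B(a := toggle i (B a))) c}" using True by simp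
    ultimately have "card {c. i \<in> B c} = Suc (card {c. i \<in> (B(a := toggle i (B a))) c})"
      by (metis card_insert_disjoint finite)
    then show ?thesis by simp
  next
    case False
    then have "{c. i \<in> (B(a := toggle i (B a))) c} = insert a {c. i \<in> B c}" by auto
    then show ?thesis using False by simp
  qed
  have "(A(a := toggle k (A a), b := toggle k (A b))) = (let B = A(a := toggle i (A a)) in B(b := toggle i (B b)))"
    using assms True by (auto simp: Let_def)
  then show ?thesis using *[of "A(a := toggle i (A a))" b] *[of A a] unfolding Let_def by simp
qed

text \<open>Statements about \<open>contr\<close> distinguish the cases \<open>X = cre\<close> and
  \<open>X = ann\<close>, which must therefore exclude each other.\<close>

lemma cre_neq_ann: "(cre :: 'l \<Rightarrow> _) \<noteq> ann"
proof
  assume eq: "(cre :: 'l \<Rightarrow> _) = ann"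
  have "act (cre a 0) (\<lambda>_. 1) (\<lambda>_. {}) \<noteq> act (ann a 0) (\<lambda>_. 1) (\<lambda>_. {})" for a :: 'l
    by (simp add: act_cre act_ann sg_def)
  with eq show False by simp
qed

text \<open>A nonzero coefficient of the image stems from one of \<open>f\<close> at a configuration
  differing by \<open>k\<close> in both factors. Creation means that \<open>k\<close> is now
  present, which determines the change of degree.\<close>

lemma contr_support:
  assumes X: "X = cre \<or> X = ann" and Y: "Y = cre \<or> Y = ann" and ab: "a \<noteq> b"
    and nz: "act (contr N X Y a b) f A \<noteq> 0"
  obtains k where "k \<in> {1..N}" "f (A(a := toggle k (A a), b := toggle k (A b))) \<noteq> 0"
    "X = cre \<longleftrightarrow> k \<in> A a" "Y = cre \<longleftrightarrow> k \<in> A b"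
proof -
  have "(\<Sum>k=1..N. act (X a k) (act (Y b k) f) A) \<noteq> 0" using nz by (simp add: contr_def act_sum)
  then obtain k where k: "k \<in> {1..N}" "act (X a k) (act (Y b k) f) A \<noteq> 0" by (meson sum.neutral)
  then show thesis
    using that[of k] k ab X Y cre_neq_ann cre_neq_ann[symmetric]
    by (auto simp: act_cre' act_ann' fun_upd_twist split: if_splits)
qed

lemma invariant_contr:
  assumes X: "X = cre \<or> X = ann" and Y: "Y = cre \<or> Y = ann" and ab: "a \<noteq> b"
    and f: "invariant N f"
  shows "invariant N (act (contr N X Y a b) f)"
  unfolding invariant_def
proof (intro conjI allI impI ballI)
  fix A assume "act (contr N X Y a b) f A \<noteq> 0"
  from contr_support[OF X Y ab this] obtain k where k: "k \<in> {1..N}"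
    "f (A(a := toggle k (A a), b := toggle k (A b))) \<noteq> 0" by blast
  then have A: "A(a := toggle k (A a), b := toggle k (A b)) \<in> configs N"
    "even (card {c. i \<in> (A(a := toggle k (A a), b := toggle k (A b))) c})" for i
    using f by (auto simp: invariant_def simp del: fun_upd_apply)
  show "even (card {c. i \<in> A c})" for i
    using A(2)[of i] unfolding card_toggles[OF ab] .
  have "A(a := toggle k (A a), b := toggle k ((A(a := toggle k (A a))) b)) \<in> configs N"
    using A(1) ab by simp
  then show "A \<in> configs N" by (simp only: configs_toggle_iff[OF k(1)])
next
  fix i j assume "i \<in> {1..N}" "j \<in> {1..N}"
  from so_contr[OF X Y this, of a b] have "act (so i j) (act (contr N X Y a b) f) = act (contr N X Y a b) (act (so i j) f)"
    by (simp only: flip: act_simps(6))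
  also have "\<dots> = (\<lambda>A. 0)" using f \<open>i \<in> _\<close> \<open>j \<in> _\<close> by (simp add: invariant_def act_zero)
  finally show "act (so i j) (act (contr N X Y a b) f) = (\<lambda>A. 0)" .
qed

lemma invariant_add:
  assumes "invariant N f" "invariant N g"
  shows "invariant N (\<lambda>A. f A + g A)"
  unfolding invariant_def act_add
proof (intro conjI allI impI ballI)
  fix A assume "f A + g A \<noteq> 0"
  then have "f A \<noteq> 0 \<or> g A \<noteq> 0" by auto
  then show "A \<in> configs N" "even (card {a. i \<in> A a})" for i
    using assms unfolding invariant_def by blast+
qed (use assms in \<open>simp add: invariant_def\<close>)

lemma invariant_scale:
  assumes "invariant N f" shows "invariant N (\<lambda>A. c * f A)"
  unfolding invariant_def
proof (intro conjI allI impI ballI)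
  fix A assume "c * f A \<noteq> 0"
  then have "f A \<noteq> 0" by auto
  then show "A \<in> configs N" "even (card {a. i \<in> A a})" for i
    using assms unfolding invariant_def by blast+
qed (use assms in \<open>simp add: invariant_def act_scale\<close>)

lemma degree_toggles:
  assumes "a \<noteq> b" "A \<in> configs N" "k \<in> {1..N}"
  shows "int (\<Sum>c\<in>UNIV. card ((A(a := toggle k (A a), b := toggle k (A b))) c)) =
    int (\<Sum>c\<in>UNIV. card (A c)) + (if k \<in> A a then - 1 else 1) + (if k \<in> A b then - 1 else 1)"
proof -
  have *: "int (card (toggle k (A c))) = int (card (A c)) + (if k \<in> A c then -1 else 1)" for c
  proof -
    have "finite (A c)" using assms(2) by (auto simp: configs_def intro: finite_subset)
    then show ?thesis
      by (cases "card (A c)") (auto simp: toggle_def card_Diff_singleton)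
  qed
  have eq: "UNIV = insert a (insert b (UNIV - {a, b}))" by auto
  have "(\<Sum>c\<in>UNIV. h c) = h a + (h b + (\<Sum>c\<in>UNIV - {a, b}. h c))" for h :: "'a \<Rightarrow> int"
    by (subst eq) (use assms(1) in simp)
  then show ?thesis
    using assms(1) by (simp add: *)
qed

text \<open>The case \<open>d < 2\<close> is listed apart, because truncated subtraction turns
  \<open>d - 2\<close> into degree zero where in fact the contraction vanishes.\<close>

lemma degree_contr:
  assumes ab: "a \<noteq> b" and f: "invariant N f" and d: "degree_le d f"
  shows "degree_le (d + 2) (act (contr N cre cre a b) f)"
    "degree_le d (act (contr N cre ann a b) f)" "degree_le d (act (contr N ann cre a b) f)"
    "degree_le (d - 2) (act (contr N ann ann a b) f)"
    "d < 2 \<Longrightarrow> act (contr N ann ann a b) f = (\<lambda>A. 0)"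
proof -
  have key: "int (\<Sum>c\<in>UNIV. card (A c)) \<le> int d + (if X = cre then 1 else -1) + (if Y = cre then 1 else -1)"
    if X: "X = cre \<or> X = ann" and Y: "Y = cre \<or> Y = ann" and nz: "act (contr N X Y a b) f A \<noteq> 0" for X Y A
  proof -
    from contr_support[OF X Y ab nz] obtain k where k: "k \<in> {1..N}"
      "f (A(a := toggle k (A a), b := toggle k (A b))) \<noteq> 0"
      "X = cre \<longleftrightarrow> k \<in> A a" "Y = cre \<longleftrightarrow> k \<in> A b" by blast
    have "A \<in> configs N" using invariant_contr[OF X Y ab f] nz by (auto simp: invariant_def)
    note deg = degree_toggles[OF ab this k(1)]
    have "int (\<Sum>c\<in>UNIV. card ((A(a := toggle k (A a), b := toggle k (A b))) c)) \<le> int d"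
      using d k(2) unfolding degree_le_def of_nat_le_iff by blast
    then show ?thesis
      unfolding deg by (simp add: k(3,4) split: if_splits)
  qed
  note ne = cre_neq_ann[symmetric, where 'l = 'a]
  show "degree_le (d + 2) (act (contr N cre cre a b) f)"
    unfolding degree_le_def using key[of cre cre]
    by (intro allI impI) (simp flip: of_nat_le_iff[where 'a = int])
  show "degree_le d (act (contr N cre ann a b) f)" "degree_le d (act (contr N ann cre a b) f)"
    unfolding degree_le_def using key[of cre ann] key[of ann cre] ne
    by (intro allI impI, simp flip: of_nat_le_iff[where 'a = int])+
  have low: "(\<Sum>c\<in>UNIV. card (A c)) + 2 \<le> d" if "act (contr N ann ann a b) f A \<noteq> 0" for A
    using key[of ann ann A] that ne by (simp flip: of_nat_le_iff[where 'a = int])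
  show "degree_le (d - 2) (act (contr N ann ann a b) f)"
    unfolding degree_le_def using low by fastforce
  show "d < 2 \<Longrightarrow> act (contr N ann ann a b) f = (\<lambda>A. 0)"
    using low by fastforce
qed

definition cliff_contr :: "nat \<Rightarrow> 'l::finite \<Rightarrow> 'l \<Rightarrow> ('l \<Rightarrow> nat set) endo" where
  "cliff_contr N a b = (\<Sum>k=1..N. cliff a k * cliff b k)"

lemma cliff_contr_eq:
  "cliff_contr N a b = contr N cre cre a b + contr N cre ann a b + contr N ann cre a b + contr N ann ann a b"
proof -
  have "cliff a k * cliff b k = cre a k * cre b k + cre a k * ann b k + ann a k * cre b k + ann a k * ann b k" for k
    by (simp add: cliff_eq distrib_left distrib_right)
  then show ?thesis
    by (simp add: cliff_contr_def contr_def sum.distrib)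
qed

text \<open>Strong induction on the degree. The difference \<open>z\<close> between \<open>f\<close>
  and its projection is shown to be harmonic: if \<open>y\<close> is a contraction of
  \<open>z\<close>, double creation brings \<open>y\<close> back to an invariant that is already
  generated, and pairing this with \<open>z\<close> computes the norm of \<open>y\<close>.\<close>

theorem invariants_generated:
  fixes f :: "('l::finite \<Rightarrow> nat set) \<Rightarrow> complex"
  assumes W: "complex_subspace W" and vac: "(\<lambda>A. if A = (\<lambda>_. {}) then 1 else 0) \<in> W"
    and step: "\<And>a b y. a \<noteq> b \<Longrightarrow> y \<in> W \<Longrightarrow> act (cliff_contr N a b) y \<in> W"
    and f: "invariant N f"
  shows "f \<in> W"
proof -
  have main: "f \<in> W" if "invariant N f" "degree_le d f" for d and f :: "('l \<Rightarrow> nat set) \<Rightarrow> complex"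
    using that
  proof (induction d arbitrary: f rule: less_induct)
    case (less d)
    let ?C = "configs N :: ('l \<Rightarrow> nat set) set"
    \<comment> \<open>Projecting within the degree bound keeps the remainder \<open>z\<close> of
      degree at most \<open>d\<close>, which the induction hypothesis for its contractions
      requires.\<close>
    define V where "V = {w \<in> W. invariant N w \<and> degree_le d w}"
    have V: "complex_subspace V"
    proof -
      have "invariant N (\<lambda>A. 0)" by (simp add: invariant_def act_zero)
      moreover have "degree_le d (\<lambda>A :: 'l \<Rightarrow> nat set. 0)" by (simp add: degree_le_def)
      moreover have "degree_le d (\<lambda>A. g A + h A)" if "degree_le d g" "degree_le d h"
        for g h :: "('l \<Rightarrow> nat set) \<Rightarrow> complex"
        using that unfolding degree_le_def by (metis add_0)
      moreover have "degree_le d (\<lambda>A. c * g A)" if "degree_le d g" for c and g :: "('l \<Rightarrow> nat set) \<Rightarrow> complex"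
        using that by (simp add: degree_le_def)
      ultimately show ?thesis
        using W unfolding complex_subspace_def V_def
        by (intro conjI ballI allI) (auto intro: invariant_add invariant_scale)
    qed
    obtain w where w: "w \<in> V" "\<And>y. y \<in> V \<Longrightarrow> ip ?C (\<lambda>A. f A - w A) y = 0"
    proof -
      have "w A = 0" if "w \<in> V" "A \<notin> ?C" for w A
        using that unfolding V_def invariant_def by blast
      with orthogonal_projection[OF finite_configs V] that show thesis by blast
    qed
    define z where "z = (\<lambda>A. f A - w A)"
    have z_eq: "z = (\<lambda>A. f A + (-1) * w A)" by (simp add: z_def)
    have z: "invariant N z"
      unfolding z_eq using w(1) less.prems(1) by (intro invariant_add invariant_scale) (auto simp: V_def)
    have zd: "degree_le d z"
      using w(1) less.prems(2) by (auto simp: z_def V_def degree_le_def) (metis diff_zero)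
    have harm: "act (contr N ann ann a b) z = (\<lambda>A. 0)" if ab: "a \<noteq> b" for a b
    proof (cases "d < 2")
      case True
      then show ?thesis using degree_contr(5)[OF ab z zd] by simp
    next
      case False
      define y where "y = act (contr N ann ann a b) z"
      have y: "invariant N y" "degree_le (d - 2) y"
        unfolding y_def using z zd ab by (auto intro: invariant_contr degree_contr)
      have IH: "g \<in> W" if "invariant N g" "degree_le (d - 2) g" for g
        using less.IH[of "d - 2" g] False that by simp
      define g where "g = act (contr N cre cre a b) y"
      \<comment> \<open>Double creation is the only part of \<open>cliff_contr\<close> that raises
        the degree; the three parts subtracted have degree at most \<open>d - 2\<close> and lie in
        \<open>W\<close> by induction.\<close>
      have "g = (\<lambda>A. act (cliff_contr N a b) y A - (act (contr N cre ann a b) y A + act (contr N ann cre a b) y A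
          + act (contr N ann ann a b) y A))"
        by (simp add: g_def cliff_contr_eq)
      moreover have "act (contr N cre ann a b) y \<in> W" "act (contr N ann cre a b) y \<in> W"
        using y ab by (auto intro!: IH invariant_contr degree_contr)
      moreover have "act (contr N ann ann a b) y \<in> W"
        using degree_contr(4)[OF ab y] y(1) ab
        by (intro IH invariant_contr) (auto simp: degree_le_def intro: order_trans[OF _ diff_le_self])
      moreover have "act (cliff_contr N a b) y \<in> W" using step[OF ab IH[OF y]] .
      ultimately have "g \<in> W"
        using W by (auto intro!: complex_subspace_diff simp: complex_subspace_def)
      moreover have "invariant N g" "degree_le d g"
        unfolding g_def using degree_contr(1)[OF ab y(1), of d] degree_contr(1)[OF ab y] False y(1) ab
        by (auto intro: invariant_contr simp: Suc_diff_Suc numeral_2_eq_2)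
      ultimately have "g \<in> V" by (simp add: V_def)
      \<comment> \<open>Moving the contraction to the other side of the form replaces it by double
        creation and yields the product of \<open>z\<close> with \<open>g\<close>, which is an
        element of \<open>V\<close>.\<close>
      have "ip ?C y y = cnj (ip ?C (act (contr N ann ann a b) z) y)"
        by (simp add: ip_def y_def mult.commute)
      also have "ip ?C (act (contr N ann ann a b) z) y = cnj (ip ?C y (act (contr N ann ann a b) z))"
        by (simp add: ip_def mult.commute)
      also have "ip ?C y (act (contr N ann ann a b) z) = ip ?C g z"
        using adjoint_contr[OF ab, of N] by (simp add: adjoint_pair_def g_def)
      also have "\<dots> = cnj (ip ?C z g)" by (simp add: ip_def mult.commute)
      also have "ip ?C z g = 0" using w(2)[OF \<open>g \<in> V\<close>] by (simp add: z_def)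
      finally have "ip ?C y y = 0" by simp
      then have "y A = 0" for A
        using ip_self_eq_0[of ?C y A] y(1) by (auto simp: invariant_def)
      then show ?thesis by (auto simp: y_def)
    qed
    have "z = (\<lambda>A. z (\<lambda>_. {}) * (if A = (\<lambda>_. {}) then 1 else 0))"
      using harmonic_invariant[OF z harm] by fastforce
    moreover have "(\<lambda>A. z (\<lambda>_. {}) * (if A = (\<lambda>_. {}) then 1 else 0)) \<in> W"
      using W vac by (simp add: complex_subspace_def)
    ultimately have "z \<in> W" by simp
    moreover have "w \<in> W" using w(1) by (simp add: V_def)
    ultimately have "(\<lambda>A. z A + w A) \<in> W" using W by (simp add: complex_subspace_def)
    then show ?case by (simp add: z_def)
  qed
  \<comment> \<open>Finitely many configurations support an invariant, so the largest of their
    degrees bounds \<open>f\<close>.\<close>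
  define d where "d = Max ((\<lambda>A. \<Sum>a\<in>UNIV. card (A a)) ` (configs N :: ('l \<Rightarrow> nat set) set))"
  have "degree_le d f"
    using f by (auto simp: degree_le_def d_def invariant_def)
  with main f show ?thesis by blast
qed

section \<open>Operators on tensor powers\<close>

text \<open>A copy of the square matrices in which \<open>*\<close> is matrix multiplication, so
  that they become an instance of \<open>complex_alg\<close>.\<close>

typedef ('n::finite) sqm = "UNIV :: (complex^'n^'n) set"
  morphisms to_mat of_mat by simp

setup_lifting type_definition_sqm

instantiation sqm :: (finite) complex_alg
begin

lift_definition zero_sqm :: "'a sqm" is 0 .
lift_definition one_sqm :: "'a sqm" is "mat 1" .
lift_definition plus_sqm :: "'a sqm \<Rightarrow> 'a sqm \<Rightarrow> 'a sqm" is "(+)" .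
lift_definition minus_sqm :: "'a sqm \<Rightarrow> 'a sqm \<Rightarrow> 'a sqm" is "(-)" .
lift_definition uminus_sqm :: "'a sqm \<Rightarrow> 'a sqm" is uminus .
lift_definition times_sqm :: "'a sqm \<Rightarrow> 'a sqm \<Rightarrow> 'a sqm" is "(**)" .
lift_definition of_complex_sqm :: "complex \<Rightarrow> 'a sqm" is mat .

instance
proof
  fix x y z :: "'a sqm" and c d :: complex
  show "x + y + z = x + (y + z)" by transfer (rule add.assoc)
  show "x + y = y + x" by transfer (rule add.commute)
  show "0 + x = x" by transfer (rule add_0)
  show "- x + x = 0" by transfer (rule left_minus)
  show "x - y = x + - y" by transfer (rule diff_conv_add_uminus)
  show "1 * x = x" by transfer (rule matrix_mul_lid)
  show "x * 1 = x" by transfer (rule matrix_mul_rid)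
  show "x * y * z = x * (y * z)" by transfer (rule matrix_mul_assoc[symmetric])
  show "(x + y) * z = x * z + y * z" by transfer (simp add: vec_eq_iff matrix_matrix_mult_def algebra_simps sum.distrib)
  show "x * (y + z) = x * y + x * z" by transfer (rule matrix_add_ldistrib)
  show "(0 :: 'a sqm) \<noteq> 1" by transfer (auto simp: mat_def vec_eq_iff)
  show "of_complex 1 = (1 :: 'a sqm)" by transfer (rule refl)
  show "of_complex (c + d) = (of_complex c + of_complex d :: 'a sqm)"
    by transfer (simp add: mat_def vec_eq_iff)
  have "(if i = m then c else 0) * (if m = j then d else 0) = (if i = m then (if i = j then c * d else 0) else 0)"
    for i j m :: 'a
    by auto
  then show "of_complex (c * d) = (of_complex c * of_complex d :: 'a sqm)"
    by transfer (simp add: mat_def vec_eq_iff matrix_matrix_mult_def)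
  have "(if i = m then c else 0) * A $ m $ j = (if i = m then c * A $ i $ j else 0)"
    and "A $ i $ m * (if m = j then c else 0) = (if m = j then c * A $ i $ j else 0)"
    for A :: "complex^'a^'a" and i j m
    by auto
  then show "of_complex c * x = x * of_complex c"
    by transfer (simp add: mat_def vec_eq_iff matrix_matrix_mult_def)
qed

end

lift_definition ent :: "'n::finite sqm \<Rightarrow> 'n \<Rightarrow> 'n \<Rightarrow> complex" is "\<lambda>X i j. X $ i $ j" .

lemma sqm_eqI:
  assumes "\<And>i j. ent X i j = ent Y i j" shows "X = Y"
proof -
  have "to_mat X = to_mat Y"
    using assms unfolding ent.rep_eq vec_eq_iff by blast
  then show ?thesis by (simp add: to_mat_inject)
qed

lemma ent_simps [simp]:
  "ent 0 i j = 0" "ent 1 i j = (if i = j then 1 else 0)" "ent (of_complex c) i j = (if i = j then c else 0)"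
  "ent (X + Y) i j = ent X i j + ent Y i j" "ent (X - Y) i j = ent X i j - ent Y i j"
  "ent (- X) i j = - ent X i j"
  unfolding ent.rep_eq zero_sqm.rep_eq one_sqm.rep_eq of_complex_sqm.rep_eq plus_sqm.rep_eq
    minus_sqm.rep_eq uminus_sqm.rep_eq
  by (simp_all add: mat_def)

lemma ent_mult: "ent (X * Y) i j = (\<Sum>m\<in>UNIV. ent X i m * ent Y m j)"
  unfolding ent.rep_eq times_sqm.rep_eq by (simp add: matrix_matrix_mult_def)

lemma ent_of_complex_mult [simp]: "ent (of_complex c * X) i j = c * ent X i j"
  by (simp add: ent_mult if_distrib[where f="\<lambda>x. x * _"] cong: if_cong)

lemma ent_sum: "ent (sum F I) i j = (\<Sum>x\<in>I. ent (F x) i j)"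
  by (induction I rule: infinite_finite_induct) auto

section \<open>Tensor products of matrices and operators in one slot\<close>

lift_definition tens :: "('l::finite \<Rightarrow> 's::finite sqm) \<Rightarrow> ('l \<Rightarrow> 's) sqm" is
  "\<lambda>X. \<chi> f g. \<Prod>a\<in>UNIV. X a $ f a $ g a" .

lemma ent_tens: "ent (tens X) f g = (\<Prod>a\<in>UNIV. ent (X a) (f a) (g a))"
  unfolding ent.rep_eq tens.rep_eq by simp

lemma tens_mult: "tens X * tens Y = tens (\<lambda>a. X a * Y a)"
proof (rule sqm_eqI)
  fix f g :: "'a \<Rightarrow> 'b"
  have "ent (tens (\<lambda>a. X a * Y a)) f g
      = (\<Prod>a\<in>UNIV. \<Sum>m\<in>UNIV. ent (X a) (f a) m * ent (Y a) m (g a))"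
    by (simp add: ent_tens ent_mult)
  also have "\<dots> = (\<Sum>h\<in>PiE UNIV (\<lambda>_. UNIV). \<Prod>a\<in>UNIV. ent (X a) (f a) (h a) * ent (Y a) (h a) (g a))"
    by (rule prod_sum_PiE) auto
  also have "\<dots> = ent (tens X * tens Y) f g"
    by (simp add: ent_mult ent_tens prod.distrib PiE_UNIV_domain)
  finally show "ent (tens X * tens Y) f g = ent (tens (\<lambda>a. X a * Y a)) f g" ..
qed

lemma tens_one [simp]: "tens (\<lambda>_. 1) = 1"
proof (rule sqm_eqI)
  fix f g :: "'a \<Rightarrow> 'b"
  show "ent (tens (\<lambda>_. 1)) f g = ent 1 f g"
    by (auto simp: ent_tens fun_eq_iff intro!: prod_zero)
qed

lemma ent_tens_upd: "ent (tens (X(a := P))) f g = ent P (f a) (g a) * (\<Prod>b\<in>UNIV - {a}. ent (X b) (f b) (g b))"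
proof -
  have "ent (tens (X(a := P))) f g = ent ((X(a := P)) a) (f a) (g a) * (\<Prod>b\<in>UNIV - {a}. ent ((X(a := P)) b) (f b) (g b))"
    unfolding ent_tens by (rule prod.remove) auto
  then show ?thesis by simp
qed

lemma tens_upd_add: "tens (X(a := P + Q)) = tens (X(a := P)) + tens (X(a := Q))"
  by (rule sqm_eqI) (simp add: ent_tens_upd algebra_simps)

lemma tens_upd_scale: "tens (X(a := of_complex c * P)) = of_complex c * tens (X(a := P))"
  by (rule sqm_eqI) (simp add: ent_tens_upd algebra_simps)

lemma tens_scale: "tens (\<lambda>a. of_complex (c a) * X a) = of_complex (\<Prod>a\<in>UNIV. c a) * tens X"
  by (rule sqm_eqI) (simp add: ent_tens prod.distrib)

definition slot :: "'l::finite \<Rightarrow> 's::finite sqm \<Rightarrow> ('l \<Rightarrow> 's) sqm" where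
  "slot a P = tens ((\<lambda>_. 1)(a := P))"

lemma slot_one [simp]: "slot a 1 = 1"
  by (simp add: slot_def fun_upd_idem)

lemma slot_mult: "slot a (P * Q) = slot a P * slot a Q"
  unfolding slot_def tens_mult by (rule arg_cong[where f=tens]) auto

lemma slot_add: "slot a (P + Q) = slot a P + slot a Q"
  by (simp add: slot_def tens_upd_add)

lemma slot_scale: "slot a (of_complex c * P) = of_complex c * slot a P"
  by (simp add: slot_def tens_upd_scale)

lemma slot_of_complex [simp]: "slot a (of_complex c) = of_complex c"
  using slot_scale[of a c 1] by simp

lemma slot_zero [simp]: "slot a 0 = 0"
  using slot_scale[of a 0 0] by simp

lemma slot_minus: "slot a (- P) = - slot a P"
  using slot_scale[of a "-1" P] by simp

lemma slot_sum: "slot a (sum F I) = (\<Sum>i\<in>I. slot a (F i))"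
  by (induction I rule: infinite_finite_induct) (auto simp: slot_add)

lemma slot_commute: "a \<noteq> b \<Longrightarrow> slot a P * slot b Q = slot b Q * slot a P"
  unfolding slot_def tens_mult by (rule arg_cong[where f=tens]) auto

lemma slot_tens: "slot a P * tens X = tens (X(a := P * X a))"
  unfolding slot_def tens_mult by (rule arg_cong[where f=tens]) auto

lemma tens_slot: "tens X * slot a P = tens (X(a := X a * P))"
  unfolding slot_def tens_mult by (rule arg_cong[where f=tens]) auto

lemma of_complex_eq_0_iff [simp]: "of_complex c = (0 :: 'a::complex_alg) \<longleftrightarrow> c = 0"
  using of_complex_inverse_cancel[of c "1::'a"] by (cases "c = 0") auto

text \<open>The sign under conjugation by the generator \<open>i\<close> of the monomial over
  \<open>B\<close>: every other generator in \<open>B\<close> anticommutes with it. These signs are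
  the characters that tell monomials apart.\<close>

definition chr :: "nat \<Rightarrow> nat set \<Rightarrow> complex" where
  "chr i B = (-1) ^ card (B - {i})"

lemma chr_sq [simp]: "chr i B * chr i B = 1"
  by (simp add: chr_def flip: power_add mult_2)

lemma chr_cases: "chr i B = 1 \<or> chr i B = -1"
  by (cases "even (card (B - {i}))") (auto simp: chr_def)

lemma chr_eq_1:
  assumes "finite B" shows "chr i B = 1 \<longleftrightarrow> (even (card B) \<longleftrightarrow> i \<notin> B)"
proof -
  have "chr i B = 1 \<longleftrightarrow> even (card (B - {i}))"
    unfolding chr_def by (cases "even (card (B - {i}))") auto
  moreover have "card B = Suc (card (B - {i}))" if "i \<in> B"
    using assms that by (metis card.remove)
  ultimately show ?thesis
    by (cases "i \<in> B") (metis even_Suc, simp)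
qed

section \<open>Monomials in the Clifford generators\<close>

locale clifford_family =
  fixes N :: nat and e :: "nat \<Rightarrow> 'r::complex_alg"
  assumes e_sq: "i \<in> {1..N} \<Longrightarrow> e i * e i = 1"
    and e_anti: "i \<in> {1..N} \<Longrightarrow> j \<in> {1..N} \<Longrightarrow> i \<noteq> j \<Longrightarrow> e i * e j = - (e j * e i)"
begin

definition mon :: "nat set \<Rightarrow> 'r" where
  "mon B = prod_list (map e (sorted_list_of_set B))"

lemma e_insort:
  assumes "i \<in> {1..N}" "set xs \<subseteq> {1..N}" "i \<notin> set xs" "sorted xs" "distinct xs"
  shows "e i * prod_list (map e xs) = of_complex (sg i (set xs)) * prod_list (map e (insort i xs))"
  using assms
proof (induction xs)
  case Nil
  then show ?case by (simp add: sg_def)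
next
  case (Cons x xs)
  show ?case
  proof (cases "i \<le> x")
    case True
    have empty: "{j \<in> set (x # xs). j < i} = {}" using True Cons.prems by auto
    have "sg i (set (x # xs)) = 1" unfolding sg_def empty by simp
    then show ?thesis using True by simp
  next
    case False
    have "set (x # xs) = toggle x (set xs)" using Cons.prems by (auto simp: toggle_def)
    then have sgn: "sg i (set (x # xs)) = - sg i (set xs)"
      using sg_toggle_less[of x i "set xs"] False by simp
    have "e i * (e x * prod_list (map e xs)) = - (e x * (e i * prod_list (map e xs)))"
      using e_anti[of i x] Cons.prems by (simp add: mult.assoc[symmetric])
    also have "\<dots> = - (e x * (of_complex (sg i (set xs)) * prod_list (map e (insort i xs))))"
      using Cons by simp
    also have "\<dots> = - of_complex (sg i (set xs)) * (e x * prod_list (map e (insort i xs)))"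
      by (simp add: of_complex_left_commute)
    finally show ?thesis using False by (simp only: sgn of_complex_minus) simp
  qed
qed

text \<open>For \<open>i\<close> outside \<open>B\<close> this is insertion into the sorted product.
  For \<open>i\<close> in \<open>B\<close> apply that case to \<open>B - {i}\<close> and multiply
  once more by \<open>e i\<close>, which squares to one; \<open>sg\<close> does not see the
  difference.\<close>

lemma e_mon:
  assumes i: "i \<in> {1..N}" and B: "B \<subseteq> {1..N}"
  shows "e i * mon B = of_complex (sg i B) * mon (toggle i B)"
proof -
  have not_in: "e i * mon B = of_complex (sg i B) * mon (insert i B)" if B: "B \<subseteq> {1..N}" "i \<notin> B" for B
  proof -
    have "finite B" using B finite_subset by blast
    then show ?thesis
      using e_insort[of i "sorted_list_of_set B"] i B by (simp add: mon_def sorted_list_of_set_insert)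
  qed
  show ?thesis
  proof (cases "i \<in> B")
    case False
    then show ?thesis using not_in B by (simp add: toggle_def)
  next
    case True
    have "e i * mon (B - {i}) = of_complex (sg i (B - {i})) * mon B"
      using not_in[of "B - {i}"] B True by (auto simp: insert_absorb)
    moreover have "sg i (B - {i}) = sg i B"
      using sg_toggle_same[of i B] True by (simp add: toggle_def)
    ultimately have *: "e i * mon (B - {i}) = of_complex (sg i B) * mon B" by simp
    have "e i * (of_complex (sg i B) * (e i * mon (B - {i}))) = of_complex (sg i B) * (e i * e i * mon (B - {i}))"
      by (simp add: of_complex_left_commute mult.assoc)
    also have "\<dots> = of_complex (sg i B) * mon (B - {i})" using e_sq[OF i] by simp
    also have "of_complex (sg i B) * (e i * mon (B - {i})) = mon B"
      unfolding * by (simp flip: mult.assoc of_complex_mult)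
    finally show ?thesis using True by (simp add: toggle_def)
  qed
qed

lemma mon_empty [simp]: "mon {} = 1"
  by (simp add: mon_def)

lemma e_mon_commute:
  assumes i: "i \<in> {1..N}" and B: "B \<subseteq> {1..N}"
  shows "mon B * e i = of_complex (chr i B) * (e i * mon B)"
proof -
  have "prod_list (map e xs) * e i = of_complex ((-1) ^ card (set xs - {i})) * (e i * prod_list (map e xs))"
    if "set xs \<subseteq> {1..N}" "distinct xs" for xs
    using that
  proof (induction xs)
    case (Cons x xs)
    have "e x * prod_list (map e xs) * e i = of_complex ((-1) ^ card (set xs - {i})) * (e x * e i * prod_list (map e xs))"
      using Cons by (simp add: mult.assoc of_complex_left_commute)
    also have "\<dots> = of_complex ((-1) ^ card (set (x # xs) - {i})) * (e i * (e x * prod_list (map e xs)))"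
    proof (cases "x = i")
      case True
      then show ?thesis by (simp add: mult.assoc)
    next
      case False
      have "set (x # xs) - {i} = insert x (set xs - {i})" using False by auto
      then have "card (set (x # xs) - {i}) = Suc (card (set xs - {i}))" using Cons.prems False by simp
      then have sgn: "(-1) ^ card (set (x # xs) - {i}) = - ((-1) ^ card (set xs - {i}) :: complex)" by simp
      have "e x * e i = - (e i * e x)" using e_anti[of x i] False Cons.prems i by auto
      then have "e x * e i * prod_list (map e xs) = - (e i * (e x * prod_list (map e xs)))"
        by (simp only: minus_mult_left[symmetric] mult.assoc)
      then show ?thesis unfolding sgn of_complex_minus by simp
    qed
    finally show ?case by simp
  qed simp
  from this[of "sorted_list_of_set B"] show ?thesis
    using B finite_subset[OF B] by (simp add: mon_def chr_def)
qed

lemma mon_invertible: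
  assumes B: "B \<subseteq> {1..N}" shows "\<exists>y. mon B * y = 1"
proof -
  have "\<exists>y. prod_list (map e xs) * y = 1" if "set xs \<subseteq> {1..N}" for xs
    using that
  proof (induction xs)
    case (Cons x xs)
    then obtain y where "prod_list (map e xs) * y = 1" by auto
    then have "prod_list (map e (x # xs)) * (y * e x) = e x * e x"
      by (simp add: mult.assoc flip: mult.assoc[of _ y])
    then show ?case using e_sq Cons.prems by auto
  qed simp
  from this[of "sorted_list_of_set B"] show ?thesis
    using B finite_subset[OF B] by (simp add: mon_def)
qed

end

text \<open>By \<open>chr_eq_1\<close> the characters determine \<open>B\<close> once the parity of
  its size is known. Sets of different parity with equal characters would be complementary, but
  complements have equal parity for even \<open>N\<close>, and for odd \<open>N\<close> both sizes
  are even by assumption.\<close>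

lemma chr_separates:
  assumes B: "B \<subseteq> {1..N}" "odd N \<longrightarrow> even (card B)" and C: "C \<subseteq> {1..N}" "odd N \<longrightarrow> even (card C)"
    and eq: "\<And>i. i \<in> {1..N} \<Longrightarrow> chr i B = chr i C"
  shows "B = C"
proof -
  have fin: "finite B" "finite C" using B C finite_subset by blast+
  have *: "(even (card B) \<longleftrightarrow> i \<notin> B) \<longleftrightarrow> (even (card C) \<longleftrightarrow> i \<notin> C)" if "i \<in> {1..N}" for i
    using eq[OF that] chr_eq_1[OF fin(1), of i] chr_eq_1[OF fin(2), of i] by simp
  show ?thesis
  proof (cases "even (card B) \<longleftrightarrow> even (card C)")
    case True
    then have "i \<in> B \<longleftrightarrow> i \<in> C" if "i \<in> {1..N}" for i using *[OF that] by blast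
    then show ?thesis using B C by blast
  next
    case False
    then have "i \<in> C \<longleftrightarrow> i \<notin> B" if "i \<in> {1..N}" for i using *[OF that] by blast
    then have "C = {1..N} - B" using C by blast
    then have "card C = N - card B" "card B \<le> N"
      using B(1) card_mono[OF _ B(1)] by (auto simp: card_Diff_subset[OF fin(1)])
    moreover have "even N" using False B(2) C(2) by blast
    ultimately show ?thesis using False by simp
  qed
qed

text \<open>
  For odd \<open>N\<close> the product of all generators is a scalar, so that only half of the monomials are
  linearly independent.
\<close>

definition good_sets :: "nat \<Rightarrow> nat set set" where
  "good_sets N = {B. B \<subseteq> {1..N} \<and> (odd N \<longrightarrow> even (card B))}"

text \<open>For odd \<open>N\<close> the subset of the first \<open>2 * k\<close> indices is
  arbitrary, and parity decides whether the last index \<open>N\<close> belongs to the set.\<close>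

lemma card_good_sets:
  assumes "N = 2 * k \<or> N = 2 * k + 1" shows "card (good_sets N) = 2 ^ (2 * k)"
  using assms
proof
  assume "N = 2 * k"
  then have "good_sets N = Pow {1..N}" by (auto simp: good_sets_def)
  then show ?thesis using \<open>N = 2 * k\<close> by (simp add: card_Pow)
next
  assume N: "N = 2 * k + 1"
  have "bij_betw (\<lambda>B. B - {N}) (good_sets N) (Pow {1..2 * k})"
  proof (rule bij_betw_byWitness[where f' = "\<lambda>C. if even (card C) then C else insert N C"])
    have fin: "finite B" if "B \<in> good_sets N" for B
      using that finite_subset[of B "{1..N}"] by (auto simp: good_sets_def)
    show "\<forall>B\<in>good_sets N. (if even (card (B - {N})) then B - {N} else insert N (B - {N})) = B"
    proof
      fix B assume B: "B \<in> good_sets N"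
      then have "even (card B)" using N by (simp add: good_sets_def)
      moreover have "card B = Suc (card (B - {N}))" if "N \<in> B" using fin[OF B] that by (metis card.remove)
      ultimately show "(if even (card (B - {N})) then B - {N} else insert N (B - {N})) = B"
        by (cases "N \<in> B") (metis even_Suc insert_Diff, simp)
    qed
    show "\<forall>C\<in>Pow {1..2 * k}. (if even (card C) then C else insert N C) - {N} = C"
      using N by auto
    show "(\<lambda>B. B - {N}) ` good_sets N \<subseteq> Pow {1..2 * k}"
      using N by (fastforce simp: good_sets_def)
    show "(\<lambda>C. if even (card C) then C else insert N C) ` Pow {1..2 * k} \<subseteq> good_sets N"
    proof safe
      fix C assume C: "C \<subseteq> {1..2 * k}"
      then have "finite C" "N \<notin> C" using N finite_subset[OF C] by auto
      then show "(if even (card C) then C else insert N C) \<in> good_sets N"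
        using C N by (auto simp: good_sets_def)
    qed
  qed
  then show ?thesis by (simp add: bij_betw_same_card card_Pow)
qed

definition gg :: "(nat \<Rightarrow> 's::finite sqm) \<Rightarrow> 'l::finite \<Rightarrow> 'l \<Rightarrow> nat \<Rightarrow> ('l \<Rightarrow> 's) sqm" where
  "gg e a b i = slot a (e i) * slot b (e i)"

locale clifford_matrices = clifford_family N e for N :: nat and e :: "nat \<Rightarrow> 's::finite sqm"
begin

definition cas :: "'l::finite \<Rightarrow> 'l \<Rightarrow> ('l \<Rightarrow> 's) sqm" where
  "cas a b = (\<Sum>i=1..N. gg e a b i)"

end

text \<open>The dimension is such that in each factor there are \<open>4 ^ k\<close> good monomials,
  as many as matrix entries; the surjectivity of \<open>theta\<close> rests on this count.\<close>

locale spinor_power = clifford_matrices N e for N :: nat and e :: "nat \<Rightarrow> 's::finite sqm" +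
  fixes k :: nat
  assumes card_s: "CARD('s) = 2 ^ k" and N_cases: "N = 2 * k \<or> N = 2 * k + 1"
begin

definition tmon :: "('l::finite \<Rightarrow> nat set) \<Rightarrow> ('l \<Rightarrow> 's) sqm" where
  "tmon A = tens (\<lambda>a. mon (A a))"

text \<open>The quantization map from the tensor product of exterior algebras to the operators on
  the tensor power. It becomes a bijection on the functions supported on \<open>good\<close>
  configurations.\<close>

definition theta :: "(('l::finite \<Rightarrow> nat set) \<Rightarrow> complex) \<Rightarrow> ('l \<Rightarrow> 's) sqm" where
  "theta f = (\<Sum>A\<in>configs N. of_complex (f A) * tmon A)"

lemma slot_tmon:
  assumes i: "i \<in> {1..N}" and A: "A \<in> configs N"
  shows "slot a (e i) * tmon A = of_complex (sg i (A a)) * tmon (A(a := toggle i (A a)))"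
proof -
  have "slot a (e i) * tmon A = tens ((\<lambda>a. mon (A a))(a := of_complex (sg i (A a)) * mon (toggle i (A a))))"
    unfolding tmon_def slot_tens using e_mon[OF i, of "A a"] A by (simp add: configs_def)
  also have "\<dots> = of_complex (sg i (A a)) * tens ((\<lambda>a. mon (A a))(a := mon (toggle i (A a))))"
    by (rule tens_upd_scale)
  also have "(\<lambda>a. mon (A a))(a := mon (toggle i (A a))) = (\<lambda>b. mon ((A(a := toggle i (A a))) b))"
    by auto
  finally show ?thesis unfolding tmon_def .
qed

lemma tmon_slot:
  assumes i: "i \<in> {1..N}" and A: "A \<in> configs N"
  shows "tmon A * slot a (e i) = of_complex (chr i (A a)) * (slot a (e i) * tmon A)"
proof -
  have "mon (A a) * e i = of_complex (chr i (A a)) * (e i * mon (A a))"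
    using e_mon_commute[OF i, of "A a"] A by (simp add: configs_def)
  then show ?thesis
    unfolding tmon_def slot_tens tens_slot by (simp add: tens_upd_scale)
qed

lemma theta_add: "theta (\<lambda>A. f A + g A) = theta f + theta g"
  by (simp add: theta_def of_complex_add algebra_simps sum.distrib)

lemma theta_scale: "theta (\<lambda>A. c * f A) = of_complex c * theta f"
  by (simp add: theta_def of_complex_mult mult.assoc sum_distrib_left)

lemma theta_zero [simp]: "theta (\<lambda>A. 0) = 0"
  by (simp add: theta_def)

lemma theta_diff: "theta (\<lambda>A. f A - g A) = theta f - theta g"
  by (simp add: theta_def of_complex_diff algebra_simps sum_subtractf)

lemma theta_sum: "theta (\<lambda>A. \<Sum>i\<in>I. g i A) = (\<Sum>i\<in>I. theta (g i))"
  by (induction I rule: infinite_finite_induct) (simp_all add: theta_add)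

lemma theta_cliff:
  fixes f :: "('l::finite \<Rightarrow> nat set) \<Rightarrow> complex"
  assumes i: "i \<in> {1..N}"
  shows "theta (act (cliff a i) f) = slot a (e i) * theta f"
proof -
  let ?t = "\<lambda>A. A(a := toggle i (A a))"
  have "slot a (e i) * theta f = (\<Sum>A\<in>configs N. of_complex (f A * sg i (A a)) * tmon (?t A))"
    unfolding theta_def sum_distrib_left
  proof (intro sum.cong refl)
    fix A :: "'l \<Rightarrow> nat set" assume A: "A \<in> configs N"
    have "slot a (e i) * (of_complex (f A) * tmon A) = of_complex (f A) * (slot a (e i) * tmon A)"
      by (rule of_complex_left_commute)
    then show "slot a (e i) * (of_complex (f A) * tmon A) = of_complex (f A * sg i (A a)) * tmon (?t A)"
      unfolding slot_tmon[OF i A] of_complex_mult by (simp only: mult.assoc)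
  qed
  also have "\<dots> = (\<Sum>A\<in>configs N. of_complex (act (cliff a i) f A) * tmon A)"
    by (rule sum.reindex_bij_witness[of _ ?t ?t])
      (use i in \<open>auto simp: configs_toggle_iff act_cliff mult.commute[of "sg _ _"]\<close>)
  finally show ?thesis by (simp add: theta_def)
qed

text \<open>Multiplication from the right is multiplication from the left after weighting the
  coefficients by a character, so conjugation by a generator acts diagonally on monomials.\<close>

lemma theta_slot:
  assumes i: "i \<in> {1..N}"
  shows "theta f * slot a (e i) = slot a (e i) * theta (\<lambda>A. chr i (A a) * f A)"
  unfolding theta_def sum_distrib_left sum_distrib_right
proof (intro sum.cong refl)
  fix A :: "'a \<Rightarrow> nat set" assume A: "A \<in> configs N"
  have "of_complex (f A) * tmon A * slot a (e i) = of_complex (f A) * (of_complex (chr i (A a)) * (slot a (e i) * tmon A))"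
    by (simp only: mult.assoc tmon_slot[OF i A])
  also have "\<dots> = of_complex (chr i (A a) * f A) * (slot a (e i) * tmon A)"
    by (simp only: mult.assoc[symmetric] of_complex_mult[symmetric] mult.commute[of "f A"])
  also have "\<dots> = slot a (e i) * (of_complex (chr i (A a) * f A) * tmon A)"
    by (rule of_complex_left_commute[symmetric])
  finally show "of_complex (f A) * tmon A * slot a (e i) = slot a (e i) * (of_complex (chr i (A a) * f A) * tmon A)" .
qed

lemma slot_e_sq: "i \<in> {1..N} \<Longrightarrow> slot a (e i) * slot a (e i) = 1"
  by (simp add: e_sq flip: slot_mult)

definition good :: "('l::finite \<Rightarrow> nat set) \<Rightarrow> bool" where
  "good A \<longleftrightarrow> (\<forall>a. A a \<in> good_sets N)"

lemma good_configs: "good A \<Longrightarrow> A \<in> configs N"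
  by (auto simp: good_def good_sets_def configs_def)

text \<open>Linear independence by characters: averaging over conjugations isolates one character
  after another until only the configuration \<open>C\<close> is left, and its monomial is
  invertible.\<close>

lemma theta_inj:
  fixes f :: "('l::finite \<Rightarrow> nat set) \<Rightarrow> complex"
  assumes f: "\<And>A. f A \<noteq> 0 \<Longrightarrow> good A" and z: "theta f = 0"
  shows "f C = 0"
proof (cases "good C")
  case False
  then show ?thesis using f by blast
next
  case True
  have part: "theta (\<lambda>A. if \<forall>(a, i)\<in>P. chr i (A a) = chr i (C a) then f A else 0) = 0"
    if "finite P" "P \<subseteq> UNIV \<times> {1..N}" for P
    using that
  proof (induction P rule: finite_induct)
    case empty
    then show ?case using z by simp
  next
    case (insert p P)
    obtain a i where p: "p = (a, i)" by (cases p)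
    with insert.prems have i: "i \<in> {1..N}" by auto
    define g where "g = (\<lambda>A. if \<forall>(a, i)\<in>P. chr i (A a) = chr i (C a) then f A else 0)"
    have g: "theta g = 0" unfolding g_def using insert by auto
    have "slot a (e i) * (slot a (e i) * theta (\<lambda>A. chr i (A a) * g A)) = 0"
      using theta_slot[OF i, of g a] g by simp
    then have g': "theta (\<lambda>A. chr i (A a) * g A) = 0"
      by (simp add: slot_e_sq[OF i] flip: mult.assoc)
    \<comment> \<open>Half of one plus the product of the two signs is one where the characters at
      \<open>(a, i)\<close> agree and zero elsewhere.\<close>
    have "(\<lambda>A. if \<forall>(a, i)\<in>insert p P. chr i (A a) = chr i (C a) then f A else 0)
        = (\<lambda>A. (1/2) * (g A + chr i (C a) * (chr i (A a) * g A)))"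
    proof
      fix A
      show "(if \<forall>(a, i)\<in>insert p P. chr i (A a) = chr i (C a) then f A else 0) = (1/2) * (g A + chr i (C a) * (chr i (A a) * g A))"
        using chr_cases[of i "A a"] chr_cases[of i "C a"] by (auto simp: p g_def)
    qed
    then show ?case
      by (simp only: theta_scale theta_add[of g] g g') simp
  qed
  have iff: "(\<forall>(a, i)\<in>UNIV \<times> {1..N}. chr i (A a) = chr i (C a)) \<longleftrightarrow> A = C" if "good A" for A
  proof
    assume *: "\<forall>(a, i)\<in>UNIV \<times> {1..N}. chr i (A a) = chr i (C a)"
    show "A = C"
    proof
      fix a
      show "A a = C a"
        by (rule chr_separates[where N = N]) (use * that True in \<open>auto simp: good_def good_sets_def\<close>)
    qed
  qed auto
  have "(\<lambda>A. if \<forall>(a, i)\<in>UNIV \<times> {1..N}. chr i (A a) = chr i (C a) then f A else 0)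
      = (\<lambda>A. if A = C then f C else 0)"
  proof
    fix A
    show "(if \<forall>(a, i)\<in>UNIV \<times> {1..N}. chr i (A a) = chr i (C a) then f A else 0) = (if A = C then f C else 0)"
      using f[of A] iff[of A] by (cases "f A = 0") auto
  qed
  then have "theta (\<lambda>A. if A = C then f C else 0) = 0"
    using part[of "UNIV \<times> {1..N}"] by simp
  then have "of_complex (f C) * tmon C = 0"
    unfolding theta_def using good_configs[OF True]
    by (simp add: if_distrib[where f = of_complex] if_distrib[where f = "\<lambda>x. x * _"] cong: if_cong)
  moreover have "\<exists>y. tmon C * y = 1"
  proof -
    have "\<forall>a. \<exists>y. mon (C a) * y = 1"
      using True mon_invertible by (auto simp: good_def good_sets_def)
    then obtain Y where "mon (C a) * Y a = 1" for a by metis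
    then have "tmon C * tens Y = 1" by (simp add: tmon_def tens_mult)
    then show ?thesis by blast
  qed
  then obtain y where "tmon C * y = 1" by blast
  then have "of_complex (f C) * tmon C * y = of_complex (f C)" by (simp add: mult.assoc)
  ultimately show ?thesis by (metis mult_zero_left of_complex_eq_0_iff)
qed

lemma theta_eqD:
  assumes "theta f = theta g" "\<And>A. f A \<noteq> 0 \<Longrightarrow> good A" "\<And>A. g A \<noteq> 0 \<Longrightarrow> good A"
  shows "f = g"
proof
  fix A
  have "theta (\<lambda>A. f A - g A) = 0" using assms(1) by (simp add: theta_diff)
  moreover have "good A" if "f A - g A \<noteq> 0" for A
    using assms(2,3)[of A] that by (cases "f A = 0") auto
  ultimately show "f A = g A" using theta_inj[of "\<lambda>A. f A - g A" A] by simp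
qed

text \<open>A dimension count: the good monomials are independent by \<open>theta_inj\<close>, and
  there are as many of them as entries of a matrix on the tensor power. The map \<open>F\<close>
  lays out these entries as one vector, so that dimension theory applies.\<close>

lemma theta_surj:
  fixes x :: "('l::finite \<Rightarrow> 's) sqm"
  shows "\<exists>f. (\<forall>A. f A \<noteq> 0 \<longrightarrow> good A) \<and> theta f = x"
proof -
  define F :: "('l \<Rightarrow> 's) sqm \<Rightarrow> complex^(('l \<Rightarrow> 's) \<times> ('l \<Rightarrow> 's))" where
    "F y = (\<chi> p. ent y (fst p) (snd p))" for y
  define G where "G = {A :: 'l \<Rightarrow> nat set. good A}"
  have Gsub: "G \<subseteq> configs N" using good_configs by (auto simp: G_def)
  then have fin: "finite G" using finite_subset finite_configs by blast
  have F_inj: "y = z" if "F y = F z" for y z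
    using that by (auto intro!: sqm_eqI simp: F_def vec_eq_iff)
  have F_theta: "F (theta f) = (\<Sum>A\<in>G. f A *s F (tmon A))" if "\<And>A. f A \<noteq> 0 \<Longrightarrow> good A" for f
  proof -
    have "theta f = (\<Sum>A\<in>G. of_complex (f A) * tmon A)"
      unfolding theta_def
    proof (intro sum.mono_neutral_right Gsub ballI)
      fix A assume "A \<in> configs N - G"
      then show "of_complex (f A) * tmon A = 0" using that[of A] by (cases "f A = 0") (auto simp: G_def)
    qed simp
    then show ?thesis by (simp add: F_def vec_eq_iff ent_sum)
  qed
  have indep0: "f A = 0" if "(\<Sum>A\<in>G. f A *s F (tmon A)) = 0" "A \<in> G" for f A
  proof -
    define h where "h = (\<lambda>A. if A \<in> G then f A else 0)"
    have h: "good A" if "h A \<noteq> 0" for A using that by (auto simp: h_def G_def split: if_splits)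
    have "F (theta h) = (\<Sum>A\<in>G. h A *s F (tmon A))"
      by (rule F_theta) (rule h)
    also have "\<dots> = (\<Sum>A\<in>G. f A *s F (tmon A))"
      by (rule sum.cong) (auto simp: h_def)
    also have "\<dots> = F 0" using that(1) by (simp add: F_def vec_eq_iff)
    finally have "theta h = 0" by (rule F_inj)
    from theta_inj[of h A, OF h this] that(2) show ?thesis by (simp add: h_def)
  qed
  have inj: "inj_on (\<lambda>A. F (tmon A)) G"
  proof (rule inj_onI, rule ccontr)
    fix A B assume AB: "A \<in> G" "B \<in> G" "F (tmon A) = F (tmon B)" "A \<noteq> B"
    have "(\<Sum>C\<in>G. (if C = A then 1 else if C = B then -1 else 0) *s F (tmon C))
        = (\<Sum>C\<in>{A, B}. (if C = A then 1 else if C = B then -1 else 0) *s F (tmon C))"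
      using AB fin by (intro sum.mono_neutral_right) auto
    also have "\<dots> = 0" using AB by simp
    finally show False using indep0[of "\<lambda>C. if C = A then 1 else if C = B then -1 else 0" A] AB by simp
  qed
  let ?V = "(\<lambda>A. F (tmon A)) ` G"
  have "vec.independent ?V"
  proof (rule vec.independent_if_scalars_zero)
    show "finite ?V" using fin by simp
    fix u v assume u: "(\<Sum>v\<in>?V. u v *s v) = 0" "v \<in> ?V"
    then have "(\<Sum>A\<in>G. u (F (tmon A)) *s F (tmon A)) = 0"
      by (simp add: sum.reindex[OF inj])
    from indep0[OF this] u(2) show "u v = 0" by auto
  qed
  moreover have "card ?V = CARD(('l \<Rightarrow> 's) \<times> ('l \<Rightarrow> 's))"
  proof -
    have "G = (\<Pi>\<^sub>E a\<in>UNIV. good_sets N)" by (auto simp: G_def good_def PiE_def)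
    then have "card G = (4 ^ k) ^ CARD('l)"
      by (simp add: card_PiE card_good_sets[OF N_cases] power_mult)
    moreover have "CARD(('l \<Rightarrow> 's) \<times> ('l \<Rightarrow> 's)) = (2 ^ k) ^ CARD('l) * (2 ^ k) ^ CARD('l)"
      by (simp add: card_fun card_s)
    ultimately show ?thesis
      by (simp add: card_image[OF inj] power_mult_distrib[symmetric])
  qed
  ultimately have "UNIV \<subseteq> vec.span ?V"
    by (intro vec.card_ge_dim_independent) (simp_all add: vec_dim_card del: vec.dim_UNIV)
  then have "F x \<in> range (\<lambda>u. \<Sum>v\<in>?V. u v *s v)"
    using fin by (subst vec.span_finite[symmetric]) auto
  then obtain u where "F x = (\<Sum>v\<in>?V. u v *s v)" by blast
  then have u: "F x = (\<Sum>A\<in>G. u (F (tmon A)) *s F (tmon A))"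
    by (simp add: sum.reindex[OF inj])
  define f where "f = (\<lambda>A. if A \<in> G then u (F (tmon A)) else 0)"
  have f: "good A" if "f A \<noteq> 0" for A using that by (auto simp: f_def G_def split: if_splits)
  have "F (theta f) = (\<Sum>A\<in>G. f A *s F (tmon A))"
    by (rule F_theta) (rule f)
  also have "\<dots> = F x" unfolding u by (rule sum.cong) (auto simp: f_def)
  finally have "theta f = x" by (rule F_inj)
  with f show ?thesis by blast
qed

lemma theta_vacuum: "theta (\<lambda>A. if A = (\<lambda>_. {}) then 1 else 0) = 1"
proof -
  have "(\<lambda>_. {}) \<in> configs N" by (simp add: configs_def)
  then show ?thesis
    unfolding theta_def
    by (simp add: if_distrib[where f = of_complex] if_distrib[where f = "\<lambda>x. x * _"] tmon_def cong: if_cong)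
qed

end

section \<open>The commutant of the spin group\<close>

inductive_set galg :: "'r::complex_alg set \<Rightarrow> 'r set" for S where
  galg_of_complex: "of_complex c \<in> galg S"
| galg_incl: "x \<in> S \<Longrightarrow> x \<in> galg S"
| galg_add: "x \<in> galg S \<Longrightarrow> y \<in> galg S \<Longrightarrow> x + y \<in> galg S"
| galg_mult: "x \<in> galg S \<Longrightarrow> y \<in> galg S \<Longrightarrow> x * y \<in> galg S"

lemma galg_0: "0 \<in> galg S" and galg_1: "1 \<in> galg S"
  using galg_of_complex[of 0 S] galg_of_complex[of 1 S] by simp_all

lemma galg_sum: "(\<And>i. i \<in> I \<Longrightarrow> f i \<in> galg S) \<Longrightarrow> sum f I \<in> galg S"
  by (induction I rule: infinite_finite_induct) (auto intro: galg_add galg_0)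

lemma galg_power: "x \<in> galg S \<Longrightarrow> x ^ n \<in> galg S"
  by (induction n) (auto intro: galg_mult galg_1)

lemma galg_least: "x \<in> galg S \<Longrightarrow> S \<subseteq> galg T \<Longrightarrow> x \<in> galg T"
  by (induction rule: galg.induct) (auto intro: galg.intros)

lemma galg_commute:
  assumes "x \<in> galg S" "\<And>s. s \<in> S \<Longrightarrow> s * y = y * s" shows "x * y = y * x"
  using assms(1)
proof (induction rule: galg.induct)
  case (galg_mult x z)
  then show ?case by (metis mult.assoc)
qed (auto simp: of_complex_commute assms(2) algebra_simps)

context spinor_power
begin

text \<open>Up to a factor, the infinitesimal rotation in the plane of \<open>i\<close> and
  \<open>j\<close>, acting on the tensor power of the spinors.\<close>

definition rot :: "nat \<Rightarrow> nat \<Rightarrow> ('l::finite \<Rightarrow> 's) sqm" where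
  "rot i j = (\<Sum>a\<in>UNIV. slot a (e i * e j))"

lemma theta_cliff_contr: "theta (act (cliff_contr N a b) f) = cas a b * theta f"
  by (simp add: cliff_contr_def act_sum theta_sum cas_def gg_def theta_cliff sum_distrib_right mult.assoc)

text \<open>The subspace fed into \<open>invariants_generated\<close> is the preimage under
  \<open>theta\<close> of the generated algebra; it is stable because \<open>cliff_contr\<close>
  corresponds to left multiplication by \<open>cas\<close>.\<close>

lemma theta_invariant:
  assumes "invariant N f"
  shows "theta f \<in> galg {cas a b | a b. a \<noteq> b}"
proof -
  let ?S = "{cas a b | a b :: 'a. a \<noteq> b}"
  have "f \<in> {f. theta f \<in> galg ?S}"
  proof (rule invariants_generated[OF _ _ _ assms])
    show "complex_subspace {f. theta f \<in> galg ?S}"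
      by (auto simp: complex_subspace_def theta_add theta_scale intro: galg.intros galg_0)
    show "(\<lambda>A. if A = (\<lambda>_. {}) then 1 else 0) \<in> {f. theta f \<in> galg ?S}"
      by (simp add: theta_vacuum galg_1)
    show "act (cliff_contr N a b) y \<in> {f. theta f \<in> galg ?S}"
      if "a \<noteq> b" "y \<in> {f. theta f \<in> galg ?S}" for a b y
    proof -
      have "cas a b \<in> galg ?S" by (rule galg_incl) (use that(1) in blast)
      with that(2) show ?thesis by (simp add: theta_cliff_contr galg_mult)
    qed
  qed
  then show ?thesis by simp
qed

lemma theta_cong: "(\<And>A. A \<in> configs N \<Longrightarrow> f A = g A) \<Longrightarrow> theta f = theta g"
  unfolding theta_def by (intro sum.cong) auto

text \<open>The commutator with \<open>e i * e j\<close> in one slot is left multiplication by it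
  after applying \<open>1 - K a\<close>. This operator is twice the projection to the configurations
  containing exactly one of \<open>i\<close> and \<open>j\<close>, and there Clifford multiplication
  by both exchanges them.\<close>

lemma theta_so:
  fixes f :: "('l::finite \<Rightarrow> nat set) \<Rightarrow> complex"
  assumes i: "i \<in> {1..N}" and j: "j \<in> {1..N}" and ij: "i \<noteq> j"
  shows "of_complex 2 * theta (act (so i j) f) = rot i j * theta f - theta f * rot i j"
proof -
  \<comment> \<open>The product of the characters for \<open>i\<close> and \<open>j\<close>: the
    sizes of the sets cancel modulo two, and one sign is left for each of \<open>i\<close> and
    \<open>j\<close> that is present.\<close>
  define K :: "'l \<Rightarrow> ('l \<Rightarrow> nat set) endo" where "K a = (1 - 2 * num a i) * (1 - 2 * num a j)" for a
  have act_K: "act (K a) f = (\<lambda>A. (if i \<in> A a then -1 else 1) * (if j \<in> A a then -1 else 1) * f A)" for a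
  proof -
    have two: "2 * num a m = num a m + num a m" for m by (rule mult_2)
    show ?thesis unfolding K_def two by (rule ext) (simp add: act_num)
  qed
  have so: "2 * (cre a i * ann a j - cre a j * ann a i) = cliff a i * cliff a j * (1 - K a)" for a :: 'l
  proof -
    let ?c = "cliff a i" and ?d = "cliff a j" and ?n = "num a i" and ?m = "num a j"
    have "cre a i * ann a j = ?c * (1 - ?n) * (?d * ?m)"
      by (simp add: cre_def ann_def num_cliff_same)
    also have "\<dots> = ?c * ?d * ((1 - ?n) * ?m)"
      using num_cliff[of a i a j] ij by (simp add: algebra_simps) (simp add: mult.assoc[symmetric])
    finally have 1: "cre a i * ann a j = ?c * ?d * ((1 - ?n) * ?m)" .
    have "cre a j * ann a i = ?d * (1 - ?m) * (?c * ?n)"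
      by (simp add: cre_def ann_def num_cliff_same)
    also have "\<dots> = ?d * ?c * ((1 - ?m) * ?n)"
      using num_cliff[of a j a i] ij by (simp add: algebra_simps) (simp add: mult.assoc[symmetric])
    also have "?d * ?c = - (?c * ?d)" using cliff_anticommute[of j i a] ij by simp
    finally have 2: "cre a j * ann a i = - (?c * ?d * ((1 - ?m) * ?n))" by simp
    have K2: "1 - K a = 2 * ((1 - ?n) * ?m + (1 - ?m) * ?n)"
      using num_commute[of a i a j] unfolding K_def mult_2 by (simp add: algebra_simps)
    show ?thesis unfolding 1 2 K2 by (simp add: algebra_simps mult_2 mult_2_right)
  qed
  have right: "theta f * slot a (e i * e j) = slot a (e i * e j) * theta (act (K a) f)" for a :: 'l
  proof -
    have "theta f * slot a (e i * e j) = slot a (e i * e j) * theta (\<lambda>A. chr j (A a) * (chr i (A a) * f A))"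
      by (simp only: slot_mult mult.assoc[symmetric] theta_slot[OF i]) (simp only: mult.assoc theta_slot[OF j])
    also have "theta (\<lambda>A. chr j (A a) * (chr i (A a) * f A)) = theta (act (K a) f)"
    proof (rule theta_cong)
      fix A :: "'l \<Rightarrow> nat set" assume "A \<in> configs N"
      then have fin: "finite (A a)" by (auto simp: configs_def intro: finite_subset)
      show "chr j (A a) * (chr i (A a) * f A) = act (K a) f A"
        using chr_eq_1[OF fin, of i] chr_eq_1[OF fin, of j] chr_cases[of i "A a"] chr_cases[of j "A a"]
        unfolding act_K by auto
    qed
    finally show ?thesis .
  qed
  have "of_complex 2 * theta (act (so i j) f) = theta (act (2 * so i j) f)"
    by (simp only: of_complex_2 mult_2 act_simps theta_add)
  also have "2 * so i j = (\<Sum>a\<in>UNIV. cliff a i * cliff a j * (1 - K a))"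
    unfolding so[symmetric] so_def gl_def by (simp add: sum_distrib_left sum_subtractf right_diff_distrib)
  also have "theta (act \<dots> f) = (\<Sum>a\<in>UNIV. slot a (e i * e j) * (theta f - theta (act (K a) f)))"
    unfolding act_sum theta_sum by (simp add: theta_cliff[OF i] theta_cliff[OF j] theta_diff slot_mult mult.assoc)
  also have "\<dots> = rot i j * theta f - theta f * rot i j"
    by (simp add: rot_def right_diff_distrib sum_subtractf sum_distrib_left sum_distrib_right right)
  finally show ?thesis .
qed

lemma theta_tens_e:
  assumes i: "i \<in> {1..N}"
  shows "theta f * tens (\<lambda>_. e i) = tens (\<lambda>_. e i) * theta (\<lambda>A. (\<Prod>a\<in>UNIV. chr i (A a)) * f A)"
  unfolding theta_def sum_distrib_left sum_distrib_right
proof (intro sum.cong refl)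
  fix A :: "'a \<Rightarrow> nat set" assume A: "A \<in> configs N"
  have "tmon A * tens (\<lambda>_. e i) = tens (\<lambda>a. of_complex (chr i (A a)) * (e i * mon (A a)))"
    unfolding tmon_def tens_mult using A by (intro arg_cong[where f = tens] ext) (auto simp: e_mon_commute[OF i] configs_def)
  also have "\<dots> = of_complex (\<Prod>a\<in>UNIV. chr i (A a)) * (tens (\<lambda>_. e i) * tmon A)"
    unfolding tens_scale tmon_def tens_mult ..
  finally have *: "tmon A * tens (\<lambda>_. e i) = of_complex (\<Prod>a\<in>UNIV. chr i (A a)) * (tens (\<lambda>_. e i) * tmon A)" .
  have "of_complex (f A) * tmon A * tens (\<lambda>_. e i) = of_complex (f A) * of_complex (\<Prod>a\<in>UNIV. chr i (A a)) * (tens (\<lambda>_. e i) * tmon A)"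
    by (simp only: * mult.assoc)
  also have "\<dots> = of_complex ((\<Prod>a\<in>UNIV. chr i (A a)) * f A) * (tens (\<lambda>_. e i) * tmon A)"
    by (simp only: of_complex_mult[symmetric] mult.commute[of "f A"])
  also have "\<dots> = tens (\<lambda>_. e i) * (of_complex ((\<Prod>a\<in>UNIV. chr i (A a)) * f A) * tmon A)"
    by (rule of_complex_left_commute[symmetric])
  finally show "of_complex (f A) * tmon A * tens (\<lambda>_. e i) = tens (\<lambda>_. e i) * (of_complex ((\<Prod>a\<in>UNIV. chr i (A a)) * f A) * tmon A)" .
qed

lemma sum_card_configs:
  assumes A: "A \<in> configs N"
  shows "(\<Sum>a\<in>UNIV. card (A a)) = (\<Sum>j=1..N. card {a::'l::finite. j \<in> A a})"
proof -
  have "card (A a) = (\<Sum>j=1..N. if j \<in> A a then 1 else 0)" for a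
  proof -
    have "{1..N} \<inter> A a = A a" using A by (auto simp: configs_def)
    then show ?thesis by (simp add: sum.If_cases Collect_mem_eq)
  qed
  then show ?thesis by (simp only:) (subst sum.swap, simp add: sum.If_cases)
qed

text \<open>Each character has exponent the size of the set plus one if \<open>i\<close> belongs to
  it; summing over the factors, the sizes are recounted index by index.\<close>

lemma prod_chr:
  assumes A: "A \<in> configs N"
  shows "(\<Prod>a\<in>UNIV. chr i (A a)) = (-1) ^ ((\<Sum>j=1..N. card {a. j \<in> A a}) + card {a::'l::finite. i \<in> A a})"
proof -
  have fin: "finite (A a)" for a using A finite_subset[of "A a" "{1..N}"] by (auto simp: configs_def)
  have "chr i (A a) = (-1) ^ (card (A a) + (if i \<in> A a then 1 else 0))" for a
    using chr_eq_1[OF fin, of i a] chr_cases[of i "A a"] by (cases "i \<in> A a"; cases "even (card (A a))") auto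
  then have "(\<Prod>a\<in>UNIV. chr i (A a)) = (-1) ^ (\<Sum>a\<in>UNIV. card (A a) + (if i \<in> A a then 1 else 0))"
    by (simp add: power_sum)
  also have "(\<Sum>a\<in>UNIV. card (A a) + (if i \<in> A a then 1 else 0)) = (\<Sum>a\<in>UNIV. card (A a)) + card {a. i \<in> A a}"
    by (simp add: sum.distrib sum.If_cases)
  also have "(\<Sum>a\<in>UNIV. card (A a)) = (\<Sum>j=1..N. card {a. j \<in> A a})"
    by (rule sum_card_configs[OF A])
  finally show ?thesis .
qed

lemma parity_equal:
  fixes n :: "nat \<Rightarrow> nat"
  assumes "\<And>i. i \<in> {1..N} \<Longrightarrow> even (n i) \<longleftrightarrow> b"
  shows "even (\<Sum>i=1..N. n i) \<longleftrightarrow> (b \<or> even N)"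
proof -
  have "even (\<Sum>i\<in>J. n i) \<longleftrightarrow> (b \<or> even (card J))" if "finite J" "J \<subseteq> {1..N}" for J
    using that by (induction J rule: finite_induct) (auto simp: assms)
  from this[of "{1..N}"] show ?thesis by simp
qed

text \<open>Commutation with the rotations gives the \<open>so\<close> condition. Commutation with
  products of two generators forces the counts \<open>?n i A\<close> to have one common parity, and
  that it is even comes from a single generator if \<open>N\<close> is even and from the even length
  of good monomials if \<open>N\<close> is odd.\<close>

theorem commutant_generated:
  fixes x :: "('l::finite \<Rightarrow> 's) sqm"
  assumes rot: "\<And>i j. i \<in> {1..N} \<Longrightarrow> j \<in> {1..N} \<Longrightarrow> i \<noteq> j \<Longrightarrow> x * rot i j = rot i j * x"
    and sgn: "\<And>i j. i \<in> {1..N} \<Longrightarrow> j \<in> {1..N} \<Longrightarrow>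
      x * (tens (\<lambda>_. e i) * tens (\<lambda>_. e j)) = tens (\<lambda>_. e i) * tens (\<lambda>_. e j) * x"
    and sgn_even: "\<And>i. even N \<Longrightarrow> i \<in> {1..N} \<Longrightarrow> x * tens (\<lambda>_. e i) = tens (\<lambda>_. e i) * x"
  shows "x \<in> galg {cas a b | a b. a \<noteq> b}"
proof -
  obtain f where f: "\<And>A. f A \<noteq> 0 \<Longrightarrow> good A" and x: "theta f = x"
    using theta_surj[of x] by blast
  let ?n = "\<lambda>i A. card {a::'l. i \<in> A a}"
  let ?p = "\<lambda>i A. \<Prod>a\<in>(UNIV :: 'l set). chr i (A a)"
  have tens_sq: "tens (\<lambda>_::'l. e i) * tens (\<lambda>_. e i) = 1" if "i \<in> {1..N}" for i
    using that by (simp add: tens_mult e_sq)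
  have cancel: "y = z" if "i \<in> {1..N}" "tens (\<lambda>_. e i) * y = tens (\<lambda>_. e i) * z" for i and y z :: "('l \<Rightarrow> 's) sqm"
  proof -
    have "y = tens (\<lambda>_. e i) * (tens (\<lambda>_. e i) * y)"
      by (simp only: mult.assoc[symmetric] tens_sq[OF that(1)] mult_1_left)
    also have "\<dots> = tens (\<lambda>_. e i) * (tens (\<lambda>_. e i) * z)" by (simp only: that(2))
    also have "\<dots> = z"
      by (simp only: mult.assoc[symmetric] tens_sq[OF that(1)] mult_1_left)
    finally show ?thesis .
  qed
  have p_sgn: "?p i A = (-1) ^ ((\<Sum>j=1..N. ?n j A) + ?n i A)" if "f A \<noteq> 0" for i A
    using prod_chr good_configs f that by blast
  have supp: "A \<in> configs N \<and> (\<forall>i. even (?n i A))" if A: "f A \<noteq> 0" for A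
  proof
    show conf: "A \<in> configs N" using good_configs f A by blast
    have same: "even (?n i A) \<longleftrightarrow> even (?n j A)" if i: "i \<in> {1..N}" and j: "j \<in> {1..N}" for i j
    proof -
      have "tens (\<lambda>_. e i) * tens (\<lambda>_. e j) * theta (\<lambda>A. ?p j A * (?p i A * f A)) = theta f * (tens (\<lambda>_. e i) * tens (\<lambda>_. e j))"
        by (simp only: mult.assoc[symmetric] theta_tens_e[OF i]) (simp only: mult.assoc theta_tens_e[OF j])
      also have "\<dots> = tens (\<lambda>_. e i) * tens (\<lambda>_. e j) * theta f"
        using sgn[OF i j] x by simp
      finally have eq: "tens (\<lambda>_. e i) * (tens (\<lambda>_. e j) * theta (\<lambda>A. ?p j A * (?p i A * f A)))
          = tens (\<lambda>_. e i) * (tens (\<lambda>_. e j) * theta f)"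
        by (simp only: mult.assoc)
      have "theta (\<lambda>A. ?p j A * (?p i A * f A)) = theta f"
        by (rule cancel[OF j]) (rule cancel[OF i], rule eq)
      then have "(\<lambda>A. ?p j A * (?p i A * f A)) = f"
        by (rule theta_eqD) (use f in auto)
      from fun_cong[OF this, of A] have "?p j A * ?p i A = 1" using A by simp
      then have "even ((\<Sum>j=1..N. ?n j A) + ?n j A + ((\<Sum>j=1..N. ?n j A) + ?n i A))"
        unfolding p_sgn[OF A] power_add[symmetric] by (metis neg_one_odd_power one_neq_neg_one)
      then show ?thesis by auto
    qed
    have all_even: "even (?n i A)" if i: "i \<in> {1..N}" for i
    proof (cases "even N")
      case True
      have "tens (\<lambda>_. e i) * theta (\<lambda>A. ?p i A * f A) = tens (\<lambda>_. e i) * theta f"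
        using sgn_even[OF True i] theta_tens_e[OF i, of f] x by simp
      then have "theta (\<lambda>A. ?p i A * f A) = theta f" by (rule cancel[OF i])
      then have "(\<lambda>A. ?p i A * f A) = f" by (rule theta_eqD) (use f in auto)
      from fun_cong[OF this, of A] have "?p i A = 1" using A by simp
      then have "even ((\<Sum>j=1..N. ?n j A) + ?n i A)"
        unfolding p_sgn[OF A] by (metis neg_one_odd_power one_neq_neg_one)
      \<comment> \<open>An even number of summands of equal parity, so that the sign is governed by
        \<open>?n i A\<close> alone.\<close>
      moreover have "even (\<Sum>j=1..N. ?n j A)"
        using parity_equal[of "\<lambda>j. ?n j A" "even (?n i A)"] same[OF _ i] True by blast
      ultimately show ?thesis by simp
    next
      case False
      \<comment> \<open>The total degree is even, but an odd number of odd counts would have an odd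
        sum.\<close>
      have "even (card (A a))" for a using f[OF A] False by (auto simp: good_def good_sets_def)
      then have "even (\<Sum>a\<in>UNIV. card (A a))" by (simp add: dvd_sum)
      moreover have "(\<Sum>a\<in>UNIV. card (A a)) = (\<Sum>j=1..N. ?n j A)"
        by (rule sum_card_configs[OF conf])
      ultimately show ?thesis
        using parity_equal[of "\<lambda>j. ?n j A" "even (?n i A)"] same[OF _ i] False by simp
    qed
    show "\<forall>i. even (?n i A)"
    proof
      fix i
      show "even (?n i A)"
      proof (cases "i \<in> {1..N}")
        case False
        then have "{a. i \<in> A a} = {}" using conf unfolding configs_def by blast
        then show ?thesis by simp
      qed (rule all_even)
    qed
  qed
  have "act (so i j) f = (\<lambda>A. 0)" if i: "i \<in> {1..N}" and j: "j \<in> {1..N}" for i j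
  proof (cases "i = j")
    case True
    then show ?thesis by (simp add: so_def)
  next
    case False
    have "of_complex 2 * theta (act (so i j) f) = 0"
      unfolding theta_so[OF i j False] x using rot[OF i j False] by simp
    then have "theta (act (so i j) f) = 0"
      using of_complex_inverse_cancel[of 2 "theta (act (so i j) f)"] by simp
    \<comment> \<open>Injectivity of \<open>theta\<close> holds on good supports only. Replacing
      \<open>j\<close> by \<open>i\<close> in one factor, or conversely, keeps the size of the set,
      so \<open>so\<close> respects them.\<close>
    moreover have "good A" if nz: "act (so i j) f A \<noteq> 0" for A
    proof -
      have "(\<Sum>a\<in>UNIV. act (cre a i) (act (ann a j) f) A) \<noteq> 0 \<or> (\<Sum>a\<in>UNIV. act (cre a j) (act (ann a i) f) A) \<noteq> 0"
        using nz by (auto simp: so_def gl_def act_sum)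
      then obtain a where "act (cre a i) (act (ann a j) f) A \<noteq> 0 \<or> act (cre a j) (act (ann a i) f) A \<noteq> 0"
        by (meson sum.neutral)
      then have h: "f (A(a := toggle i (toggle j (A a)))) \<noteq> 0" "i \<in> A a \<longleftrightarrow> j \<notin> A a"
        using False by (auto simp: act_cre' act_ann' toggle_commute[of i j] split: if_splits)
      from f[OF h(1)] have g: "(A(a := toggle i (toggle j (A a)))) b \<in> good_sets N" for b unfolding good_def by blast
      have "A a \<in> good_sets N"
      proof -
        have g': "toggle i (toggle j (A a)) \<in> good_sets N" using g[of a] by simp
        have sub: "A a \<subseteq> {1..N}"
        proof
          fix m assume m: "m \<in> A a"
          show "m \<in> {1..N}"
          proof (cases "m = i \<or> m = j")
            case True then show ?thesis using i j by blast
          next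
            case False
            then have "m \<in> toggle i (toggle j (A a))" using m by simp
            then show ?thesis using g' unfolding good_sets_def by blast
          qed
        qed
        then have fin: "finite (A a)" using finite_subset by blast
        have "card (toggle i (toggle j (A a))) = card (A a)"
          using h(2) False fin card_gt_0_iff[of "A a"] by (cases "i \<in> A a") (auto simp: toggle_def card_Diff_singleton insert_Diff_if)
        then show ?thesis using g' sub by (simp add: good_sets_def)
      qed
      moreover have "A b \<in> good_sets N" if "b \<noteq> a" for b using g[of b] that by simp
      ultimately show ?thesis unfolding good_def by metis
    qed
    ultimately show ?thesis using theta_inj by blast
  qed
  then have "invariant N f" using supp by (simp add: invariant_def)
  then show ?thesis using theta_invariant x by blast
qed

end

section \<open>Commuting involutions\<close>

text \<open>A substitute for simultaneous diagonalization inside an abstract algebra, whose elements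
  serve as vectors: \<open>y\<close> is the average of \<open>y + u j * y\<close> and
  \<open>y - u j * y\<close>, eigenvectors of \<open>u j\<close>. The set \<open>J\<close> holds the
  involutions not yet diagonalized.\<close>

lemma joint_eigenvectors:
  fixes h :: "'r::complex_alg"
  assumes I: "finite I" and sq: "\<And>i. i \<in> I \<Longrightarrow> u i * u i = 1"
    and com: "\<And>i j. i \<in> I \<Longrightarrow> j \<in> I \<Longrightarrow> u i * u j = u j * u i"
    and h: "\<And>s y. (\<And>i. i \<in> I \<Longrightarrow> (s i = 1 \<or> s i = -1) \<and> u i * y = of_complex (s i) * y) \<Longrightarrow> h * y = 0"
  shows "h = 0"
proof -
  have "h * y = 0" if "finite J" "J \<subseteq> I" "\<forall>i\<in>I - J. (s i = 1 \<or> s i = -1) \<and> u i * y = of_complex (s i) * y" for J s y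
    using that
  proof (induction J arbitrary: s y rule: finite_induct)
    case empty
    then show ?case using h[of s y] by simp
  next
    case (insert j J)
    have j: "j \<in> I" using insert.prems by simp
    have half: "h * (y + of_complex c * (u j * y)) = 0" if c: "c = 1 \<or> c = -1" for c
    proof (rule insert.IH[of "s(j := c)"])
      show "J \<subseteq> I" using insert.prems by simp
      show "\<forall>i\<in>I - J. ((s(j := c)) i = 1 \<or> (s(j := c)) i = - 1) \<and>
          u i * (y + of_complex c * (u j * y)) = of_complex ((s(j := c)) i) * (y + of_complex c * (u j * y))"
      proof
        fix i assume i: "i \<in> I - J"
        show "((s(j := c)) i = 1 \<or> (s(j := c)) i = - 1) \<and>
          u i * (y + of_complex c * (u j * y)) = of_complex ((s(j := c)) i) * (y + of_complex c * (u j * y))"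
        proof (cases "i = j")
          case True
          have "u j * (u j * y) = y" by (simp add: sq[OF j] flip: mult.assoc)
          moreover have "of_complex c * (of_complex c * (u j * y)) = u j * y"
            using c by auto
          ultimately have "u j * (y + of_complex c * (u j * y)) = of_complex c * (y + of_complex c * (u j * y))"
            unfolding distrib_left of_complex_left_commute[of "u j"] by (simp only: add.commute)
          then show ?thesis using c True by simp
        next
          case False
          have "u i * (u j * y) = u j * (u i * y)" using com[of i j] i j by (simp flip: mult.assoc)
          moreover have "u i * y = of_complex (s i) * y" "s i = 1 \<or> s i = -1"
            using insert.prems(2) i False by auto
          ultimately have "u i * (y + of_complex c * (u j * y)) = of_complex (s i) * (y + of_complex c * (u j * y))"
            unfolding distrib_left of_complex_left_commute[of "u i"] of_complex_left_commute[of "of_complex (s i)"]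
            by (simp only: of_complex_left_commute[of "u j"])
          with \<open>s i = 1 \<or> s i = -1\<close> show ?thesis using False by simp
        qed
      qed
    qed
    have "2 * (h * y) = 0"
      using half[of 1] half[of "-1"] by (simp add: distrib_left right_diff_distrib mult_2)
    then show ?case
      using of_complex_inverse_cancel[of 2 "h * y"] by simp
  qed
  \<comment> \<open>With all involutions in \<open>J\<close> the vector may be arbitrary; the unit
    gives \<open>h\<close> itself.\<close>
  from this[of I _ 1] I show ?thesis by simp
qed

section \<open>Polynomials in an operator\<close>

definition peval :: "complex poly \<Rightarrow> 'r::complex_alg \<Rightarrow> 'r" where
  "peval p x = (\<Sum>i\<le>degree p. of_complex (coeff p i) * x ^ i)"

lemma peval_galg: "x \<in> galg S \<Longrightarrow> peval p x \<in> galg S"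
  unfolding peval_def by (intro galg_sum galg_mult galg_of_complex galg_power)

lemma peval_eigenvector:
  assumes "x * y = of_complex c * y"
  shows "peval p x * y = of_complex (poly p c) * y"
proof -
  have "x ^ n * y = of_complex (c ^ n) * y" for n
  proof (induction n)
    case (Suc n)
    have "x ^ Suc n * y = x * (x ^ n * y)" by (simp add: mult.assoc)
    also have "\<dots> = of_complex (c ^ n) * (x * y)" unfolding Suc by (rule of_complex_left_commute)
    also have "\<dots> = of_complex (c ^ Suc n) * y"
      unfolding assms by (simp add: mult.commute flip: mult.assoc of_complex_mult)
    finally show ?case .
  qed simp
  then show ?thesis
    unfolding peval_def poly_altdef of_complex_sum sum_distrib_right of_complex_mult
    by (simp add: mult.assoc)
qed

lemma interpolation:
  fixes f :: "complex \<Rightarrow> complex"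
  assumes "finite S" shows "\<exists>p. \<forall>x\<in>S. poly p x = f x"
  using assms
proof (induction S rule: finite_induct)
  case (insert a S)
  then obtain p where p: "\<forall>x\<in>S. poly p x = f x" by blast
  define q where "q = (\<Prod>x\<in>S. [:- x, 1:])"
  have q: "poly q a \<noteq> 0" "\<forall>x\<in>S. poly q x = 0"
    using insert.hyps by (auto simp: q_def poly_prod)
  have "\<forall>x\<in>insert a S. poly (p + Polynomial.smult ((f a - poly p a) / poly q a) q) x = f x"
    using p q by auto
  then show ?case by blast
qed auto

section \<open>Sum and product of a family of commuting involutions\<close>

locale commuting_involutions =
  fixes N :: nat and u :: "nat \<Rightarrow> 'r::complex_alg"
  assumes u_sq: "i \<in> {1..N} \<Longrightarrow> u i * u i = 1"
    and u_commute: "i \<in> {1..N} \<Longrightarrow> j \<in> {1..N} \<Longrightarrow> u i * u j = u j * u i"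
begin

definition total :: 'r where "total = (\<Sum>i=1..N. u i)"
definition uprod :: 'r where "uprod = prod_list (map u [1..<Suc N])"

text \<open>If \<open>m\<close> of the involutions act as \<open>-1\<close> on a joint eigenvector,
  their sum acts as \<open>N - 2 m\<close> and their product as \<open>(-1) ^ m\<close>.\<close>

lemma eq_0_by_eigenvectors:
  assumes "\<And>m y. m \<le> N \<Longrightarrow> total * y = of_complex (of_nat N - 2 * of_nat m) * y \<Longrightarrow>
      uprod * y = of_complex ((-1) ^ m) * y \<Longrightarrow> h * y = 0"
  shows "h = 0"
proof (rule joint_eigenvectors[of "{1..N}" u])
  fix s y assume *: "\<And>i. i \<in> {1..N} \<Longrightarrow> (s i = 1 \<or> s i = -1) \<and> u i * y = of_complex (s i) * y"
  define m where "m = card {i \<in> {1..N}. s i = -1}"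
  have m: "m \<le> N" unfolding m_def using card_mono[of "{1..N}" "{i \<in> {1..N}. s i = -1}"] by fastforce
  have "(\<Sum>i=1..N. s i) = (\<Sum>i=1..N. 1 - 2 * (if s i = -1 then 1 else 0))"
    by (rule sum.cong) (use * in auto)
  also have "\<dots> = of_nat N - 2 * of_nat m"
    by (simp add: sum_subtractf m_def sum.If_cases Int_def flip: sum_distrib_left)
  finally have sum_s: "(\<Sum>i=1..N. s i) = of_nat N - 2 * of_nat m" .
  have "total * y = (\<Sum>i=1..N. of_complex (s i) * y)"
    unfolding total_def sum_distrib_right by (rule sum.cong) (use * in auto)
  then have "total * y = of_complex (of_nat N - 2 * of_nat m) * y"
    by (simp only: sum_s[symmetric] of_complex_sum sum_distrib_right)
  moreover have "uprod * y = of_complex ((-1) ^ m) * y"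
  proof -
    have "prod_list (map u xs) * y = of_complex (prod_list (map s xs)) * y" if "set xs \<subseteq> {1..N}" for xs
      using that
    proof (induction xs)
      case (Cons i xs)
      have "prod_list (map u (i # xs)) * y = u i * (prod_list (map u xs) * y)" by (simp add: mult.assoc)
      also have "\<dots> = of_complex (prod_list (map s xs)) * (u i * y)"
        using Cons by (simp only: list.simps set_simps insert_subset simp_thms of_complex_left_commute)
      also have "u i * y = of_complex (s i) * y" using *[of i] Cons.prems by simp
      also have "of_complex (prod_list (map s xs)) * (of_complex (s i) * y) = of_complex (prod_list (map s (i # xs))) * y"
        by (simp only: mult.assoc[symmetric] of_complex_mult[symmetric] list.map prod_list.Cons mult.commute[of "s i"])
      finally show ?case .
    qed simp
    moreover have "prod_list (map s [1..<Suc N]) = (\<Prod>i=1..N. s i)"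
      by (simp add: prod.distinct_set_conv_list[symmetric] atLeastLessThanSuc_atLeastAtMost del: upt_Suc)
    moreover have "(\<Prod>i=1..N. s i) = (\<Prod>i=1..N. if s i = -1 then -1 else 1)"
      by (rule prod.cong) (use * in auto)
    moreover have "\<dots> = (-1) ^ m"
      by (simp add: prod.If_cases m_def Int_def)
    ultimately show ?thesis
      unfolding uprod_def by (metis atLeastLessThanSuc_atLeastAtMost order_refl set_upt)
  qed
  ultimately show "h * y = 0" using assms m by blast
qed (auto simp: u_sq u_commute)

text \<open>The eigenvalue of the sum determines \<open>m\<close> and with it the sign of the
  product, so interpolation writes the product as a polynomial in the sum.\<close>

lemma uprod_galg: "uprod \<in> galg {total}"
proof -
  \<comment> \<open>The exponent recovers \<open>m\<close> from the node
    \<open>N - 2 m\<close>.\<close>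
  obtain p where p: "\<forall>x\<in>(\<lambda>m. of_nat N - 2 * of_nat m) ` {..N}. poly p x = (-1) ^ nat \<lfloor>(of_nat N - Re x) / 2\<rfloor>"
    using interpolation[of "(\<lambda>m. of_nat N - 2 * of_nat m) ` {..N}" "\<lambda>x. (-1) ^ nat \<lfloor>(of_nat N - Re x) / 2\<rfloor>"] by blast
  have "uprod - peval p total = 0"
  proof (rule eq_0_by_eigenvectors)
    fix m y assume m: "m \<le> N" and t: "total * y = of_complex (of_nat N - 2 * of_nat m) * y"
      and up: "uprod * y = of_complex ((-1) ^ m) * y"
    have "poly p (of_nat N - 2 * of_nat m) = (-1) ^ m" using p m by auto
    then show "(uprod - peval p total) * y = 0"
      by (simp add: left_diff_distrib up peval_eigenvector[OF t])
  qed
  then show ?thesis using peval_galg[of total "{total}" p] galg_incl[of total "{total}"] by simp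
qed

text \<open>Opposite eigenvalues of the sum belong to \<open>m\<close> and \<open>N - m\<close>, of
  different parity for odd \<open>N\<close>. A scalar product admits only one parity, so an
  eigenvalue is determined by its square and interpolation applies.\<close>

lemma total_galg_square:
  assumes N: "odd N" and c: "uprod = of_complex c"
  shows "total \<in> galg {total * total}"
proof -
  define g where "g m = (of_nat N - 2 * of_nat m :: complex)" for m :: nat
  define M where "M = {m. m \<le> N \<and> (-1) ^ m = c}"
  have inj: "inj_on (\<lambda>m. g m * g m) M"
  proof (rule inj_onI)
    fix m n assume mn: "m \<in> M" "n \<in> M" "g m * g m = g n * g n"
    then have "g m = g n \<or> g m = - g n" by (simp add: square_eq_iff)
    moreover have False if "g m = - g n"
    proof -
      have "of_nat (N + N) = (of_nat (2 * m + 2 * n) :: complex)"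
        using that unfolding g_def by (simp add: algebra_simps)
      then have "N = m + n" unfolding of_nat_eq_iff by linarith
      then have "even m \<noteq> even n" using N by auto
      moreover have "(-1) ^ m = ((-1) ^ n :: complex)" using mn by (simp add: M_def)
      ultimately show False by (cases "even m") auto
    qed
    ultimately show "m = n" by (auto simp: g_def)
  qed
  have fin: "finite M" by (simp add: M_def)
  obtain p where p: "\<forall>x\<in>(\<lambda>m. g m * g m) ` M. poly p x = g (the_inv_into M (\<lambda>m. g m * g m) x)"
    using interpolation[of "(\<lambda>m. g m * g m) ` M" "\<lambda>x. g (the_inv_into M (\<lambda>m. g m * g m) x)"] fin by blast
  have "total - peval p (total * total) = 0"
  proof (rule eq_0_by_eigenvectors)
    fix m y assume m: "m \<le> N" and t: "total * y = of_complex (of_nat N - 2 * of_nat m) * y"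
      and up: "uprod * y = of_complex ((-1) ^ m) * y"
    have tg: "total * y = of_complex (g m) * y" using t by (simp add: g_def)
    have tt: "total * total * y = of_complex (g m * g m) * y"
    proof -
      have "total * total * y = total * (of_complex (g m) * y)" by (simp only: mult.assoc tg)
      also have "\<dots> = of_complex (g m) * (of_complex (g m) * y)" by (simp only: of_complex_left_commute[of total] tg)
      finally show ?thesis by (simp only: of_complex_mult mult.assoc)
    qed
    show "(total - peval p (total * total)) * y = 0"
    proof (cases "m \<in> M")
      case True
      then have "poly p (g m * g m) = g m" using p the_inv_into_f_f[OF inj True] by auto
      then show ?thesis by (simp add: left_diff_distrib tg peval_eigenvector[OF tt])
    next
      case False
      then have ne: "(-1) ^ m - c \<noteq> 0" using m by (simp add: M_def)
      have "of_complex ((-1) ^ m - c) * y = 0" using up c by (simp add: of_complex_diff left_diff_distrib)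
      then have "y = 0" using of_complex_inverse_cancel[OF ne, of y] by simp
      then show ?thesis by simp
    qed
  qed
  then show ?thesis
    using peval_galg[of "total * total" "{total * total}" p] galg_incl[of "total * total" "{total * total}"] by simp
qed

text \<open>Half the sum has the eigenvalues \<open>N / 2 - m\<close>, each of which makes one
  factor of the product vanish.\<close>

lemma total_annihilated:
  assumes zs: "\<And>m. m \<le> N \<Longrightarrow> of_nat N / 2 - of_nat m \<in> set zs"
  shows "prod_list (map (\<lambda>z. of_complex (1/2) * total - of_complex z) zs) = 0"
proof (rule eq_0_by_eigenvectors)
  fix m y assume m: "m \<le> N" and t: "total * y = of_complex (of_nat N - 2 * of_nat m) * y"
  define c :: complex where "c = of_nat N / 2 - of_nat m"
  have eig: "(of_complex (1/2) * total - of_complex z) * y = of_complex (c - z) * y" for z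
  proof -
    have "of_complex (1/2) * total * y = of_complex c * y"
      unfolding mult.assoc t c_def by (simp add: diff_divide_distrib flip: mult.assoc of_complex_mult)
    then show ?thesis by (simp add: left_diff_distrib of_complex_diff)
  qed
  have "prod_list (map (\<lambda>z. of_complex (1/2) * total - of_complex z) xs) * y = of_complex (prod_list (map (\<lambda>z. c - z) xs)) * y" for xs
  proof (induction xs)
    case (Cons z xs)
    let ?P = "prod_list (map (\<lambda>z. of_complex (1/2) * total - of_complex z) xs)"
    have "prod_list (map (\<lambda>z. of_complex (1/2) * total - of_complex z) (z # xs)) * y = (of_complex (1/2) * total - of_complex z) * (?P * y)"
      by (simp add: mult.assoc)
    also have "\<dots> = of_complex (prod_list (map (\<lambda>z. c - z) xs)) * ((of_complex (1/2) * total - of_complex z) * y)"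
      unfolding Cons by (rule of_complex_left_commute)
    also have "\<dots> = of_complex (prod_list (map (\<lambda>z. c - z) (z # xs))) * y"
      unfolding eig by (simp add: mult.commute flip: mult.assoc of_complex_mult)
    finally show ?case .
  qed simp
  moreover have "prod_list (map (\<lambda>z. c - z) zs) = 0"
    using zs[OF m] by (auto simp: prod_list_zero_iff c_def)
  ultimately show "prod_list (map (\<lambda>z. of_complex (1/2) * total - of_complex z) zs) * y = 0" by simp
qed

end

text \<open>Only equal indices contribute: the commutator of the sum of the \<open>u i\<close> with
  \<open>w j\<close> is \<open>2 * u j * w j\<close>, and the next one returns
  \<open>4 * w j\<close>. The halves in the two copies of \<open>D\<close> cancel this 4; the half
  in \<open>D'\<close> remains.\<close>

lemma double_commutator:
  fixes u w :: "nat \<Rightarrow> 'r::complex_alg"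
  assumes sq: "\<And>i. i \<in> {1..N} \<Longrightarrow> u i * u i = 1"
    and com: "\<And>i j. i \<in> {1..N} \<Longrightarrow> j \<in> {1..N} \<Longrightarrow> u i * u j = u j * u i"
    and uw: "\<And>i j. i \<in> {1..N} \<Longrightarrow> j \<in> {1..N} \<Longrightarrow> i \<noteq> j \<Longrightarrow> u i * w j = w j * u i"
    and anti: "\<And>i. i \<in> {1..N} \<Longrightarrow> u i * w i = - (w i * u i)"
  defines "D \<equiv> of_complex (1/2) * (\<Sum>i=1..N. u i)" and "D' \<equiv> of_complex (1/2) * (\<Sum>i=1..N. w i)"
  shows "commutator D (commutator D D') = D'"
proof -
  define U where "U = (\<Sum>i=1..N. u i)"
  have comm_scale: "commutator (of_complex (1/2) * x) y = of_complex (1/2) * commutator x y"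
    "commutator x (of_complex (1/2) * y) = of_complex (1/2) * commutator x y" for x y :: 'r
    by (simp_all add: commutator_def mult.assoc of_complex_left_commute right_diff_distrib)
  have comm_sum: "commutator x (sum f {1..N}) = (\<Sum>i=1..N. commutator x (f i))"
    "commutator (sum f {1..N}) x = (\<Sum>i=1..N. commutator (f i) x)" for x :: 'r and f
    by (simp_all add: commutator_def sum_distrib_left sum_distrib_right sum_subtractf)
  have 1: "commutator U (w j) = of_complex 2 * (u j * w j)" if j: "j \<in> {1..N}" for j
  proof -
    have "commutator U (w j) = (\<Sum>i=1..N. if i = j then of_complex 2 * (u j * w j) else 0)"
      unfolding U_def comm_sum
      by (intro sum.cong refl) (use uw anti j in \<open>auto simp: commutator_def mult_2\<close>)
    then show ?thesis using j by simp
  qed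
  have 2: "commutator U (u j * w j) = of_complex 2 * w j" if j: "j \<in> {1..N}" for j
  proof -
    have "commutator (u i) (u j * w j) = (if i = j then of_complex 2 * w j else 0)" if i: "i \<in> {1..N}" for i
    proof (cases "i = j")
      case True
      have "u j * (u j * w j) = w j" by (simp add: sq[OF j] flip: mult.assoc)
      moreover have "u j * w j * u j = - w j"
        using anti[OF j] by (simp add: mult.assoc sq[OF j])
      ultimately show ?thesis using True by (simp add: commutator_def mult_2)
    next
      case False
      have "u i * (u j * w j) = u j * w j * u i"
        using com[OF i j] uw[OF i j False] by (metis mult.assoc)
      then show ?thesis using False by (simp add: commutator_def)
    qed
    then have "commutator U (u j * w j) = (\<Sum>i=1..N. if i = j then of_complex 2 * w j else 0)"
      unfolding U_def comm_sum by (intro sum.cong refl)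
    then show ?thesis using j by simp
  qed
  have "commutator U (\<Sum>j=1..N. w j) = of_complex 2 * (\<Sum>j=1..N. u j * w j)"
    unfolding comm_sum sum_distrib_left by (intro sum.cong refl 1)
  moreover have "commutator U (\<Sum>j=1..N. u j * w j) = of_complex 2 * (\<Sum>j=1..N. w j)"
    unfolding comm_sum sum_distrib_left by (intro sum.cong refl 2)
  moreover have "commutator x (of_complex 2 * y) = of_complex 2 * commutator x y" for x y :: 'r
    by (simp only: commutator_def mult.assoc of_complex_left_commute right_diff_distrib)
  ultimately have "commutator U (commutator U (\<Sum>j=1..N. w j)) = of_complex 2 * (of_complex 2 * (\<Sum>j=1..N. w j))"
    by metis
  then have "commutator D (commutator D D') = of_complex (1/2) * (of_complex (1/2) * (of_complex (1/2) * (of_complex 2 * (of_complex 2 * (\<Sum>j=1..N. w j)))))"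
    unfolding D_def D'_def comm_scale U_def[symmetric] by simp
  then show ?thesis
    unfolding D'_def mult.assoc[symmetric] of_complex_mult[symmetric] by simp
qed

lemma tens_one_plus:
  fixes m :: "'b::finite sqm"
  shows "tens (\<lambda>_::'l::finite. 1 + of_complex t * m) = (\<Sum>S\<in>UNIV. of_complex (t ^ card S) * tens (\<lambda>a. if a \<in> S then m else 1))"
proof (rule sqm_eqI)
  fix f g :: "'l \<Rightarrow> 'b"
  let ?d = "\<lambda>a. ent (1 :: 'b sqm) (f a) (g a)" and ?m = "\<lambda>a. ent m (f a) (g a)"
  have "ent (tens (\<lambda>_::'l. 1 + of_complex t * m)) f g = (\<Prod>a\<in>UNIV. t * ?m a + ?d a)"
    unfolding ent_tens by (intro prod.cong refl) simp
  also have "\<dots> = (\<Sum>S\<in>Pow UNIV. (\<Prod>a\<in>S. t * ?m a) * (\<Prod>a\<in>UNIV - S. ?d a))"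
    by (rule prod_add) simp
  also have "\<dots> = (\<Sum>S\<in>UNIV. t ^ card S * ent (tens (\<lambda>a. if a \<in> S then m else 1)) f g)"
  proof (rule sum.cong)
    fix S :: "'l set"
    have "ent (tens (\<lambda>a. if a \<in> S then m else 1)) f g = (\<Prod>a\<in>UNIV. if a \<in> S then ?m a else ?d a)"
      unfolding ent_tens by (intro prod.cong refl) simp
    also have "\<dots> = (\<Prod>a\<in>S. ?m a) * (\<Prod>a\<in>UNIV - S. ?d a)"
      by (simp add: prod.If_cases Compl_eq_Diff_UNIV)
    finally show "(\<Prod>a\<in>S. t * ?m a) * (\<Prod>a\<in>UNIV - S. ?d a) = t ^ card S * ent (tens (\<lambda>a. if a \<in> S then m else 1)) f g"
      by (simp add: prod.distrib)
  qed simp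
  finally show "ent (tens (\<lambda>_::'l. 1 + of_complex t * m)) f g = ent (\<Sum>S\<in>UNIV. of_complex (t ^ card S) * tens (\<lambda>a. if a \<in> S then m else 1)) f g"
    by (simp add: ent_sum)
qed

text \<open>A one-parameter family in the group forces its derivative at the identity to commute as well.\<close>

lemma commute_derivation:
  fixes X :: "('l::finite \<Rightarrow> 's::finite) sqm"
  assumes "\<And>t::real. X * tens (\<lambda>_. 1 + of_complex (of_real t) * m) = tens (\<lambda>_. 1 + of_complex (of_real t) * m) * X"
  shows "X * (\<Sum>a\<in>UNIV. slot a m) = (\<Sum>a\<in>UNIV. slot a m) * X"
proof (rule sqm_eqI)
  fix f g :: "'l \<Rightarrow> 's"
  define T where "T S = tens (\<lambda>a. if a \<in> S then m else 1)" for S :: "'l set"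
  define d where "d S = ent (X * T S - T S * X) f g" for S
  \<comment> \<open>Expanding the tensor power over the sets \<open>S\<close> of slots that carry
    \<open>m\<close> gives a polynomial in \<open>t\<close>. It vanishes at all real numbers, so
    every coefficient is zero.\<close>
  define p where "p = (\<Sum>S\<in>UNIV. monom (d S) (card S))"
  have "poly p (of_real t) = 0" for t
  proof -
    have "(\<Sum>S\<in>UNIV. of_complex (of_real t ^ card S) * (X * T S - T S * X)) = 0"
      using assms[of t] unfolding tens_one_plus T_def[symmetric]
      by (simp only: sum_distrib_left sum_distrib_right of_complex_left_commute mult.assoc right_diff_distrib sum_subtractf) simp
    then have "ent (\<Sum>S\<in>UNIV. of_complex (of_real t ^ card S) * (X * T S - T S * X)) f g = 0" by simp
    then show ?thesis
      unfolding p_def d_def poly_sum poly_monom ent_sum ent_of_complex_mult by (simp add: mult.commute)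
  qed
  then have "range of_real \<subseteq> {z. poly p z = 0}" by auto
  moreover have "infinite (range (of_real :: real \<Rightarrow> complex))"
    using finite_imageD[of "of_real :: real \<Rightarrow> complex" UNIV] infinite_UNIV_char_0 by (auto simp: inj_on_def)
  ultimately have "p = 0" using poly_roots_finite[of p] finite_subset by blast
  then have "(\<Sum>S\<in>UNIV. coeff (monom (d S) (card S)) 1) = 0"
    unfolding p_def by (metis coeff_0 coeff_sum)
  \<comment> \<open>The linear coefficient comes from the singletons, that is, from \<open>m\<close>
    in a single slot.\<close>
  also have "(\<Sum>S\<in>UNIV. coeff (monom (d S) (card S)) 1) = (\<Sum>S\<in>(\<lambda>a. {a}) ` UNIV. d S)"
    by (rule sum.mono_neutral_cong_right) (auto simp: card_1_singleton_iff)
  also have "\<dots> = (\<Sum>a\<in>UNIV. d {a})" by (simp add: sum.reindex)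
  also have "\<dots> = ent (X * (\<Sum>a\<in>UNIV. slot a m) - (\<Sum>a\<in>UNIV. slot a m) * X) f g"
  proof -
    have "T {a} = slot a m" for a
      unfolding T_def slot_def by (rule arg_cong[where f = tens]) auto
    then show ?thesis
      by (simp only: d_def ent_sum[symmetric] sum_subtractf sum_distrib_left sum_distrib_right)
  qed
  finally show "ent (X * (\<Sum>a\<in>UNIV. slot a m)) f g = ent ((\<Sum>a\<in>UNIV. slot a m) * X) f g" by simp
qed

lemma prod_list_commute:
  fixes x :: "'r::monoid_mult"
  assumes "\<And>y. y \<in> set ys \<Longrightarrow> y * x = x * y" shows "prod_list ys * x = x * prod_list ys"
  using assms
proof (induction ys)
  case (Cons y ys)
  have "prod_list (y # ys) * x = y * (prod_list ys * x)" by (simp add: mult.assoc)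
  also have "prod_list ys * x = x * prod_list ys" by (rule Cons.IH) (simp add: Cons.prems)
  also have "y * (x * prod_list ys) = x * prod_list (y # ys)"
    using Cons.prems[of y] by (simp flip: mult.assoc)
  finally show ?case .
qed simp

lemma prod_list_map_mult:
  fixes P :: "'r::monoid_mult"
  assumes "\<And>i. i \<in> set xs \<Longrightarrow> g i * P = P * g i"
  shows "prod_list (map (\<lambda>i. g i * P) xs) = prod_list (map g xs) * P ^ length xs"
  using assms
proof (induction xs)
  case (Cons x xs)
  have IH: "prod_list (map (\<lambda>i. g i * P) xs) = prod_list (map g xs) * P ^ length xs"
    by (rule Cons.IH) (rule Cons.prems, simp)
  have "prod_list (map (\<lambda>i. g i * P) (x # xs)) = g x * (P * prod_list (map g xs)) * P ^ length xs"
    unfolding list.map prod_list.Cons IH by (simp only: mult.assoc)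
  also have "P * prod_list (map g xs) = prod_list (map g xs) * P"
    using Cons.prems by (intro prod_list_commute[symmetric]) auto
  finally show ?case by (simp add: mult.assoc power_commutes)
qed simp

context commuting_involutions
begin

lemma uprod_commute: "i \<in> {1..N} \<Longrightarrow> u i * uprod = uprod * u i"
  unfolding uprod_def by (rule prod_list_commute[symmetric]) (auto simp: u_commute)

lemma uprod_sq: "uprod * uprod = 1"
proof -
  have "prod_list (map u xs) * prod_list (map u xs) = 1" if "set xs \<subseteq> {1..N}" for xs
    using that
  proof (induction xs)
    case (Cons i xs)
    have "prod_list (map u xs) * u i = u i * prod_list (map u xs)"
    proof (rule prod_list_commute)
      fix y assume "y \<in> set (map u xs)"
      then obtain x where "x \<in> set xs" "y = u x" by auto
      then show "y * u i = u i * y"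
        using u_commute[of x i] Cons.prems by (simp only: set_simps) blast
    qed
    then have "prod_list (map u (i # xs)) * prod_list (map u (i # xs)) = u i * (u i * prod_list (map u xs)) * prod_list (map u xs)"
      by (simp only: list.map prod_list.Cons mult.assoc[symmetric]) (simp only: mult.assoc)
    also have "\<dots> = (u i * u i) * (prod_list (map u xs) * prod_list (map u xs))" by (simp only: mult.assoc)
    also have "\<dots> = 1" using Cons.IH Cons.prems u_sq[of i] by (simp only: set_simps insert_subset) simp
    finally show ?case .
  qed simp
  from this[of "[1..<Suc N]"] show ?thesis
    by (simp add: uprod_def atLeastLessThanSuc_atLeastAtMost del: upt_Suc)
qed

lemma twisted: "commuting_involutions N (\<lambda>i. u i * uprod)"
proof
  have *: "u i * uprod * (u j * uprod) = u i * u j" if "j \<in> {1..N}" for i j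
  proof -
    have "u i * uprod * (u j * uprod) = u i * (uprod * u j) * uprod" by (simp only: mult.assoc)
    also have "uprod * u j = u j * uprod" by (rule uprod_commute[OF that, symmetric])
    also have "u i * (u j * uprod) * uprod = u i * u j * (uprod * uprod)" by (simp only: mult.assoc)
    finally show ?thesis by (simp add: uprod_sq)
  qed
  show "u i * uprod * (u i * uprod) = 1" if "i \<in> {1..N}" for i
    by (simp only: *[OF that] u_sq[OF that])
  show "u i * uprod * (u j * uprod) = u j * uprod * (u i * uprod)" if "i \<in> {1..N}" "j \<in> {1..N}" for i j
    by (simp only: *[OF that(1)] *[OF that(2)] u_commute[OF that])
qed

text \<open>The twist contributes \<open>uprod ^ N\<close>, which is one for even \<open>N\<close>.
  Hence the product can be recovered from the twisted sum, and the twist is reversible within the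
  generated algebra.\<close>

lemma twisted_uprod:
  assumes "even N" shows "commuting_involutions.uprod N (\<lambda>i. u i * uprod) = uprod"
proof -
  have "commuting_involutions.uprod N (\<lambda>i. u i * uprod) = prod_list (map u [1..<Suc N]) * uprod ^ N"
    unfolding commuting_involutions.uprod_def[OF twisted]
    using prod_list_map_mult[of "[1..<Suc N]" u uprod] uprod_commute by (simp add: less_Suc_eq_le del: upt_Suc)
  also have "uprod ^ N = 1"
  proof -
    obtain m where "N = 2 * m" using assms by (elim evenE)
    then have "uprod ^ N = (uprod * uprod) ^ m" by (simp only: power_mult power2_eq_square)
    then show ?thesis by (simp only: uprod_sq power_one)
  qed
  finally show ?thesis by (simp add: uprod_def)
qed

end

text \<open>All letters except \<open>g j\<close> contribute a sign. For \<open>N\<close> letters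
  the total sign is negative if \<open>N\<close> is even and positive if \<open>N\<close> is odd,
  which is where the two cases of the theorem part.\<close>

lemma prod_list_anticommute:
  fixes w :: "'r::complex_alg"
  assumes "distinct xs" "j \<in> set xs" "g j * w = w * g j"
    and "\<And>i. i \<in> set xs \<Longrightarrow> i \<noteq> j \<Longrightarrow> g i * w = - (w * g i)"
  shows "prod_list (map g xs) * w = of_complex ((-1) ^ (length xs - 1)) * (w * prod_list (map g xs))"
proof -
  have "prod_list (map g xs) * w = of_complex ((-1) ^ (length (filter (\<lambda>i. i \<noteq> j) xs))) * (w * prod_list (map g xs))"
    using assms(4)
  proof (induction xs)
    case (Cons x xs)
    let ?c = "of_complex ((-1) ^ (length (filter (\<lambda>i. i \<noteq> j) xs)))" and ?P = "prod_list (map g xs)"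
    have "prod_list (map g (x # xs)) * w = g x * (?P * w)" by (simp add: mult.assoc)
    also have "?P * w = ?c * (w * ?P)" using Cons by simp
    also have "g x * (?c * (w * ?P)) = ?c * (g x * w * ?P)" by (simp only: of_complex_left_commute[of "g x"] mult.assoc)
    finally have *: "prod_list (map g (x # xs)) * w = ?c * (g x * w * ?P)" .
    show ?case
    proof (cases "x = j")
      case True
      then show ?thesis unfolding * using assms(3) by (simp add: mult.assoc)
    next
      case False
      then have "g x * w = - (w * g x)" using Cons.prems by simp
      then show ?thesis unfolding * using False by (simp add: of_complex_minus mult.assoc)
    qed
  qed simp
  moreover have "length (filter (\<lambda>i. i \<noteq> j) xs) = length xs - 1"
  proof -
    have "filter (\<lambda>i. i \<noteq> j) xs = remove1 j xs"
      using assms(1) by (simp add: distinct_remove1_removeAll removeAll_filter_not_eq neq_commute)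
    then show ?thesis using assms(2) by (simp add: length_remove1)
  qed
  ultimately show ?thesis by simp
qed

lemma slot_diff: "slot a (P - Q) = slot a P - slot a Q"
  using slot_add[of a P "- Q"] by (simp add: slot_minus)

lemma of_complex_diff_mult:
  "(of_complex c - x) * (of_complex c - y) = of_complex (c * c) - of_complex c * x - of_complex c * y + x * y"
proof -
  have "x * of_complex c = of_complex c * x" by (rule of_complex_commute[symmetric])
  then show ?thesis
    by (simp add: left_diff_distrib right_diff_distrib of_complex_mult)
qed

lemma slot4:
  assumes "a \<noteq> b"
  shows "slot a p * slot b q * (slot a r * slot b s) = slot a (p * r) * slot b (q * s)"
  unfolding slot_def tens_mult by (rule arg_cong[where f = tens]) (use assms in auto)

lemma gg_disjoint:
  assumes "a \<noteq> c" "a \<noteq> d" "b \<noteq> c" "b \<noteq> d"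
  shows "gg e a b i * gg e c d j = gg e c d j * gg e a b i"
  unfolding gg_def slot_def tens_mult by (rule arg_cong[where f = tens]) (use assms in auto)

context clifford_family
begin

lemma e_anti': "i \<in> {1..N} \<Longrightarrow> j \<in> {1..N} \<Longrightarrow> e i * e j + e j * e i = (if i = j then of_complex 2 else 0)"
  using e_sq[of i] e_anti[of i j] by (cases "i = j") auto

end

section \<open>The operators \<open>C_ab\<close> on tensor slots\<close>

context clifford_matrices
begin

lemma gg_involutions:
  assumes "a \<noteq> b" shows "commuting_involutions N (gg e a b :: nat \<Rightarrow> ('l::finite \<Rightarrow> 's) sqm)"
proof
  fix i assume i: "i \<in> {1..N}"
  show "gg e a b i * gg e a b i = 1"
    by (simp add: gg_def slot4[OF assms] e_sq[OF i])
next
  fix i j assume ij: "i \<in> {1..N}" "j \<in> {1..N}"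
  show "gg e a b i * gg e a b j = gg e a b j * gg e a b i"
    unfolding gg_def slot4[OF assms] using e_anti[OF ij] by (cases "i = j") (auto simp: slot_minus)
qed

lemma gg_chain:
  assumes "a \<noteq> b" "b \<noteq> c" "a \<noteq> c"
  shows "gg e a b i * gg e b c j = slot a (e i) * slot b (e i * e j) * slot c (e j)"
    "gg e b c j * gg e a b i = slot a (e i) * slot b (e j * e i) * slot c (e j)"
proof -
  show "gg e a b i * gg e b c j = slot a (e i) * slot b (e i * e j) * slot c (e j)"
    "gg e b c j * gg e a b i = slot a (e i) * slot b (e j * e i) * slot c (e j)"
    unfolding gg_def slot_def tens_mult by (rule arg_cong[where f = tens], use assms in auto)+
qed

text \<open>Everything is decided in the shared slot \<open>b\<close>. The pattern is the opposite
  of the one in \<open>double_commutator\<close>, where equal indices have to anticommute and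
  different ones to commute.\<close>

lemma gg_chain_commute:
  assumes "a \<noteq> b" "b \<noteq> c" "a \<noteq> c"
  shows "gg e a b i * gg e b c i = gg e b c i * gg e a b i"
    "i \<in> {1..N} \<Longrightarrow> j \<in> {1..N} \<Longrightarrow> i \<noteq> j \<Longrightarrow> gg e a b i * gg e b c j = - (gg e b c j * gg e a b i)"
proof -
  show "gg e a b i * gg e b c i = gg e b c i * gg e a b i"
    unfolding gg_chain[OF assms] ..
  assume "i \<in> {1..N}" "j \<in> {1..N}" "i \<noteq> j"
  from e_anti[OF this] show "gg e a b i * gg e b c j = - (gg e b c j * gg e a b i)"
    unfolding gg_chain[OF assms] by (simp add: slot_minus)
qed

lemma cas_total: "a \<noteq> b \<Longrightarrow> commuting_involutions.total N (gg e a b) = cas a b"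
  by (simp add: commuting_involutions.total_def[OF gg_involutions] cas_def)

lemma cas_sym: "a \<noteq> b \<Longrightarrow> cas a b = cas b a"
  unfolding cas_def gg_def by (intro sum.cong refl slot_commute)

text \<open>The anticommutator collapses to the Clifford relation in the shared slot, which keeps
  equal indices only and joins the two outer slots.\<close>

lemma cas_chain:
  assumes "a \<noteq> b" "b \<noteq> c" "a \<noteq> c"
  shows "cas a b * cas b c + cas b c * cas a b = of_complex 2 * cas a c"
proof -
  have "cas a b * cas b c + cas b c * cas a b
      = (\<Sum>i=1..N. \<Sum>j=1..N. gg e a b i * gg e b c j) + (\<Sum>i=1..N. \<Sum>j=1..N. gg e b c j * gg e a b i)"
    unfolding cas_def sum_product sum.swap[of "\<lambda>j i. gg e b c j * gg e a b i"] ..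
  also have "\<dots> = (\<Sum>i=1..N. \<Sum>j=1..N. slot a (e i) * slot b (e i * e j + e j * e i) * slot c (e j))"
    unfolding gg_chain[OF assms] sum.distrib[symmetric] slot_add by (simp only: distrib_left distrib_right)
  also have "\<dots> = (\<Sum>i=1..N. \<Sum>j=1..N. if i = j then of_complex 2 * gg e a c i else 0)"
    by (intro sum.cong refl) (auto simp: e_anti' gg_def mult.assoc of_complex_left_commute[of "slot a _"] simp del: of_complex_2)
  also have "\<dots> = of_complex 2 * cas a c" by (simp add: cas_def sum_distrib_left del: of_complex_2)
  finally show ?thesis .
qed

text \<open>The orthogonal invariance of the form behind \<open>cas\<close>, computed directly:
  \<open>e i * v = 2 * x i - v * e i\<close> is substituted in both slots and summed over
  \<open>i\<close>. The scalar part is 4, the two mixed terms are 2 each and are subtracted, and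
  \<open>cas\<close> conjugated to the other side is what remains.\<close>

lemma cas_commute_unit_vector:
  fixes x :: "nat \<Rightarrow> complex"
  assumes ab: "a \<noteq> b" and x: "(\<Sum>i=1..N. x i * x i) = 1"
  defines "v \<equiv> \<Sum>i=1..N. of_complex (x i) * e i"
  shows "v * v = 1" "cas a b * tens (\<lambda>_. v) = tens (\<lambda>_. v) * cas a b"
proof -
  have ev: "e i * v = of_complex (2 * x i) - v * e i" if i: "i \<in> {1..N}" for i
  proof -
    have "e i * v + v * e i = (\<Sum>j=1..N. of_complex (x j) * (e i * e j + e j * e i))"
      by (simp add: v_def sum_distrib_left sum_distrib_right of_complex_left_commute[of "e i"] mult.assoc distrib_left sum.distrib)
    also have "\<dots> = (\<Sum>j=1..N. if i = j then of_complex (2 * x i) else 0)"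
    proof (intro sum.cong refl)
      fix j assume "j \<in> {1..N}"
      then show "of_complex (x j) * (e i * e j + e j * e i) = (if i = j then of_complex (2 * x i) else 0)"
        using e_anti'[OF i, of j] by (simp add: mult.commute[of 2] of_complex_mult)
    qed
    finally show ?thesis using i by (simp add: eq_diff_eq)
  qed
  have "v * v = (\<Sum>i=1..N. of_complex (x i) * (e i * v))"
    by (subst (1) v_def) (simp add: sum_distrib_right mult.assoc)
  also have "\<dots> = (\<Sum>i=1..N. of_complex (2 * (x i * x i)) - v * (of_complex (x i) * e i))"
  proof (intro sum.cong refl)
    fix i assume i: "i \<in> {1..N}"
    have "of_complex (x i) * of_complex (2 * x i) = (of_complex (2 * (x i * x i)) :: 's sqm)"
      unfolding of_complex_mult[symmetric] by (simp add: mult_ac)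
    then show "of_complex (x i) * (e i * v) = of_complex (2 * (x i * x i)) - v * (of_complex (x i) * e i)"
      unfolding ev[OF i] by (simp only: right_diff_distrib of_complex_left_commute[of v])
  qed
  also have "\<dots> = of_complex (2 * (\<Sum>i=1..N. x i * x i)) - v * v"
    unfolding sum_subtractf of_complex_sum[symmetric] sum_distrib_left[symmetric] by (simp only: v_def)
  finally have "v * v + v * v = 2" unfolding x by (simp add: eq_diff_eq)
  then have "of_complex 2 * (v * v) = of_complex 2 * 1" by (simp add: mult_2)
  then show vv: "v * v = 1"
    by (metis of_complex_inverse_cancel zero_neq_numeral)
  have sx: "(\<Sum>i=1..N. of_complex (x i) * slot c (e i)) = slot c v" for c
    by (simp add: v_def slot_sum slot_scale)
  have "cas a b * (slot a v * slot b v) = (\<Sum>i=1..N. slot a (e i * v) * slot b (e i * v))"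
    by (simp add: cas_def gg_def sum_distrib_right slot4[OF ab])
  also have "\<dots> = (\<Sum>i=1..N. of_complex (4 * (x i * x i)) - of_complex 2 * (slot a v * (of_complex (x i) * slot a (e i)))
      - of_complex 2 * (slot b v * (of_complex (x i) * slot b (e i))) + slot a v * slot b v * gg e a b i)"
  proof (intro sum.cong refl)
    fix i assume i: "i \<in> {1..N}"
    let ?c = "of_complex (2 * x i)"
    have "slot a (e i * v) * slot b (e i * v) = (?c - slot a (v * e i)) * (?c - slot b (v * e i))"
      unfolding ev[OF i] slot_diff slot_of_complex ..
    also have "\<dots> = of_complex (2 * x i * (2 * x i)) - ?c * slot a (v * e i) - ?c * slot b (v * e i) + slot a (v * e i) * slot b (v * e i)"
      by (rule of_complex_diff_mult)
    also have "2 * x i * (2 * x i) = 4 * (x i * x i)" by simp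
    also have "slot a (v * e i) * slot b (v * e i) = slot a v * slot b v * gg e a b i"
      unfolding gg_def slot4[OF ab] ..
    also have "?c * slot a (v * e i) = of_complex 2 * (slot a v * (of_complex (x i) * slot a (e i)))"
      by (simp only: slot_mult of_complex_mult mult.assoc of_complex_left_commute[of "slot a v"])
    also have "?c * slot b (v * e i) = of_complex 2 * (slot b v * (of_complex (x i) * slot b (e i)))"
      by (simp only: slot_mult of_complex_mult mult.assoc of_complex_left_commute[of "slot b v"])
    finally show "slot a (e i * v) * slot b (e i * v) = of_complex (4 * (x i * x i)) - of_complex 2 * (slot a v * (of_complex (x i) * slot a (e i)))
      - of_complex 2 * (slot b v * (of_complex (x i) * slot b (e i))) + slot a v * slot b v * gg e a b i" .
  qed
  also have "\<dots> = of_complex (4 * (\<Sum>i=1..N. x i * x i)) - of_complex 2 * (slot a v * slot a v)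
      - of_complex 2 * (slot b v * slot b v) + slot a v * slot b v * cas a b"
    unfolding sum.distrib sum_subtractf of_complex_sum[symmetric] sum_distrib_left[symmetric] sx cas_def ..
  also have "\<dots> = slot a v * slot b v * cas a b"
    unfolding x slot_mult[symmetric] vv
    using of_complex_add[of 2 2, where 'a = "('a \<Rightarrow> 's) sqm"] by simp
  finally have core: "cas a b * (slot a v * slot b v) = slot a v * slot b v * cas a b" .
  \<comment> \<open>The part of the tensor power outside the slots \<open>a\<close> and
    \<open>b\<close>, which commutes with \<open>cas a b\<close>.\<close>
  define Z where "Z = tens ((\<lambda>_. v)(a := 1, b := 1))"
  have V: "tens (\<lambda>_. v) = slot a v * slot b v * Z"
    unfolding Z_def mult.assoc slot_tens using ab by (intro arg_cong[where f = tens]) auto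
  have "gg e a b i * Z = Z * gg e a b i" for i
    unfolding Z_def gg_def slot_def tens_mult using ab by (intro arg_cong[where f = tens]) auto
  then have "cas a b * Z = Z * cas a b"
    by (simp add: cas_def sum_distrib_left sum_distrib_right)
  have "cas a b * tens (\<lambda>_. v) = cas a b * (slot a v * slot b v) * Z"
    unfolding V by (simp only: mult.assoc)
  also have "\<dots> = slot a v * slot b v * (cas a b * Z)"
    unfolding core by (simp only: mult.assoc)
  also have "\<dots> = tens (\<lambda>_. v) * cas a b"
    unfolding \<open>cas a b * Z = Z * cas a b\<close> V by (simp only: mult.assoc)
  finally show "cas a b * tens (\<lambda>_. v) = tens (\<lambda>_. v) * cas a b" .
qed

text \<open>Induction on the distance of two positions along the enumeration: by
  \<open>cas_chain\<close>, the anticommutator with the next neighbour lengthens the distance by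
  one.\<close>

lemma cas_adjacent:
  fixes \<pi> :: "nat \<Rightarrow> 'l::finite"
  assumes \<pi>: "bij_betw \<pi> {1..l} UNIV"
  shows "galg {cas a b | a b. a \<noteq> b} \<subseteq> galg ((\<lambda>n. cas (\<pi> n) (\<pi> (Suc n))) ` {1..<l})"
proof
  let ?T = "(\<lambda>n. cas (\<pi> n) (\<pi> (Suc n))) ` {1..<l}"
  have inj: "\<pi> i \<noteq> \<pi> j" if "i \<in> {1..l}" "j \<in> {1..l}" "i \<noteq> j" for i j
    using bij_betw_imp_inj_on[OF \<pi>] that inj_onD by metis
  have step: "cas (\<pi> i) (\<pi> (i + Suc d)) \<in> galg ?T" if "1 \<le> i" "i + Suc d \<le> l" for i d
    using that
  proof (induction d)
    case 0
    then show ?case by (intro galg_incl) auto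
  next
    case (Suc d)
    let ?a = "\<pi> i" and ?b = "\<pi> (i + Suc d)" and ?c = "\<pi> (i + Suc (Suc d))"
    have "cas ?a ?b \<in> galg ?T" using Suc by simp
    moreover have "cas ?b ?c \<in> galg ?T" using Suc.prems by (intro galg_incl) auto
    ultimately have "of_complex (1/2) * (cas ?a ?b * cas ?b ?c + cas ?b ?c * cas ?a ?b) \<in> galg ?T"
      by (intro galg_mult galg_add galg_of_complex)
    moreover have "cas ?a ?b * cas ?b ?c + cas ?b ?c * cas ?a ?b = of_complex 2 * cas ?a ?c"
      by (rule cas_chain; rule inj) (use Suc.prems in auto)
    ultimately show ?case
      by (simp only: mult.assoc[symmetric] of_complex_mult[symmetric]) simp
  qed
  have "{cas a b | a b :: 'l. a \<noteq> b} \<subseteq> galg ?T"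
  proof safe
    fix a b :: 'l assume "a \<noteq> b"
    obtain i j where ij: "a = \<pi> i" "b = \<pi> j" "i \<in> {1..l}" "j \<in> {1..l}"
      using \<pi> by (metis UNIV_I bij_betw_def imageE)
    with \<open>a \<noteq> b\<close> have "i < j \<or> j < i" by (cases i j rule: linorder_cases) auto
    then show "cas a b \<in> galg ?T"
    proof
      assume "i < j"
      then show ?thesis using step[of i "j - Suc i"] ij by auto
    next
      assume "j < i"
      then show ?thesis using step[of j "i - Suc j"] ij cas_sym[OF \<open>a \<noteq> b\<close>] by auto
    qed
  qed
  then show "x \<in> galg ?T" if "x \<in> galg {cas a b | a b :: 'l. a \<noteq> b}" for x
    using that galg_least by blast
qed

end

section \<open>The relations of the generators\<close>

definition ev :: "(nat \<Rightarrow> 'r::complex_alg) \<Rightarrow> nc_poly \<Rightarrow> 'r" where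
  "ev g p = (\<Sum>w\<in>Poly_Mapping.keys p. of_complex (Poly_Mapping.lookup p w) * prod_list (map g (letters w)))"

lemma ev_superset:
  assumes "finite F" "Poly_Mapping.keys p \<subseteq> F"
  shows "ev g p = (\<Sum>w\<in>F. of_complex (Poly_Mapping.lookup p w) * prod_list (map g (letters w)))"
  unfolding ev_def using assms by (intro sum.mono_neutral_left) (auto simp: in_keys_iff)

lemma ev_add: "ev g (p + q) = ev g p + ev g q"
proof -
  let ?F = "Poly_Mapping.keys p \<union> Poly_Mapping.keys q"
  have "ev g (p + q) = (\<Sum>w\<in>?F. of_complex (Poly_Mapping.lookup (p + q) w) * prod_list (map g (letters w)))"
    by (rule ev_superset) (use Poly_Mapping.keys_add[of p q] in auto)
  also have "\<dots> = ev g p + ev g q"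
    by (subst (1 2) ev_superset[of ?F]) (auto simp: lookup_add of_complex_add distrib_right sum.distrib)
  finally show ?thesis .
qed

lemma ev_single: "ev g (Poly_Mapping.single w c) = of_complex c * prod_list (map g (letters w))"
  by (subst ev_superset[of "{w}"]) auto

lemma ev_zero [simp]: "ev g 0 = 0"
  by (simp add: ev_def)

lemma ev_sum: "ev g (sum f I) = (\<Sum>i\<in>I. ev g (f i))"
  by (induction I rule: infinite_finite_induct) (auto simp: ev_add)

lemma sum_singles: "(\<Sum>w\<in>Poly_Mapping.keys p. Poly_Mapping.single w (Poly_Mapping.lookup p w)) = (p :: nc_poly)"
proof (rule poly_mapping_eqI)
  fix w
  show "Poly_Mapping.lookup (\<Sum>w\<in>Poly_Mapping.keys p. Poly_Mapping.single w (Poly_Mapping.lookup p w)) w = Poly_Mapping.lookup p w"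
    by (cases "w \<in> Poly_Mapping.keys p") (auto simp: lookup_sum lookup_single when_def in_keys_iff)
qed

lemma ev_mult: "ev g (p * q) = ev g p * ev g q"
proof -
  let ?s = "\<lambda>p w. Poly_Mapping.single w (Poly_Mapping.lookup p w) :: nc_poly"
  have single: "ev g (Poly_Mapping.single u c * Poly_Mapping.single v d) = ev g (Poly_Mapping.single u c) * ev g (Poly_Mapping.single v d)" for u v c d
  proof -
    have "ev g (Poly_Mapping.single u c * Poly_Mapping.single v d) = of_complex c * (of_complex d * (prod_list (map g (letters u)) * prod_list (map g (letters v))))"
      by (simp add: mult_single ev_single plus_word_def of_complex_mult mult.assoc)
    also have "of_complex d * (prod_list (map g (letters u)) * prod_list (map g (letters v)))
        = prod_list (map g (letters u)) * (of_complex d * prod_list (map g (letters v)))"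
      by (rule of_complex_left_commute[symmetric])
    finally show ?thesis by (simp add: ev_single mult.assoc)
  qed
  have "p * q = (\<Sum>u\<in>Poly_Mapping.keys p. \<Sum>v\<in>Poly_Mapping.keys q. ?s p u * ?s q v)"
    by (subst (1 2) sum_singles[symmetric]) (rule sum_product)
  then have "ev g (p * q) = (\<Sum>u\<in>Poly_Mapping.keys p. \<Sum>v\<in>Poly_Mapping.keys q. ev g (?s p u) * ev g (?s q v))"
    by (simp add: ev_sum single)
  also have "\<dots> = ev g (\<Sum>u\<in>Poly_Mapping.keys p. ?s p u) * ev g (\<Sum>u\<in>Poly_Mapping.keys q. ?s q u)"
    by (simp add: ev_sum sum_product)
  finally show ?thesis by (simp only: sum_singles)
qed

lemma ev_gen [simp]: "ev g (gen i) = g i"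
  by (simp add: gen_def ev_single)

lemma ev_scal [simp]: "ev g (scal c) = of_complex c"
  by (simp add: scal_def ev_single zero_word_def)

lemma ev_one [simp]: "ev g 1 = 1"
  using ev_scal[of g 1] by (simp add: scal_def)

lemma ev_diff: "ev g (p - q) = ev g p - ev g q"
  using ev_add[of g "p - q" q] by simp

lemma ev_commutator: "ev g (commutator p q) = commutator (ev g p) (ev g q)"
  by (simp add: commutator_def ev_diff ev_mult)

lemma ev_prod_list: "ev g (prod_list ps) = prod_list (map (ev g) ps)"
  by (induction ps) (auto simp: ev_mult)

text \<open>Reduces both parities of \<open>N\<close> to building, for each position, commuting
  involutions with prescribed signs between positions: \<open>double_commutator\<close> gives the
  cubic relations and \<open>total_annihilated\<close> the polynomial ones.\<close>

lemma D_rels_satisfied: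
  fixes u :: "nat \<Rightarrow> nat \<Rightarrow> 'r::complex_alg"
  assumes inv: "\<And>n. n \<in> {1..<l} \<Longrightarrow> commuting_involutions N (u n)"
    and adj: "\<And>n m i j. n \<in> {1..<l} \<Longrightarrow> m \<in> {1..<l} \<Longrightarrow> m = n + 1 \<or> n = m + 1 \<Longrightarrow> i \<in> {1..N} \<Longrightarrow> j \<in> {1..N} \<Longrightarrow>
      u n i * u m j = (if i = j then - (u m j * u n i) else u m j * u n i)"
    and far: "\<And>n m i j. n \<in> {1..<l} \<Longrightarrow> m \<in> {1..<l} \<Longrightarrow> \<bar>int n - int m\<bar> > 1 \<Longrightarrow> i \<in> {1..N} \<Longrightarrow> j \<in> {1..N} \<Longrightarrow>
      u n i * u m j = u m j * u n i"
    and zs: "\<And>m. m \<le> N \<Longrightarrow> of_nat N / 2 - of_nat m \<in> set zs"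
    and r: "r \<in> D_rels l zs"
  shows "ev (\<lambda>n. of_complex (1/2) * (\<Sum>i=1..N. u n i)) r = 0"
proof -
  define D where "D n = of_complex (1/2) * (\<Sum>i=1..N. u n i)" for n
  from r consider
    (serre) n m where "r = commutator (gen n) (commutator (gen n) (gen m)) - gen m"
      "n \<in> {1..<l}" "m \<in> {1..<l}" "m = n + 1 \<or> n = m + 1"
    | (far) n m where "r = commutator (gen n) (gen m)" "n \<in> {1..<l}" "m \<in> {1..<l}" "\<bar>int n - int m\<bar> > 1"
    | (poly) n where "r = prod_list (map (\<lambda>z. gen n - scal z) zs)" "n \<in> {1..<l}"
    unfolding D_rels_def by blast
  then have "ev D r = 0"
  proof cases
    case serre
    interpret n: commuting_involutions N "u n" by (rule inv) fact
    have "commutator (D n) (commutator (D n) (D m)) = D m"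
      unfolding D_def
    proof (rule double_commutator)
      show "u n i * u n i = 1" if "i \<in> {1..N}" for i using n.u_sq[OF that] .
      show "u n i * u n j = u n j * u n i" if "i \<in> {1..N}" "j \<in> {1..N}" for i j using n.u_commute[OF that] .
      show "u n i * u m j = u m j * u n i" if "i \<in> {1..N}" "j \<in> {1..N}" "i \<noteq> j" for i j
        using adj[OF serre(2-4) that(1,2)] that(3) by simp
      show "u n i * u m i = - (u m i * u n i)" if "i \<in> {1..N}" for i
        using adj[OF serre(2-4) that that] by simp
    qed
    then show ?thesis by (simp add: serre(1) ev_diff ev_commutator)
  next
    case far
    have "(\<Sum>i=1..N. u n i) * (\<Sum>j=1..N. u m j) = (\<Sum>i=1..N. \<Sum>j=1..N. u m j * u n i)"
      unfolding sum_product using assms(3)[OF far(2-4)] by (intro sum.cong refl) auto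
    also have "\<dots> = (\<Sum>j=1..N. u m j) * (\<Sum>i=1..N. u n i)"
      unfolding sum_product by (rule sum.swap)
    finally have com: "(\<Sum>i=1..N. u n i) * (\<Sum>j=1..N. u m j) = (\<Sum>j=1..N. u m j) * (\<Sum>i=1..N. u n i)" .
    have "D n * D m = of_complex (1/2) * (of_complex (1/2) * ((\<Sum>i=1..N. u n i) * (\<Sum>j=1..N. u m j)))" for n m
      unfolding D_def mult.assoc by (simp only: of_complex_left_commute[of "sum _ _"])
    then have "D n * D m = D m * D n" by (simp only: com)
    then show ?thesis unfolding far(1) ev_commutator by (simp add: commutator_def)
  next
    case poly
    interpret n: commuting_involutions N "u n" by (rule inv) fact
    have "prod_list (map (\<lambda>z. D n - of_complex z) zs) = 0"
      using n.total_annihilated[OF zs] unfolding D_def n.total_def .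
    then show ?thesis by (simp add: poly(1) ev_prod_list o_def ev_diff)
  qed
  moreover have "D = (\<lambda>n. of_complex (1/2) * (\<Sum>i=1..N. u n i))" by (rule ext) (rule D_def)
  ultimately show ?thesis by (simp only:)
qed

text \<open>For even \<open>N\<close> the product anticommutes with \<open>w\<close>, as it meets
  \<open>N - 1\<close> sign changes. Multiplying by it therefore reverses the rule for every index
  and gives the pattern of \<open>double_commutator\<close>.\<close>

lemma (in commuting_involutions) twisted_cross:
  assumes N: "even N" and ij: "i \<in> {1..N}" "j \<in> {1..N}"
    and same: "u j * w = w * u j" and diff: "\<And>i. i \<in> {1..N} \<Longrightarrow> i \<noteq> j \<Longrightarrow> u i * w = - (w * u i)"
  shows "u i * uprod * w = (if i = j then - (w * (u i * uprod)) else w * (u i * uprod))"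
proof -
  have "odd (N - 1)" using N ij by (cases N) auto
  moreover have "uprod * w = of_complex ((-1) ^ (N - 1)) * (w * uprod)"
    using prod_list_anticommute[of "[1..<Suc N]" j u w] same diff ij
    by (simp add: uprod_def less_Suc_eq_le del: upt_Suc)
  ultimately have "uprod * w = - (w * uprod)" by simp
  then have "u i * uprod * w = - (u i * w * uprod)" by (simp add: mult.assoc)
  then show ?thesis using same diff[OF ij(1)] by (cases "i = j") (simp_all add: mult.assoc)
qed

lemma slot_chain:
  assumes "a \<noteq> b" "b \<noteq> c" "a \<noteq> c"
  shows "slot a p * slot b q * (slot b r * slot c s) = slot a p * slot b (q * r) * slot c s"
    "slot b r * slot c s * (slot a p * slot b q) = slot a p * slot b (r * q) * slot c s"
  unfolding slot_def tens_mult by (rule arg_cong[where f = tens], use assms in auto)+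

lemma slot_disjoint:
  assumes "a \<noteq> c" "a \<noteq> d" "b \<noteq> c" "b \<noteq> d"
  shows "slot a p * slot b q * (slot c r * slot d s) = slot c r * slot d s * (slot a p * slot b q)"
  unfolding slot_def tens_mult by (rule arg_cong[where f = tens]) (use assms in auto)

section \<open>Tensor slots arranged in a chain\<close>

locale slot_enumeration =
  fixes \<pi> :: "nat \<Rightarrow> 'l::finite" and l :: nat
  assumes \<pi>: "bij_betw \<pi> {1..l} UNIV"
begin

lemma \<pi>_neq: "i \<in> {1..l} \<Longrightarrow> j \<in> {1..l} \<Longrightarrow> i \<noteq> j \<Longrightarrow> \<pi> i \<noteq> \<pi> j"
  using bij_betw_imp_inj_on[OF \<pi>] inj_onD by metis

lemma \<pi>_Suc_neq: "n \<in> {1..<l} \<Longrightarrow> \<pi> n \<noteq> \<pi> (Suc n)"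
  by (rule \<pi>_neq) auto

lemma \<pi>_Suc_Suc_neq:
  assumes "n \<in> {1..<l}" "Suc n \<in> {1..<l}"
  shows "\<pi> n \<noteq> \<pi> (Suc n)" "\<pi> (Suc n) \<noteq> \<pi> (Suc (Suc n))" "\<pi> n \<noteq> \<pi> (Suc (Suc n))"
  by (rule \<pi>_neq; use assms in auto)+

lemma \<pi>_far_neq:
  assumes "n \<in> {1..<l}" "m \<in> {1..<l}" "\<bar>int n - int m\<bar> > 1"
  shows "\<pi> n \<noteq> \<pi> m" "\<pi> n \<noteq> \<pi> (Suc m)" "\<pi> (Suc n) \<noteq> \<pi> m" "\<pi> (Suc n) \<noteq> \<pi> (Suc m)"
  by (rule \<pi>_neq; use assms in auto)+

end

locale clifford_slots = clifford_matrices N e + slot_enumeration \<pi> l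
  for N :: nat and e :: "nat \<Rightarrow> 's::finite sqm" and \<pi> :: "nat \<Rightarrow> 'l::finite" and l :: nat
begin

definition g :: "nat \<Rightarrow> nat \<Rightarrow> ('l \<Rightarrow> 's) sqm" where
  "g n = gg e (\<pi> n) (\<pi> (Suc n))"

definition c :: "nat \<Rightarrow> ('l \<Rightarrow> 's) sqm" where
  "c n = cas (\<pi> n) (\<pi> (Suc n))"

lemma g_involutions: "n \<in> {1..<l} \<Longrightarrow> commuting_involutions N (g n)"
  unfolding g_def by (intro gg_involutions \<pi>_Suc_neq)

lemma g_total: "n \<in> {1..<l} \<Longrightarrow> commuting_involutions.total N (g n) = c n"
  unfolding g_def c_def by (intro cas_total \<pi>_Suc_neq)

lemma g_adjacent:
  assumes nm: "n \<in> {1..<l}" "m \<in> {1..<l}" "m = n + 1 \<or> n = m + 1" and ij: "i \<in> {1..N}" "j \<in> {1..N}"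
  shows "g n i * g m j = (if i = j then g m j * g n i else - (g m j * g n i))"
proof -
  have *: "g n i * g m j = (if i = j then g m j * g n i else - (g m j * g n i))"
    if "n \<in> {1..<l}" "m \<in> {1..<l}" "m = Suc n" "i \<in> {1..N}" "j \<in> {1..N}" for n m i j
  proof -
    have "n \<in> {1..<l}" "Suc n \<in> {1..<l}" using that by auto
    note neq = \<pi>_Suc_Suc_neq[OF this]
    show ?thesis
      unfolding g_def that(3)
      using gg_chain_commute(1)[OF neq, of i] gg_chain_commute(2)[OF neq that(4,5)] by (cases "i = j") simp_all
  qed
  show ?thesis
    using nm(3)
  proof
    assume "n = m + 1"
    then show ?thesis using *[of m n j i] nm ij by auto
  qed (use *[of n m i j] nm ij in auto)
qed

lemma g_far:
  assumes "n \<in> {1..<l}" "m \<in> {1..<l}" "\<bar>int n - int m\<bar> > 1"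
  shows "g n i * g m j = g m j * g n i"
  unfolding g_def by (intro gg_disjoint \<pi>_far_neq assms)

lemma cas_adjacent': "galg {cas a b | a b. a \<noteq> b} \<subseteq> galg (c ` {1..<l})"
  using cas_adjacent[OF \<pi>] unfolding c_def .

definition P :: "nat \<Rightarrow> ('l \<Rightarrow> 's) sqm" where
  "P n = commuting_involutions.uprod N (g n)"

text \<open>
  The twist by \<open>P n\<close> in every other position turns the relations of commuting tensor factors
  into those of graded ones.
\<close>

definition u :: "nat \<Rightarrow> nat \<Rightarrow> ('l \<Rightarrow> 's) sqm" where
  "u n i = (if odd n then g n i * P n else g n i)"

lemma u_involutions: "n \<in> {1..<l} \<Longrightarrow> commuting_involutions N (u n)"
proof (cases "odd n")
  case True
  then have "u n = (\<lambda>i. g n i * P n)" by (auto simp: u_def)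
  then show "commuting_involutions N (u n)" if "n \<in> {1..<l}"
    using commuting_involutions.twisted[OF g_involutions[OF that]] by (simp only: P_def)
next
  case False
  then have "u n = g n" by (auto simp: u_def)
  then show "commuting_involutions N (u n)" if "n \<in> {1..<l}"
    using g_involutions[OF that] by (simp only:)
qed

text \<open>Of two adjacent positions exactly one is odd, so exactly one of the two families is
  twisted and the signs are reversed once.\<close>

lemma u_adjacent:
  assumes N: "even N" and nm: "n \<in> {1..<l}" "m \<in> {1..<l}" "m = n + 1 \<or> n = m + 1" and ij: "i \<in> {1..N}" "j \<in> {1..N}"
  shows "u n i * u m j = (if i = j then - (u m j * u n i) else u m j * u n i)"
proof -
  have *: "u n i * u m j = (if i = j then - (u m j * u n i) else u m j * u n i)"
    if "n \<in> {1..<l}" "m \<in> {1..<l}" "m = n + 1 \<or> n = m + 1" "odd n" "i \<in> {1..N}" "j \<in> {1..N}" for n m i j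
  proof -
    have "even m" using that by auto
    then show ?thesis
      using commuting_involutions.twisted_cross[OF g_involutions[OF that(1)] N that(5,6), of "g m j"]
        g_adjacent[OF that(1-3) _ that(6)] that(4,6) by (auto simp: u_def P_def)
  qed
  show ?thesis
  proof (cases "odd n")
    case False
    then have "odd m" using nm by auto
    with *[of m n j i] nm ij show ?thesis by auto
  qed (use * nm ij in auto)
qed

lemma P_commute:
  assumes "\<And>i. i \<in> {1..N} \<Longrightarrow> g n i * x = x * g n i" "n \<in> {1..<l}" shows "P n * x = x * P n"
  unfolding P_def commuting_involutions.uprod_def[OF g_involutions[OF assms(2)]]
  by (rule prod_list_commute) (use assms in \<open>auto simp: less_Suc_eq_le\<close>)

lemma u_far:
  assumes nm: "n \<in> {1..<l}" "m \<in> {1..<l}" "\<bar>int n - int m\<bar> > 1"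
  shows "u n i * u m j = u m j * u n i"
proof -
  have u: "u n i * x = x * u n i" if "n \<in> {1..<l}" "\<And>i. g n i * x = x * g n i" for n i x
    unfolding u_def using that(2)[of i] P_commute[of n x, OF that(2) that(1)]
    by (auto simp: mult.assoc) (simp flip: mult.assoc)
  have "u m j * g n i = g n i * u m j" for i
    by (rule u[OF nm(2)]) (use g_far[OF nm] in simp)
  then show ?thesis by (intro u[OF nm(1)]) simp
qed

text \<open>In odd positions the twist multiplies the sum by the product of the involutions. This
  product is a polynomial in the sum both before and after the twist, so each of the two sums yields
  the other.\<close>

lemma u_galg:
  assumes N: "even N" and n: "n \<in> {1..<l}"
  shows "of_complex (1/2) * (\<Sum>i=1..N. u n i) \<in> galg {c n}"
    "c n \<in> galg {of_complex (1/2) * (\<Sum>i=1..N. u n i)}"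
proof -
  interpret g: commuting_involutions N "g n" by (rule g_involutions[OF n])
  interpret t: commuting_involutions N "\<lambda>i. g n i * g.uprod" by (rule g.twisted)
  let ?D = "of_complex (1/2) * (\<Sum>i=1..N. u n i)"
  have tot: "g.total = c n" by (rule g_total[OF n])
  have c: "c n \<in> galg {c n}" by (rule galg_incl) simp
  have 2: "(\<Sum>i=1..N. u n i) \<in> galg {?D}"
  proof -
    have "of_complex 2 * ?D \<in> galg {?D}" by (intro galg_mult galg_of_complex galg_incl) simp
    then show ?thesis by (simp only: mult.assoc[symmetric] of_complex_mult[symmetric]) simp
  qed
  show "?D \<in> galg {c n}" "c n \<in> galg {?D}"
  proof -
    have "(\<Sum>i=1..N. u n i) = (if odd n then c n * g.uprod else c n)"
      using tot by (simp add: u_def P_def g.total_def sum_distrib_right[symmetric])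
    moreover have "g.uprod \<in> galg {c n}" using g.uprod_galg tot by simp
    ultimately show "?D \<in> galg {c n}"
      by (auto intro!: galg_mult galg_of_complex c)
    show "c n \<in> galg {?D}"
    proof (cases "odd n")
      case False
      then show ?thesis using 2 \<open>(\<Sum>i=1..N. u n i) = _\<close> by simp
    next
      case True
      have "t.total = (\<Sum>i=1..N. u n i)" using True by (simp add: t.total_def u_def P_def)
      then have "t.uprod \<in> galg {?D}"
        using galg_least[OF t.uprod_galg] 2 by simp
      then have "g.uprod \<in> galg {?D}" by (simp only: g.twisted_uprod[OF N])
      then have "(\<Sum>i=1..N. u n i) * g.uprod \<in> galg {?D}" using 2 by (rule galg_mult[rotated])
      moreover have "(\<Sum>i=1..N. u n i) * g.uprod = c n"
        using \<open>(\<Sum>i=1..N. u n i) = _\<close> True by (simp add: mult.assoc g.uprod_sq)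
      ultimately show ?thesis by simp
    qed
  qed
qed

end

section \<open>The auxiliary tensor factor and Pauli matrices\<close>

lift_definition kron :: "'m::finite sqm \<Rightarrow> 'n::finite sqm \<Rightarrow> ('m \<times> 'n) sqm" is
  "\<lambda>X Y. \<chi> p q. X $ fst p $ fst q * Y $ snd p $ snd q" .

lemma ent_kron: "ent (kron X Y) p q = ent X (fst p) (fst q) * ent Y (snd p) (snd q)"
  unfolding ent.rep_eq kron.rep_eq by simp

lemma kron_mult: "kron X Y * kron X' Y' = kron (X * X') (Y * Y')"
proof (rule sqm_eqI)
  fix p q :: "'a \<times> 'b"
  have "ent (kron (X * X') (Y * Y')) p q = (\<Sum>m\<in>UNIV. \<Sum>n\<in>UNIV. ent X (fst p) m * ent X' m (fst q) * (ent Y (snd p) n * ent Y' n (snd q)))"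
    by (simp add: ent_kron ent_mult sum_product)
  also have "\<dots> = (\<Sum>r\<in>UNIV \<times> UNIV. ent X (fst p) (fst r) * ent X' (fst r) (fst q) * (ent Y (snd p) (snd r) * ent Y' (snd r) (snd q)))"
    by (subst sum.cartesian_product) (simp add: case_prod_beta)
  also have "\<dots> = ent (kron X Y * kron X' Y') p q"
    unfolding UNIV_Times_UNIV ent_mult[of "kron X Y"] ent_kron by (rule sum.cong) simp_all
  finally show "ent (kron X Y * kron X' Y') p q = ent (kron (X * X') (Y * Y')) p q" ..
qed

lemma kron_one [simp]: "kron 1 1 = 1"
  by (rule sqm_eqI) (auto simp: ent_kron prod_eq_iff)

lemma kron_add: "kron (X + X') Y = kron X Y + kron X' Y"
  by (rule sqm_eqI) (simp add: ent_kron algebra_simps)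

lemma kron_scale: "kron (of_complex c * X) Y = of_complex c * kron X Y"
  by (rule sqm_eqI) (simp add: ent_kron)

lemma kron_minus: "kron (- X) Y = - kron X Y" "kron X (- Y) = - kron X Y"
  by (rule sqm_eqI, simp add: ent_kron)+

lemma kron_of_complex [simp]: "kron (of_complex c) 1 = of_complex c"
  using kron_scale[of c 1 1] by simp

lemma kron_zero: "kron 0 Y = 0"
  by (rule sqm_eqI) (simp add: ent_kron)

lemma kron_sum: "kron (sum f I) Y = (\<Sum>i\<in>I. kron (f i) Y)"
  by (induction I rule: infinite_finite_induct) (auto simp: kron_add kron_zero)

lemma kron_inject:
  assumes "kron X (1 :: 'n::finite sqm) = kron Y 1" shows "X = Y"
proof (rule sqm_eqI)
  fix i j
  \<comment> \<open>Any diagonal position of the second factor does, since the unit matrix has entry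
    one there; \<open>undefined\<close> names one.\<close>
  have "ent (kron X (1 :: 'n sqm)) (i, undefined) (j, undefined) = ent (kron Y (1 :: 'n sqm)) (i, undefined) (j, undefined)"
    using assms by simp
  then show "ent X i j = ent Y i j" by (simp add: ent_kron)
qed

text \<open>\<open>True\<close> gives the flip matrix sigma_x and \<open>False\<close> the diagonal
  matrix sigma_z: two anticommuting involutions on a two-dimensional space.\<close>

lift_definition pauli :: "bool \<Rightarrow> bool sqm" is
  "\<lambda>b. \<chi> i j. if b then (if i = j then 0 else 1) else (if i \<noteq> j then 0 else if i then 1 else -1)" .

lemma ent_pauli:
  "ent (pauli b) i j = (if b then (if i = j then 0 else 1) else (if i \<noteq> j then 0 else if i then 1 else -1))"
  unfolding ent.rep_eq pauli.rep_eq by simp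

lemma pauli_sq: "pauli b * pauli b = 1"
  by (rule sqm_eqI) (auto simp: ent_mult ent_pauli UNIV_bool)

lemma pauli_anticommute: "b \<noteq> b' \<Longrightarrow> pauli b * pauli b' = - (pauli b' * pauli b)"
  by (rule sqm_eqI) (auto simp: ent_mult ent_pauli UNIV_bool)

context slot_enumeration
begin

text \<open>Alternating the two Pauli matrices along the chain makes adjacent positions meet in one
  slot with different matrices. They anticommute there, and positions further apart share no
  slot.\<close>

definition tau :: "nat \<Rightarrow> ('l \<Rightarrow> bool) sqm" where
  "tau n = slot (\<pi> n) (pauli (odd n)) * slot (\<pi> (Suc n)) (pauli (odd n))"

lemma tau_sq: "n \<in> {1..<l} \<Longrightarrow> tau n * tau n = 1"
  unfolding tau_def by (simp add: slot4[OF \<pi>_Suc_neq] pauli_sq)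

lemma tau_adjacent:
  assumes nm: "n \<in> {1..<l}" "m \<in> {1..<l}" "m = n + 1 \<or> n = m + 1"
  shows "tau n * tau m = - (tau m * tau n)"
proof -
  have *: "tau n * tau (Suc n) = - (tau (Suc n) * tau n)" if "n \<in> {1..<l}" "Suc n \<in> {1..<l}" for n
    using pauli_anticommute[of "odd n" "even n"]
    unfolding tau_def slot_chain[OF \<pi>_Suc_Suc_neq[OF that]] by (simp add: slot_minus)
  show ?thesis
    using nm(3)
  proof
    assume "n = m + 1"
    then show ?thesis using *[of m] nm by simp
  qed (use *[of n] nm in simp)
qed

lemma tau_far:
  assumes "n \<in> {1..<l}" "m \<in> {1..<l}" "\<bar>int n - int m\<bar> > 1"
  shows "tau n * tau m = tau m * tau n"
  unfolding tau_def by (rule slot_disjoint; rule \<pi>_far_neq[OF assms])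

end

context clifford_slots
begin

text \<open>
  The auxiliary tensor factor supplies the missing signs in odd dimension; it disappears in
  the squares of the generators.
\<close>

definition w :: "nat \<Rightarrow> nat \<Rightarrow> (('l \<Rightarrow> 's) \<times> ('l \<Rightarrow> bool)) sqm" where
  "w n i = kron (g n i) (tau n)"

lemma w_involutions:
  assumes "n \<in> {1..<l}" shows "commuting_involutions N (w n)"
proof -
  interpret g: commuting_involutions N "g n" by (rule g_involutions[OF assms])
  show ?thesis
    by unfold_locales (simp_all only: w_def kron_mult g.u_sq tau_sq[OF assms] kron_one g.u_commute)
qed

lemma w_adjacent:
  assumes nm: "n \<in> {1..<l}" "m \<in> {1..<l}" "m = n + 1 \<or> n = m + 1" and ij: "i \<in> {1..N}" "j \<in> {1..N}"
  shows "w n i * w m j = (if i = j then - (w m j * w n i) else w m j * w n i)"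
  unfolding w_def kron_mult g_adjacent[OF assms] tau_adjacent[OF nm] by (simp add: kron_minus)

lemma w_far:
  assumes nm: "n \<in> {1..<l}" "m \<in> {1..<l}" "\<bar>int n - int m\<bar> > 1"
  shows "w n i * w m j = w m j * w n i"
  unfolding w_def kron_mult g_far[OF assms] tau_far[OF nm] ..

text \<open>The auxiliary involution \<open>tau n\<close> is a common factor of the whole sum and
  squares to one.\<close>

lemma w_square:
  assumes n: "n \<in> {1..<l}"
  defines "D \<equiv> of_complex (1/2) * (\<Sum>i=1..N. w n i)"
  shows "D * D = kron (of_complex (1/4) * (c n * c n)) 1"
proof -
  have "(\<Sum>i=1..N. w n i) = kron (c n) (tau n)"
    unfolding w_def kron_sum[symmetric] c_def cas_def g_def ..
  then have D: "D = kron (of_complex (1/2) * c n) (tau n)"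
    by (simp add: D_def kron_scale)
  have "of_complex (1/2) * c n * (of_complex (1/2) * c n) = of_complex (1/2) * (of_complex (1/2) * (c n * c n))"
    by (simp only: mult.assoc of_complex_left_commute[of "c n"])
  also have "\<dots> = of_complex (1/4) * (c n * c n)"
    by (simp only: mult.assoc[symmetric] of_complex_mult[symmetric]) simp
  finally show ?thesis unfolding D kron_mult tau_sq[OF n] by simp
qed

end

locale spinor_slots = spinor_power N e k + slot_enumeration \<pi> l
  for N :: nat and e :: "nat \<Rightarrow> 's::finite sqm" and k :: nat and \<pi> :: "nat \<Rightarrow> 'l::finite" and l :: nat

sublocale spinor_slots \<subseteq> clifford_slots ..

context spinor_power
begin

text \<open>Commuting with every generator in every slot forces all characters on the support to be
  trivial, which leaves only the vacuum coefficient.\<close>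

lemma scalar_if_commutes:
  fixes x :: "('l::finite \<Rightarrow> 's) sqm"
  assumes x: "\<And>a i. i \<in> {1..N} \<Longrightarrow> x * slot a (e i) = slot a (e i) * x"
  shows "\<exists>c. x = of_complex c"
proof -
  obtain f where f: "\<And>A. f A \<noteq> 0 \<Longrightarrow> good A" and xf: "theta f = x"
    using theta_surj[of x] by blast
  have "A = (\<lambda>_. {})" if A: "f A \<noteq> 0" for A
  proof
    fix a
    have "chr i (A a) = chr i {}" if i: "i \<in> {1..N}" for i
    proof -
      have "slot a (e i) * theta (\<lambda>A. chr i (A a) * f A) = slot a (e i) * theta f"
        using theta_slot[OF i, of f a] x[OF i, of a] xf by simp
      then have "slot a (e i) * (slot a (e i) * theta (\<lambda>A. chr i (A a) * f A)) = slot a (e i) * (slot a (e i) * theta f)"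
        by simp
      then have "theta (\<lambda>A. chr i (A a) * f A) = theta f"
        by (simp only: mult.assoc[symmetric] slot_e_sq[OF i] mult_1_left)
      then have "(\<lambda>A. chr i (A a) * f A) = f" by (rule theta_eqD) (use f in auto)
      from fun_cong[OF this, of A] show ?thesis using A by (simp add: chr_def)
    qed
    then show "A a = {}"
      using f[OF A] by (intro chr_separates[where N = N]) (auto simp: good_def good_sets_def)
  qed
  then have "f = (\<lambda>A. f (\<lambda>_. {}) * (if A = (\<lambda>_. {}) then 1 else 0))" by fastforce
  then have "theta f = theta (\<lambda>A. f (\<lambda>_. {}) * (if A = (\<lambda>_. {}) then 1 else 0))" by (rule arg_cong)
  also have "\<dots> = of_complex (f (\<lambda>_. {}))" by (simp only: theta_scale theta_vacuum mult_1_right)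
  finally show ?thesis using xf by auto
qed

end

context spinor_slots
begin

text \<open>The product of an odd number of Clifford generators is central. Here: \<open>e j\<close>
  in one of the two slots commutes with \<open>g n j\<close> and anticommutes with the other
  \<open>N - 1\<close> factors, an even number.\<close>

lemma P_scalar:
  assumes N: "odd N" and n: "n \<in> {1..<l}"
  shows "\<exists>z. P n = of_complex z"
proof (rule scalar_if_commutes)
  fix b j assume j: "j \<in> {1..N}"
  have neq: "\<pi> n \<noteq> \<pi> (Suc n)" by (rule \<pi>_Suc_neq[OF n])
  show "P n * slot b (e j) = slot b (e j) * P n"
  proof (cases "b = \<pi> n \<or> b = \<pi> (Suc n)")
    case False
    show ?thesis
    proof (rule P_commute[OF _ n])
      fix i
      show "g n i * slot b (e j) = slot b (e j) * g n i"
        unfolding g_def gg_def slot_def tens_mult by (rule arg_cong[where f = tens]) (use False neq in auto)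
    qed
  next
    case True
    have cross: "g n i * slot b (e j) = (if i = j then slot b (e j) * g n i else - (slot b (e j) * g n i))"
      if i: "i \<in> {1..N}" for i
    proof -
      have anti: "e i * e j = - (e j * e i)" if "i \<noteq> j" using e_anti[OF i j that] .
      have 1: "slot a (e i) * slot a' (e i) * slot a (e j) = slot a (e i * e j) * slot a' (e i)"
        "slot a (e j) * (slot a (e i) * slot a' (e i)) = slot a (e j * e i) * slot a' (e i)"
        "slot a' (e i) * slot a (e i) * slot a (e j) = slot a (e i * e j) * slot a' (e i)"
        "slot a (e j) * (slot a' (e i) * slot a (e i)) = slot a (e j * e i) * slot a' (e i)"
        if "a \<noteq> a'" for a a' :: 'l
        unfolding slot_def tens_mult by (rule arg_cong[where f = tens], use that in auto)+
      show ?thesis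
        using True 1(1,2)[OF neq] 1(3,4)[OF neq[symmetric]] anti
        unfolding g_def gg_def by (cases "i = j") (auto simp: slot_minus)
    qed
    have "prod_list (map (g n) [1..<Suc N]) * slot b (e j) =
        of_complex ((- 1) ^ (length [1..<Suc N] - 1)) * (slot b (e j) * prod_list (map (g n) [1..<Suc N]))"
      by (rule prod_list_anticommute[where j = j]) (use j cross in \<open>auto simp: less_Suc_eq_le simp del: upt_Suc\<close>)
    moreover have "even (length [1..<Suc N] - 1)" using N by (simp del: upt_Suc)
    ultimately show ?thesis
      unfolding P_def commuting_involutions.uprod_def[OF g_involutions[OF n]] by simp
  qed
qed

text \<open>Recovers \<open>c n\<close> from its square, since the subalgebra \<open>Uo_alg\<close>
  has only the squares of the generators to offer.\<close>

lemma c_galg_square: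
  assumes N: "odd N" and n: "n \<in> {1..<l}"
  shows "c n \<in> galg {c n * c n}"
proof -
  interpret g: commuting_involutions N "g n" by (rule g_involutions[OF n])
  have tot: "g.total = c n" by (rule g_total[OF n])
  obtain z where "P n = of_complex z" using P_scalar[OF N n] by blast
  then show ?thesis using g.total_galg_square[OF N, of z] unfolding P_def tot by simp
qed

end

section \<open>Algebras given by generators and relations\<close>

lemma ring_ext:
  fixes R :: "('a, 'b) ring_scheme" and S :: "('a, 'c) ring_scheme"
  assumes "ring R" and eqs: "carrier S = carrier R" "mult S = mult R" "one S = one R" "zero S = zero R" "add S = add R"
  shows "ring S"
proof -
  interpret R: ring R by fact
  show ?thesis
  proof (rule ringI)
    show "abelian_group S"
    proof (rule abelian_groupI)
      fix x assume "x \<in> carrier S"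
      then show "\<exists>y\<in>carrier S. y \<oplus>\<^bsub>S\<^esub> x = \<zero>\<^bsub>S\<^esub>"
        using R.l_neg[of x] R.a_inv_closed[of x] unfolding eqs by blast
    qed (simp_all add: eqs R.a_assoc, simp add: R.a_comm)
    show "Group.monoid S"
      by (rule monoidI) (simp_all add: eqs R.m_assoc)
  qed (simp_all add: eqs R.l_distr R.r_distr)
qed

lemma quot_alg_simps [simp]:
  "carrier (quot_alg A I) = carrier (A Quot I)" "mult (quot_alg A I) = mult (A Quot I)"
  "one (quot_alg A I) = one (A Quot I)" "zero (quot_alg A I) = zero (A Quot I)"
  "add (quot_alg A I) = add (A Quot I)"
  "smult (quot_alg A I) = (\<lambda>c X. \<Union>x\<in>X. I +>\<^bsub>A\<^esub> (c \<odot>\<^bsub>A\<^esub> x))"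
  by (simp_all add: quot_alg_def ring.defs module.defs)

lemma carrier_FactRing: "carrier (A Quot I) = (\<lambda>x. I +>\<^bsub>A\<^esub> x) ` carrier A"
  by (auto simp: FactRing_def A_RCOSETS_def')

lemma ring_hom_quot_alg:
  "ring_hom (quot_alg A I) B = ring_hom (A Quot I) B"
  by (simp add: ring_hom_def)

text \<open>The first isomorphism theorem, with one more point to check: the scalar multiplication
  of \<open>quot_alg\<close> is a union over all representatives of a coset.\<close>

lemma is_quotient_ofI:
  assumes A: "ring A" and B: "ring B" and h: "h \<in> alg_hom A B" and surj: "h ` carrier A = carrier B"
    and smult: "\<And>c x. x \<in> carrier A \<Longrightarrow> c \<odot>\<^bsub>A\<^esub> x \<in> carrier A"
  shows "is_quotient_of B A"
proof -
  have "h \<in> ring_hom A B" using h by (simp add: alg_hom_def)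
  then interpret ring_hom_ring A B h by (rule ring_hom_ringI2[OF A B])
  define K where "K = a_kernel A B h"
  interpret K: ideal K A unfolding K_def by (rule kernel_is_ideal)
  define \<phi> where "\<phi> X = the_elem (h ` X)" for X
  have iso: "\<phi> \<in> ring_iso (A Quot K) B"
    unfolding \<phi>_def K_def by (rule FactRing_iso_set[OF surj])
  have \<phi>: "\<phi> (K +>\<^bsub>A\<^esub> x) = h x" if "x \<in> carrier A" for x
    unfolding \<phi>_def K_def by (rule the_elem_simp[OF that])
  have coset: "h y = h x" "y \<in> carrier A" if "y \<in> K +>\<^bsub>A\<^esub> x" "x \<in> carrier A" for x y
  proof -
    from that obtain i where i: "i \<in> K" "y = i \<oplus>\<^bsub>A\<^esub> x" by (auto simp: a_r_coset_def')
    then have "i \<in> carrier A" "h i = \<zero>\<^bsub>B\<^esub>"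
      unfolding K_def a_kernel_def' by blast+
    with i(2) that(2) show "h y = h x" "y \<in> carrier A" by simp_all
  qed
  have "\<phi> (c \<odot>\<^bsub>quot_alg A K\<^esub> X) = c \<odot>\<^bsub>B\<^esub> \<phi> X" if X: "X \<in> carrier (quot_alg A K)" for c X
  proof -
    from X obtain x where x: "x \<in> carrier A" "X = K +>\<^bsub>A\<^esub> x" by (auto simp: carrier_FactRing)
    have hs: "h (c \<odot>\<^bsub>A\<^esub> y) = c \<odot>\<^bsub>B\<^esub> h y" if "y \<in> carrier A" for y
      using h that by (auto simp: alg_hom_def)
    define S where "S = c \<odot>\<^bsub>quot_alg A K\<^esub> X"
    \<comment> \<open>The homomorphism is constant on the whole union, so its image is a singleton
      and \<open>the_elem\<close> picks the expected value.\<close>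
    have const: "h z = c \<odot>\<^bsub>B\<^esub> h x" if z: "z \<in> S" for z
    proof -
      from z obtain y where y: "y \<in> X" "z \<in> K +>\<^bsub>A\<^esub> (c \<odot>\<^bsub>A\<^esub> y)" by (auto simp: S_def)
      have "y \<in> carrier A" "h y = h x" using coset y(1) x by auto
      then show ?thesis using coset(1)[OF y(2) smult] hs by simp
    qed
    have "c \<odot>\<^bsub>A\<^esub> x \<in> S"
      using K.a_rcos_self[OF x(1)] K.a_rcos_self[OF smult[OF x(1)]] x by (auto simp: S_def)
    with const have "h ` S = {c \<odot>\<^bsub>B\<^esub> h x}" by force
    then have "\<phi> S = c \<odot>\<^bsub>B\<^esub> h x" by (simp add: \<phi>_def)
    then show ?thesis using \<phi>[OF x(1)] x(2) by (simp only: S_def)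
  qed
  then have "\<phi> \<in> alg_hom (quot_alg A K) B"
    using iso by (auto simp: alg_hom_def ring_hom_quot_alg ring_iso_def)
  then show ?thesis
    using iso K.ideal_axioms unfolding is_quotient_of_def by (auto simp: ring_iso_def)
qed

definition calg :: "(complex, 'r::complex_alg) module" where
  "calg = \<lparr>carrier = UNIV, monoid.mult = (*), one = 1, zero = 0, add = (+), smult = (\<lambda>c x. of_complex c * x)\<rparr>"

lemma calg_simps [simp]:
  "carrier calg = UNIV" "mult calg = (*)" "one calg = 1" "zero calg = 0" "add calg = (+)"
  "smult calg c x = of_complex c * x"
  by (simp_all add: calg_def)

lemma ring_calg: "ring (calg :: (complex, 'r::complex_alg) module)"
proof (rule ringI)
  show "abelian_group (calg :: (complex, 'r) module)"
    by (rule abelian_groupI) (auto simp: add.assoc add.commute intro: exI[of _ "- _"])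
  show "Group.monoid (calg :: (complex, 'r) module)"
    by (rule monoidI) (auto simp: mult.assoc)
qed (auto simp: distrib_left distrib_right)

lemma free_alg_simps [simp]:
  "mult (free_alg X) = (*)" "one (free_alg X) = 1" "zero (free_alg X) = 0" "add (free_alg X) = (+)"
  "smult (free_alg X) c p = scal c * p"
  by (simp_all add: free_alg_def)

lemma free_alg_closed:
  "p \<in> carrier (free_alg X) \<Longrightarrow> q \<in> carrier (free_alg X) \<Longrightarrow> p + q \<in> carrier (free_alg X)"
  "p \<in> carrier (free_alg X) \<Longrightarrow> q \<in> carrier (free_alg X) \<Longrightarrow> p * q \<in> carrier (free_alg X)"
  "p \<in> carrier (free_alg X) \<Longrightarrow> - p \<in> carrier (free_alg X)"
  "i \<in> X \<Longrightarrow> gen i \<in> carrier (free_alg X)" "scal c \<in> carrier (free_alg X)"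
  "0 \<in> carrier (free_alg X)" "1 \<in> carrier (free_alg X)"
proof -
  interpret ring "free_alg X" by (rule ring_free_alg)
  show "p \<in> carrier (free_alg X) \<Longrightarrow> q \<in> carrier (free_alg X) \<Longrightarrow> p + q \<in> carrier (free_alg X)"
    using a_closed by simp
  show "p \<in> carrier (free_alg X) \<Longrightarrow> q \<in> carrier (free_alg X) \<Longrightarrow> p * q \<in> carrier (free_alg X)"
    using m_closed by simp
  show "0 \<in> carrier (free_alg X)" "1 \<in> carrier (free_alg X)"
    using zero_closed one_closed by simp_all
qed (auto simp: free_alg_def gen_def scal_def zero_word_def)

lemma free_alg_diff_closed:
  "p \<in> carrier (free_alg X) \<Longrightarrow> q \<in> carrier (free_alg X) \<Longrightarrow> p - q \<in> carrier (free_alg X)"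
  using free_alg_closed(1)[of p X "- q"] free_alg_closed(3) by simp

lemma free_alg_sum_closed: "(\<And>i. i \<in> I \<Longrightarrow> f i \<in> carrier (free_alg X)) \<Longrightarrow> sum f I \<in> carrier (free_alg X)"
  by (induction I rule: infinite_finite_induct) (auto intro: free_alg_closed)

lemma free_alg_prod_list_closed: "set ps \<subseteq> carrier (free_alg X) \<Longrightarrow> prod_list ps \<in> carrier (free_alg X)"
  by (induction ps) (auto intro: free_alg_closed)

lemma free_alg_minus:
  assumes "p \<in> carrier (free_alg X)" "q \<in> carrier (free_alg X)"
  shows "p \<ominus>\<^bsub>free_alg X\<^esub> q = p - q"
proof -
  interpret ring "free_alg X" by (rule ring_free_alg)
  have "\<ominus>\<^bsub>free_alg X\<^esub> q = - q"
    using assms by (intro minus_equality) (auto intro: free_alg_closed)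
  then show ?thesis by (simp add: a_minus_def)
qed

lemma ev_ring_hom: "ring_hom_ring (free_alg X) calg (ev g)"
  by (rule ring_hom_ringI2[OF ring_free_alg ring_calg]) (auto simp: ring_hom_def ev_add ev_mult)

lemma scal_mult: "scal (c * d) = scal c * scal d"
  by (simp add: scal_def mult_single)

section \<open>Homomorphisms out of presented algebras\<close>

locale presentation =
  fixes X :: "nat set" and R :: "nc_poly set"
  assumes R: "R \<subseteq> carrier (free_alg X)"
begin

sublocale F: ring "free_alg X" by (rule ring_free_alg)

abbreviation "J \<equiv> Idl\<^bsub>free_alg X\<^esub> R"
abbreviation "cls \<equiv> presented_class X R"

sublocale J: ideal J "free_alg X" by (rule F.genideal_ideal[OF R])

lemma ring_presented: "ring (presented_alg X R)"
  unfolding presented_alg_def by (rule ring_ext[OF ring_presented_alg[OF R]]) simp_all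

lemma carrier_presented: "carrier (presented_alg X R) = cls ` carrier (free_alg X)"
  by (simp add: presented_alg_def presented_class_def carrier_FactRing)

lemma cls_mult: "p \<in> carrier (free_alg X) \<Longrightarrow> q \<in> carrier (free_alg X) \<Longrightarrow>
    cls p \<otimes>\<^bsub>presented_alg X R\<^esub> cls q = cls (p * q)"
  using J.rcoset_mult_add[of p q] by (simp add: presented_alg_def presented_class_def FactRing_def)

lemma cls_add: "p \<in> carrier (free_alg X) \<Longrightarrow> q \<in> carrier (free_alg X) \<Longrightarrow>
    cls p \<oplus>\<^bsub>presented_alg X R\<^esub> cls q = cls (p + q)"
  using J.a_rcos_sum[of p q] by (simp add: presented_alg_def presented_class_def FactRing_def)

lemma cls_one: "\<one>\<^bsub>presented_alg X R\<^esub> = cls 1"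
  by (simp add: presented_alg_def presented_class_def FactRing_def)

lemma cls_eq_iff: "p \<in> carrier (free_alg X) \<Longrightarrow> q \<in> carrier (free_alg X) \<Longrightarrow> cls p = cls q \<longleftrightarrow> p - q \<in> J"
  using F.quotient_eq_iff_same_a_r_cos[OF J.ideal_axioms, of p q] by (simp add: presented_class_def free_alg_minus)

lemma J_mult_left: "p \<in> carrier (free_alg X) \<Longrightarrow> q \<in> J \<Longrightarrow> p * q \<in> J"
  using J.I_l_closed[of q p] by simp

lemma J_add: "p \<in> J \<Longrightarrow> q \<in> J \<Longrightarrow> p + q \<in> J"
  using J.a_closed[of p q] by simp

lemma J_sum: "(\<And>i. i \<in> I \<Longrightarrow> f i \<in> J) \<Longrightarrow> sum f I \<in> J"
  using J.zero_closed by (induction I rule: infinite_finite_induct) (auto intro: J_add)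

lemma J_incl: "r \<in> R \<Longrightarrow> r \<in> J"
  using F.genideal_self[OF R] by blast

lemma mem_cls: "q \<in> cls p \<Longrightarrow> p \<in> carrier (free_alg X) \<Longrightarrow> q \<in> carrier (free_alg X) \<and> q - p \<in> J"
  using J.a_Hcarr by (auto simp: presented_class_def a_r_coset_def' intro: free_alg_closed)

lemma self_mem_cls: "p \<in> carrier (free_alg X) \<Longrightarrow> p \<in> cls p"
  using J.a_rcos_self by (simp add: presented_class_def)

lemma cls_smult:
  assumes p: "p \<in> carrier (free_alg X)"
  shows "c \<odot>\<^bsub>presented_alg X R\<^esub> cls p = cls (scal c * p)"
proof -
  have "cls (scal c * q) = cls (scal c * p)" if "q \<in> cls p" for q
  proof -
    from mem_cls[OF that p] have q: "q \<in> carrier (free_alg X)" "q - p \<in> J" by auto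
    have "scal c * q - scal c * p \<in> J"
      using J_mult_left[OF free_alg_closed(5) q(2), of c] by (simp add: right_diff_distrib)
    then show ?thesis using p q by (subst cls_eq_iff) (auto intro: free_alg_closed)
  qed
  then have "(\<Union>q\<in>cls p. cls (scal c * q)) = cls (scal c * p)"
    by (intro UN_constant_eq[OF self_mem_cls[OF p]] ballI)
  then show ?thesis by (simp add: presented_alg_def presented_class_def)
qed

lemma smult_closed:
  assumes "x \<in> carrier (presented_alg X R)" shows "c \<odot>\<^bsub>presented_alg X R\<^esub> x \<in> carrier (presented_alg X R)"
  using assms unfolding carrier_presented by (auto simp: cls_smult intro!: imageI free_alg_closed)

text \<open>The value on a class is read off a chosen representative; \<open>induced_cls\<close>
  shows that the choice does not matter once the relations evaluate to zero.\<close>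

definition induced :: "(nat \<Rightarrow> 'r::complex_alg) \<Rightarrow> nc_poly set \<Rightarrow> 'r" where
  "induced g C = ev g (SOME p. p \<in> C)"

lemma induced_cls:
  assumes g: "\<And>r. r \<in> R \<Longrightarrow> ev g r = 0" and p: "p \<in> carrier (free_alg X)"
  shows "induced g (cls p) = ev g p"
proof -
  interpret ring_hom_ring "free_alg X" calg "ev g" by (rule ev_ring_hom)
  have "J \<subseteq> a_kernel (free_alg X) calg (ev g)"
    by (rule F.genideal_minimal[OF kernel_is_ideal]) (use R g in \<open>unfold a_kernel_def', auto\<close>)
  then have ker: "ev g q = 0" if "q \<in> J" for q
    using that unfolding a_kernel_def' calg_simps by blast
  have "(SOME q. q \<in> cls p) \<in> cls p" using self_mem_cls[OF p] by (rule someI)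
  from mem_cls[OF this p] have "ev g ((SOME q. q \<in> cls p) - p) = 0" by (intro ker) simp
  then show ?thesis by (simp add: induced_def ev_diff)
qed

lemma induced_hom:
  assumes g: "\<And>r. r \<in> R \<Longrightarrow> ev g r = 0"
  shows "induced g \<in> alg_hom (presented_alg X R) calg"
proof -
  note [simp] = induced_cls[of g, OF g]
  have "induced g \<in> ring_hom (presented_alg X R) calg"
    by (rule ring_hom_memI)
      (auto simp: carrier_presented cls_mult cls_add cls_one free_alg_closed ev_mult ev_add)
  then show ?thesis
    by (auto simp: alg_hom_def carrier_presented cls_smult free_alg_closed ev_mult)
qed

lemma ev_image: "ev g ` carrier (free_alg X) = galg (g ` X)"
proof safe
  fix p assume p: "p \<in> carrier (free_alg X)"
  have list: "prod_list (map g xs) \<in> galg (g ` X)" if "set xs \<subseteq> X" for xs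
    using that by (induction xs) (auto intro: galg_1 galg_mult galg_incl)
  have "set (letters w) \<subseteq> X" if "w \<in> Poly_Mapping.keys p" for w
    using p that by (auto simp: free_alg_def)
  then show "ev g p \<in> galg (g ` X)"
    unfolding ev_def by (intro galg_sum galg_mult galg_of_complex list)
next
  fix x assume "x \<in> galg (g ` X)"
  then show "x \<in> ev g ` carrier (free_alg X)"
  proof (induction rule: galg.induct)
    case (galg_of_complex c)
    show ?case by (rule image_eqI[of _ _ "scal c"]) (auto intro: free_alg_closed)
  next
    case (galg_incl x)
    then obtain i where "i \<in> X" "x = g i" by auto
    then show ?case by (intro image_eqI[of _ _ "gen i"]) (auto intro: free_alg_closed)
  next
    case (galg_add x y)
    then obtain p q where "x = ev g p" "y = ev g q" "p \<in> carrier (free_alg X)" "q \<in> carrier (free_alg X)" by auto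
    then show ?case by (intro image_eqI[of _ _ "p + q"]) (auto intro: free_alg_closed simp: ev_add)
  next
    case (galg_mult x y)
    then obtain p q where "x = ev g p" "y = ev g q" "p \<in> carrier (free_alg X)" "q \<in> carrier (free_alg X)" by auto
    then show ?case by (intro image_eqI[of _ _ "p * q"]) (auto intro: free_alg_closed simp: ev_mult)
  qed
qed

lemma induced_image:
  assumes g: "\<And>r. r \<in> R \<Longrightarrow> ev g r = 0"
  shows "induced g ` carrier (presented_alg X R) = galg (g ` X)"
  unfolding carrier_presented image_image ev_image[symmetric]
  by (rule image_cong) (auto simp: induced_cls[OF g])

end

lemma D_rels_closed: "D_rels l zs \<subseteq> carrier (free_alg {1..<l})"
proof -
  have gen: "gen i \<in> carrier (free_alg {1..<l})" if "i \<in> {1..<l}" for i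
    using that by (rule free_alg_closed)
  have comm: "commutator p q \<in> carrier (free_alg {1..<l})"
    if "p \<in> carrier (free_alg {1..<l})" "q \<in> carrier (free_alg {1..<l})" for p q
    unfolding commutator_def using that by (intro free_alg_diff_closed free_alg_closed)
  have "prod_list (map (\<lambda>z. gen i - scal z) zs) \<in> carrier (free_alg {1..<l})" if "i \<in> {1..<l}" for i
    using gen[OF that] by (intro free_alg_prod_list_closed) (auto intro!: free_alg_diff_closed free_alg_closed(5))
  then show ?thesis
    unfolding D_rels_def using gen comm by (auto intro!: free_alg_diff_closed comm)
qed

lemma clifford_rels_closed: "clifford_rels N \<subseteq> carrier (free_alg {1..N})"
  unfolding clifford_rels_def by (auto intro!: free_alg_diff_closed free_alg_closed)

section \<open>Pin and Spin\<close>

lemma to_mat_inverse': "of_mat (to_mat x) = x" and of_mat_inverse': "to_mat (of_mat X) = X"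
  by (simp_all add: to_mat_inverse of_mat_inverse)

lemma to_mat_of_complex_mult: "to_mat (of_complex c * x) = (\<chi> i j. c * to_mat x $ i $ j)"
  using ent_of_complex_mult[of c x] unfolding ent.rep_eq vec_eq_iff by simp

lemma tensor_power_eq: "tensor_power A = to_mat (tens (\<lambda>_. of_mat A))"
  unfolding tensor_power_def tens.rep_eq of_mat_inverse' ..

section \<open>Commutants of group elements acting on the tensor power\<close>

definition commutant :: "'g set \<Rightarrow> ('g \<Rightarrow> complex^'s::finite^'s) \<Rightarrow> ('l::finite \<Rightarrow> 's) sqm set" where
  "commutant G \<rho> = {x. \<forall>h\<in>G. x * tens (\<lambda>_. of_mat (\<rho> h)) = tens (\<lambda>_. of_mat (\<rho> h)) * x}"

lemma End_simps [simp]: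
  "mult (End_tensor_power G \<rho>) = (**)" "one (End_tensor_power G \<rho>) = mat 1"
  "zero (End_tensor_power G \<rho>) = 0" "add (End_tensor_power G \<rho>) = (+)"
  "smult (End_tensor_power G \<rho>) c A = (\<chi> i j. c * A $ i $ j)"
  by (simp_all add: End_tensor_power_def cmat_alg_def)

lemma carrier_End:
  fixes \<rho> :: "'g \<Rightarrow> complex^'s::finite^'s"
  shows "carrier (End_tensor_power G \<rho> :: (complex, complex^('l::finite \<Rightarrow> 's)^('l \<Rightarrow> 's)) module) = to_mat ` commutant G \<rho>"
    (is "carrier ?E = _")
proof -
  have *: "X \<in> carrier ?E \<longleftrightarrow> of_mat X \<in> commutant G \<rho>" for X
    unfolding End_tensor_power_def commutant_def
    by (simp add: cmat_alg_def tensor_power_eq to_mat_inject[symmetric] times_sqm.rep_eq of_mat_inverse')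
  show ?thesis
  proof safe
    fix X assume "X \<in> carrier ?E"
    then have "of_mat X \<in> commutant G \<rho>" by (simp only: *)
    then have "to_mat (of_mat X) \<in> to_mat ` commutant G \<rho>" by (rule imageI)
    then show "X \<in> to_mat ` commutant G \<rho>" by (simp only: of_mat_inverse')
  next
    fix x :: "('l \<Rightarrow> 's) sqm" assume "x \<in> commutant G \<rho>"
    then show "to_mat x \<in> carrier ?E" by (simp only: * to_mat_inverse')
  qed
qed

lemma commutant_closed:
  "0 \<in> commutant G \<rho>" "1 \<in> commutant G \<rho>"
  "x \<in> commutant G \<rho> \<Longrightarrow> y \<in> commutant G \<rho> \<Longrightarrow> x + y \<in> commutant G \<rho>"
  "x \<in> commutant G \<rho> \<Longrightarrow> - x \<in> commutant G \<rho>"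
  "x \<in> commutant G \<rho> \<Longrightarrow> y \<in> commutant G \<rho> \<Longrightarrow> x * y \<in> commutant G \<rho>"
proof -
  show "x \<in> commutant G \<rho> \<Longrightarrow> y \<in> commutant G \<rho> \<Longrightarrow> x * y \<in> commutant G \<rho>"
    unfolding commutant_def by (auto simp: mult.assoc) (simp flip: mult.assoc)
qed (auto simp: commutant_def distrib_left distrib_right)

lemma ring_End:
  fixes \<rho> :: "'g \<Rightarrow> complex^'s::finite^'s"
  shows "ring (End_tensor_power G \<rho> :: (complex, complex^('l::finite \<Rightarrow> 's)^('l \<Rightarrow> 's)) module)"
    (is "ring ?E")
proof (rule ringI)
  show "abelian_group ?E"
  proof (rule abelian_groupI)
    fix X assume "X \<in> carrier ?E"
    then obtain x where x: "x \<in> commutant G \<rho>" "X = to_mat x" unfolding carrier_End by blast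
    show "\<exists>Y\<in>carrier ?E. Y \<oplus>\<^bsub>?E\<^esub> X = \<zero>\<^bsub>?E\<^esub>"
    proof
      show "to_mat (- x) \<in> carrier ?E" unfolding carrier_End by (intro imageI commutant_closed x)
      show "to_mat (- x) \<oplus>\<^bsub>?E\<^esub> X = \<zero>\<^bsub>?E\<^esub>" by (simp add: x(2) flip: plus_sqm.rep_eq zero_sqm.rep_eq)
    qed
  qed (auto simp: carrier_End commutant_closed add.assoc add.commute simp flip: plus_sqm.rep_eq zero_sqm.rep_eq)
  show "Group.monoid ?E"
    by (rule monoidI)
      (auto simp: carrier_End commutant_closed mult.assoc simp flip: times_sqm.rep_eq one_sqm.rep_eq)
qed (auto simp: carrier_End distrib_left distrib_right simp flip: plus_sqm.rep_eq times_sqm.rep_eq)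

lemma End_is_quotient_of:
  fixes \<rho> :: "'g \<Rightarrow> complex^'s::finite^'s" and h :: "'a \<Rightarrow> ('l::finite \<Rightarrow> 's) sqm"
  assumes A: "ring A" and smult: "\<And>c x. x \<in> carrier A \<Longrightarrow> c \<odot>\<^bsub>A\<^esub> x \<in> carrier A"
    and h: "h \<in> alg_hom A calg" and surj: "h ` carrier A = commutant G \<rho>"
  shows "is_quotient_of (End_tensor_power G \<rho> :: (complex, complex^('l \<Rightarrow> 's)^('l \<Rightarrow> 's)) module) A"
    (is "is_quotient_of ?E A")
proof (rule is_quotient_ofI[OF A ring_End _ _ smult])
  show "(\<lambda>x. to_mat (h x)) ` carrier A = carrier ?E"
    unfolding carrier_End surj[symmetric] by (rule image_image[symmetric])
  have hom: "h (x \<otimes>\<^bsub>A\<^esub> y) = h x * h y" "h (x \<oplus>\<^bsub>A\<^esub> y) = h x + h y" "h (c \<odot>\<^bsub>A\<^esub> x) = of_complex c * h x" "h \<one>\<^bsub>A\<^esub> = 1"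
    if "x \<in> carrier A" "y \<in> carrier A" for x y c
    using h that by (auto simp: alg_hom_def ring_hom_def)
  have one: "h \<one>\<^bsub>A\<^esub> = 1" using h by (auto simp: alg_hom_def ring_hom_def)
  have "(\<lambda>x. to_mat (h x)) \<in> ring_hom A ?E"
  proof (rule ring_hom_memI)
    fix x assume "x \<in> carrier A"
    then have "h x \<in> commutant G \<rho>" using surj by blast
    then show "to_mat (h x) \<in> carrier ?E" by (simp add: carrier_End)
  qed (simp_all add: hom one times_sqm.rep_eq plus_sqm.rep_eq one_sqm.rep_eq)
  then show "(\<lambda>x. to_mat (h x)) \<in> alg_hom A ?E"
    using hom by (simp add: alg_hom_def to_mat_of_complex_mult)
qed

abbreviation unit_coords :: "nat \<Rightarrow> (nat \<Rightarrow> real) \<Rightarrow> bool" where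
  "unit_coords N x \<equiv> (\<Sum>i=1..N. (x i)\<^sup>2) = 1"

context spinor_power
begin

definition vect :: "(nat \<Rightarrow> real) \<Rightarrow> 's sqm" where
  "vect x = (\<Sum>i=1..N. of_complex (of_real (x i)) * e i)"

lemma vect_unit:
  assumes "unit_coords N x"
  shows "vect x * vect x = 1" "a \<noteq> b \<Longrightarrow> cas a b * tens (\<lambda>_. vect x) = tens (\<lambda>_. vect x) * cas a b"
proof -
  have "(\<Sum>i=1..N. complex_of_real (x i) * complex_of_real (x i)) = of_real (\<Sum>i=1..N. (x i)\<^sup>2)"
    by (simp add: power2_eq_square)
  then have x: "(\<Sum>i=1..N. complex_of_real (x i) * complex_of_real (x i)) = 1"
    by (simp only: assms of_real_1)
  \<comment> \<open>The type \<open>bool\<close> has two different elements, which instantiate the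
    slots of \<open>cas_commute_unit_vector\<close>.\<close>
  obtain c d :: bool where "c \<noteq> d" by blast
  from cas_commute_unit_vector(1)[OF this x] show "vect x * vect x = 1"
    by (simp only: vect_def)
  show "cas a b * tens (\<lambda>_. vect x) = tens (\<lambda>_. vect x) * cas a b" if "a \<noteq> b"
    using cas_commute_unit_vector(2)[OF that x] by (simp only: vect_def)
qed

lemma vect_single:
  assumes "i \<in> {1..N}"
  shows "vect (\<lambda>m. if m = i then 1 else 0) = e i" "unit_coords N (\<lambda>m. if m = i then 1 else 0)"
proof -
  have "vect (\<lambda>m. if m = i then 1 else 0) = (\<Sum>m=1..N. if m = i then e i else 0)"
    unfolding vect_def by (rule sum.cong) auto
  then show "vect (\<lambda>m. if m = i then 1 else 0) = e i" using assms by simp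
  have "(\<Sum>m=1..N. (if m = i then 1 else 0 :: real)\<^sup>2) = (\<Sum>m=1..N. if m = i then 1 else 0)"
    by (rule sum.cong) auto
  then show "unit_coords N (\<lambda>m. if m = i then 1 else 0)" using assms by simp
qed

text \<open>For the unit vector \<open>y\<close> proportional to \<open>e i + t * e j\<close>, the
  product \<open>e i * y\<close> is a multiple of \<open>1 + t * e i * e j\<close>. So up to scalars
  these rotations form a polynomial family in \<open>t\<close>, to which
  \<open>commute_derivation\<close> applies without any exponential map.\<close>

lemma commutant_subset:
  fixes X :: "('l::finite \<Rightarrow> 's) sqm"
  assumes spin: "\<And>x y. unit_coords N x \<Longrightarrow> unit_coords N y \<Longrightarrow>
      X * tens (\<lambda>_. vect x * vect y) = tens (\<lambda>_. vect x * vect y) * X"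
    and pin: "\<And>x. even N \<Longrightarrow> unit_coords N x \<Longrightarrow> X * tens (\<lambda>_. vect x) = tens (\<lambda>_. vect x) * X"
  shows "X \<in> galg {cas a b | a b. a \<noteq> b}"
proof (rule commutant_generated)
  fix i j assume i: "i \<in> {1..N}" and j: "j \<in> {1..N}"
  show "X * (tens (\<lambda>_. e i) * tens (\<lambda>_. e j)) = tens (\<lambda>_. e i) * tens (\<lambda>_. e j) * X"
    using spin[OF vect_single(2)[OF i] vect_single(2)[OF j]]
    unfolding vect_single(1)[OF i] vect_single(1)[OF j] tens_mult .
  assume ij: "i \<noteq> j"
  show "X * rot i j = rot i j * X"
    unfolding rot_def
  proof (rule commute_derivation)
    fix t :: real
    \<comment> \<open>The length of \<open>e i + t * e j\<close>, which normalizes it to a unit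
      vector.\<close>
    define s where "s = sqrt (1 + t\<^sup>2)"
    have "0 < 1 + t\<^sup>2" by (simp add: add_pos_nonneg)
    then have s: "s \<noteq> 0" "s\<^sup>2 = 1 + t\<^sup>2" by (simp_all add: s_def)
    define y where "y m = (if m = i then 1 / s else if m = j then t / s else 0)" for m
    have "(\<Sum>m=1..N. (y m)\<^sup>2) = (\<Sum>m=1..N. (if m = i then 1 / s\<^sup>2 else 0) + (if m = j then t\<^sup>2 / s\<^sup>2 else 0))"
      by (rule sum.cong) (use ij in \<open>auto simp: y_def power_divide\<close>)
    also have "\<dots> = 1 / s\<^sup>2 + t\<^sup>2 / s\<^sup>2" using i j by (simp add: sum.distrib)
    also have "\<dots> = s\<^sup>2 / s\<^sup>2" by (simp only: s(2) add_divide_distrib)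
    also have "\<dots> = 1" using s(1) by simp
    finally have y: "unit_coords N y" .
    let ?s = "complex_of_real (1 / s)" and ?t = "complex_of_real t"
    have "vect y = (\<Sum>m=1..N. (if m = i then of_complex ?s * e i else 0) + (if m = j then of_complex ?s * (of_complex ?t * e j) else 0))"
      unfolding vect_def
    proof (intro sum.cong refl)
      fix m
      have "complex_of_real (t / s) = ?s * ?t" by simp
      then have "of_complex (complex_of_real (t / s)) * e j = of_complex ?s * (of_complex ?t * e j)"
        by (simp only: of_complex_mult mult.assoc)
      then show "of_complex (complex_of_real (y m)) * e m = (if m = i then of_complex ?s * e i else 0) + (if m = j then of_complex ?s * (of_complex ?t * e j) else 0)"
        using ij by (cases "m = i"; cases "m = j") (simp_all add: y_def)
    qed
    also have "\<dots> = of_complex ?s * (e i + of_complex ?t * e j)"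
      using i j by (simp only: sum.distrib sum.delta finite_atLeastAtMost if_True distrib_left)
    finally have "e i * vect y = of_complex ?s * (1 + of_complex ?t * (e i * e j))"
      by (simp only: of_complex_left_commute[of "e i"] distrib_left e_sq[OF i])
    then have tens_eq: "tens (\<lambda>_::'l. e i * vect y) = of_complex (?s ^ CARD('l)) * tens (\<lambda>_. 1 + of_complex ?t * (e i * e j))"
      by (simp only: tens_scale prod_constant)
    have ne: "?s ^ CARD('l) \<noteq> 0" using s by simp
    have "X * tens (\<lambda>_. e i * vect y) = tens (\<lambda>_. e i * vect y) * X"
      using spin[OF vect_single(2)[OF i] y] unfolding vect_single(1)[OF i] .
    then have "of_complex (?s ^ CARD('l)) * (X * tens (\<lambda>_. 1 + of_complex ?t * (e i * e j)))
        = of_complex (?s ^ CARD('l)) * (tens (\<lambda>_. 1 + of_complex ?t * (e i * e j)) * X)"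
      unfolding tens_eq by (simp only: of_complex_left_commute[of X] mult.assoc)
    then show "X * tens (\<lambda>_. 1 + of_complex ?t * (e i * e j)) = tens (\<lambda>_. 1 + of_complex ?t * (e i * e j)) * X"
      by (metis of_complex_inverse_cancel[OF ne])
  qed
next
  fix i assume "even N" and i: "i \<in> {1..N}"
  then show "X * tens (\<lambda>_. e i) = tens (\<lambda>_. e i) * X"
    using pin[OF _ vect_single(2)[OF i]] unfolding vect_single(1)[OF i] by simp
qed

lemma galg_cas_commute:
  assumes "X \<in> galg {cas a b | a b. a \<noteq> b}" "unit_coords N x"
  shows "X * tens (\<lambda>_. vect x) = tens (\<lambda>_. vect x) * X"
  by (rule galg_commute[OF assms(1)]) (use vect_unit(2)[OF assms(2)] in auto)

end

section \<open>Representations of the Clifford algebra\<close>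

locale clifford_rep =
  fixes N :: nat and \<rho> :: "nc_poly set \<Rightarrow> complex^'s::finite^'s"
  assumes \<rho>: "\<rho> \<in> alg_hom (Cl N) cmat_alg"
begin

sublocale Cl: presentation "{1..N}" "clifford_rels N"
  by unfold_locales (rule clifford_rels_closed)

definition r :: "nc_poly \<Rightarrow> 's sqm" where
  "r p = of_mat (\<rho> (Cl.cls p))"

definition E :: "nat \<Rightarrow> 's sqm" where
  "E i = r (gen i)"

lemma to_mat_r: "to_mat (r p) = \<rho> (Cl.cls p)"
  by (simp add: r_def of_mat_inverse')

lemma r_hom:
  assumes "p \<in> carrier (free_alg {1..N})" "q \<in> carrier (free_alg {1..N})"
  shows "r (p * q) = r p * r q" "r (p + q) = r p + r q" "r (scal c) = of_complex c"
proof -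
  have mem: "Cl.cls p \<in> carrier (Cl N)" "Cl.cls q \<in> carrier (Cl N)" "Cl.cls 1 \<in> carrier (Cl N)"
    using assms free_alg_closed(7) unfolding Cl_def Cl.carrier_presented by blast+
  have hom: "\<rho> (x \<otimes>\<^bsub>Cl N\<^esub> y) = \<rho> x ** \<rho> y" "\<rho> (x \<oplus>\<^bsub>Cl N\<^esub> y) = \<rho> x + \<rho> y"
    if "x \<in> carrier (Cl N)" "y \<in> carrier (Cl N)" for x y
    using \<rho> that by (auto simp: alg_hom_def ring_hom_def cmat_alg_def)
  have one: "\<rho> \<one>\<^bsub>Cl N\<^esub> = mat 1"
    using \<rho> by (auto simp: alg_hom_def ring_hom_def cmat_alg_def)
  have sc: "\<rho> (c \<odot>\<^bsub>Cl N\<^esub> x) = (\<chi> i j. c * \<rho> x $ i $ j)" if "x \<in> carrier (Cl N)" for x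
    using \<rho> that by (auto simp: alg_hom_def cmat_alg_def)
  show "r (p * q) = r p * r q"
    unfolding to_mat_inject[symmetric] times_sqm.rep_eq to_mat_r
    using hom(1)[OF mem(1,2)] Cl.cls_mult[OF assms] by (simp add: Cl_def)
  show "r (p + q) = r p + r q"
    unfolding to_mat_inject[symmetric] plus_sqm.rep_eq to_mat_r
    using hom(2)[OF mem(1,2)] Cl.cls_add[OF assms] by (simp add: Cl_def)
  have r1: "r 1 = 1"
    unfolding to_mat_inject[symmetric] one_sqm.rep_eq to_mat_r
    using one Cl.cls_one by (simp add: Cl_def)
  have "r (scal c * 1) = of_complex c * r 1"
    unfolding to_mat_inject[symmetric] to_mat_of_complex_mult to_mat_r
    using sc[OF mem(3)] Cl.cls_smult[of 1 c] free_alg_closed by (simp add: Cl_def)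
  then show "r (scal c) = of_complex c" by (simp add: r1)
qed

lemma cls_eqI: "p - q \<in> Cl.J \<Longrightarrow> p \<in> carrier (free_alg {1..N}) \<Longrightarrow> q \<in> carrier (free_alg {1..N}) \<Longrightarrow> r p = r q"
  using Cl.cls_eq_iff[of p q] by (simp add: r_def)

lemma clifford_family_E: "clifford_family N E"
proof -
  have rel: "E i * E j + E j * E i = of_complex (if i = j then 2 else 0)" if ij: "i \<in> {1..N}" "j \<in> {1..N}" for i j
  proof -
    have gen: "gen i \<in> carrier (free_alg {1..N})" "gen j \<in> carrier (free_alg {1..N})"
      using ij free_alg_closed(4) by blast+
    have "r (gen i * gen j + gen j * gen i) = r (scal (if i = j then 2 else 0))"
    proof (rule cls_eqI)
      show "gen i * gen j + gen j * gen i - scal (if i = j then 2 else 0) \<in> Cl.J"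
        by (rule Cl.J_incl) (use ij in \<open>unfold clifford_rels_def, blast\<close>)
    qed (use gen in \<open>auto intro: free_alg_closed\<close>)
    then show ?thesis
      using gen free_alg_closed(2)[OF gen] free_alg_closed(2)[OF gen(2,1)] by (simp add: r_hom E_def)
  qed
  show ?thesis
  proof
    fix i assume "i \<in> {1..N}"
    from rel[OF this this] have "of_complex 2 * (E i * E i) = of_complex 2 * 1" by (simp add: mult_2)
    then show "E i * E i = 1" by (metis of_complex_inverse_cancel zero_neq_numeral)
  next
    fix i j assume "i \<in> {1..N}" "j \<in> {1..N}" "i \<noteq> j"
    with rel[of i j] show "E i * E j = - (E j * E i)" by (simp add: eq_neg_iff_add_eq_0)
  qed
qed

definition vpoly :: "(nat \<Rightarrow> real) \<Rightarrow> nc_poly" where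
  "vpoly x = (\<Sum>i=1..N. scal (of_real (x i)) * gen i)"

lemma vpoly_closed: "vpoly x \<in> carrier (free_alg {1..N})"
  unfolding vpoly_def by (intro free_alg_sum_closed free_alg_closed)

lemma r_vpoly: "r (vpoly x) = (\<Sum>i=1..N. of_complex (of_real (x i)) * E i)"
proof -
  have closed: "scal c * gen i \<in> carrier (free_alg {1..N})" if "i \<in> {1..N}" for c i
    using that by (intro free_alg_closed)
  have zero: "r 0 = 0" using r_hom(3)[of 0 0 0] free_alg_closed by (simp add: scal_def)
  have "r (\<Sum>i\<in>I. scal (of_real (x i)) * gen i) = (\<Sum>i\<in>I. of_complex (of_real (x i)) * E i)"
    if "finite I" "I \<subseteq> {1..N}" for I
    using that
  proof (induction I rule: finite_induct)
    case (insert i I)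
    then have i: "i \<in> {1..N}" by simp
    have "(\<Sum>i\<in>I. scal (of_real (x i)) * gen i) \<in> carrier (free_alg {1..N})"
      using insert.prems closed by (intro free_alg_sum_closed) auto
    moreover have "r (scal (of_real (x i)) * gen i) = of_complex (of_real (x i)) * E i"
      using r_hom(1)[of "scal (of_real (x i))" "gen i"] r_hom(3)[OF free_alg_closed(7) free_alg_closed(7)]
        free_alg_closed(4)[OF i] free_alg_closed(5) by (simp add: E_def)
    ultimately show ?case
      using insert closed[OF i] by (simp add: r_hom(2))
  qed (simp add: zero)
  from this[of "{1..N}"] show ?thesis by (simp add: vpoly_def)
qed

lemma unit_vectors_eq: "unit_vectors N = {Cl.cls (vpoly x) | x. unit_coords N x}"
  unfolding unit_vectors_def vpoly_def ..

lemma scal_add: "scal (c + d) = scal c + scal d"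
  by (simp add: scal_def single_add)

lemma scal_zero: "scal 0 = 0"
  by (simp add: scal_def)

lemma scal_commute: "p * scal c = scal c * (p :: nc_poly)"
proof -
  have "Poly_Mapping.single w d * scal c = scal c * Poly_Mapping.single w d" for w d
    by (simp add: scal_def mult_single mult.commute)
  then have "(\<Sum>w\<in>Poly_Mapping.keys p. Poly_Mapping.single w (Poly_Mapping.lookup p w)) * scal c
      = scal c * (\<Sum>w\<in>Poly_Mapping.keys p. Poly_Mapping.single w (Poly_Mapping.lookup p w))"
    unfolding sum_distrib_left sum_distrib_right by simp
  then show ?thesis by (simp only: sum_singles)
qed

text \<open>Averaging the double sum over both orders of \<open>i\<close> and \<open>j\<close> turns
  each term into a Clifford relation plus a scalar, and the scalars add up to one. Working modulo
  the ideal shows that unit vectors are invertible in \<open>Cl N\<close> itself and not just as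
  matrices.\<close>

lemma vpoly_square:
  assumes "unit_coords N x" shows "vpoly x * vpoly x - 1 \<in> Cl.J"
proof -
  let ?x = "\<lambda>i. complex_of_real (x i)"
  let ?rel = "\<lambda>i j. gen i * gen j + gen j * gen i - scal (if i = j then 2 else 0)"
  have scal_sum: "scal (sum f I) = (\<Sum>i\<in>I. scal (f i))" for f and I :: "nat set"
    by (induction I rule: infinite_finite_induct) (simp_all add: scal_add scal_zero)
  have prod: "scal c * gen i * (scal d * gen j) = scal (c * d) * (gen i * gen j)" for c d i j
  proof -
    have "scal c * gen i * (scal d * gen j) = scal c * (gen i * scal d) * gen j" by (simp only: mult.assoc)
    also have "gen i * scal d = scal d * gen i" by (rule scal_commute)
    finally show ?thesis by (simp only: mult.assoc scal_mult)
  qed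
  have ij: "vpoly x * vpoly x = (\<Sum>i=1..N. \<Sum>j=1..N. scal (?x i * ?x j) * (gen i * gen j))"
    unfolding vpoly_def sum_product by (simp add: prod)
  also have "\<dots> = (\<Sum>i=1..N. \<Sum>j=1..N. scal (?x i * ?x j) * (gen j * gen i))"
    by (subst sum.swap) (intro sum.cong refl arg_cong2[where f = "(*)"] arg_cong[where f = scal] mult.commute)
  finally have ji: "vpoly x * vpoly x = (\<Sum>i=1..N. \<Sum>j=1..N. scal (?x i * ?x j) * (gen j * gen i))" .
  have half: "scal (1/2) * p + scal (1/2) * p = p" for p
    by (simp flip: distrib_right scal_add) (simp add: scal_def)
  have "vpoly x * vpoly x = scal (1/2) * (vpoly x * vpoly x + vpoly x * vpoly x)"
    by (simp only: distrib_left half)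
  also have "vpoly x * vpoly x + vpoly x * vpoly x = (\<Sum>i=1..N. \<Sum>j=1..N. scal (?x i * ?x j) * (gen i * gen j + gen j * gen i))"
    by (subst ij, subst ji) (simp only: distrib_left sum.distrib)
  finally have "vpoly x * vpoly x = scal (1/2) * (\<Sum>i=1..N. \<Sum>j=1..N. scal (?x i * ?x j) * (gen i * gen j + gen j * gen i))"
    .
  also have "\<dots> = scal (1/2) * (\<Sum>i=1..N. \<Sum>j=1..N. scal (?x i * ?x j) * ?rel i j)
      + scal (1/2) * (\<Sum>i=1..N. \<Sum>j=1..N. scal (?x i * ?x j) * scal (if i = j then 2 else 0))"
    by (simp only: distrib_left[symmetric] sum.distrib[symmetric]) simp
  also have "(\<Sum>i=1..N. \<Sum>j=1..N. scal (?x i * ?x j) * scal (if i = j then 2 else 0)) = scal (\<Sum>i=1..N. \<Sum>j=1..N. if i = j then 2 * ?x i * ?x i else 0)"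
    unfolding scal_sum scal_mult[symmetric] by (intro sum.cong refl arg_cong[where f = scal]) auto
  also have "(\<Sum>i=1..N. \<Sum>j=1..N. if i = j then 2 * ?x i * ?x i else 0) = 2 * of_real (\<Sum>i=1..N. (x i)\<^sup>2)"
    by (simp add: sum_distrib_left power2_eq_square mult.assoc)
  also have "scal (1/2) * scal (2 * of_real (\<Sum>i=1..N. (x i)\<^sup>2)) = 1"
    unfolding assms scal_mult[symmetric] by (simp add: scal_def)
  finally have "vpoly x * vpoly x - 1 = scal (1/2) * (\<Sum>i=1..N. \<Sum>j=1..N. scal (?x i * ?x j) * ?rel i j)" by simp
  also have "\<dots> \<in> Cl.J"
  proof (intro Cl.J_mult_left free_alg_closed Cl.J_sum Cl.J_incl)
    fix i j assume "i \<in> {1..N}" "j \<in> {1..N}"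
    then show "?rel i j \<in> clifford_rels N" unfolding clifford_rels_def by blast
  qed
  finally show ?thesis .
qed

lemma ring_Cl: "ring (Cl N)"
  unfolding Cl_def by (rule Cl.ring_presented)

sublocale ClR: ring "Cl N" by (rule ring_Cl)

lemma unit_vector_unit:
  assumes "v \<in> unit_vectors N" shows "v \<in> Units (Cl N)"
proof -
  obtain x where x: "unit_coords N x" "v = Cl.cls (vpoly x)" using assms unfolding unit_vectors_eq by blast
  have v: "v \<in> carrier (Cl N)" using vpoly_closed x(2) unfolding Cl_def Cl.carrier_presented by blast
  have "v \<otimes>\<^bsub>Cl N\<^esub> v = Cl.cls (vpoly x * vpoly x)"
    unfolding x(2) Cl_def by (rule Cl.cls_mult[OF vpoly_closed vpoly_closed])
  also have "\<dots> = \<one>\<^bsub>Cl N\<^esub>"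
    unfolding Cl_def Cl.cls_one
    by (rule Cl.cls_eq_iff[THEN iffD2]; intro vpoly_square[OF x(1)] vpoly_closed free_alg_closed)
  finally show ?thesis using v unfolding Units_def by blast
qed

lemma \<rho>_mult: "x \<in> carrier (Cl N) \<Longrightarrow> y \<in> carrier (Cl N) \<Longrightarrow> of_mat (\<rho> (x \<otimes>\<^bsub>Cl N\<^esub> y)) = of_mat (\<rho> x) * of_mat (\<rho> y)"
  and \<rho>_one: "of_mat (\<rho> \<one>\<^bsub>Cl N\<^esub>) = 1"
proof -
  show "x \<in> carrier (Cl N) \<Longrightarrow> y \<in> carrier (Cl N) \<Longrightarrow> of_mat (\<rho> (x \<otimes>\<^bsub>Cl N\<^esub> y)) = of_mat (\<rho> x) * of_mat (\<rho> y)"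
    unfolding to_mat_inject[symmetric] times_sqm.rep_eq of_mat_inverse'
    using \<rho> by (auto simp: alg_hom_def ring_hom_def cmat_alg_def)
  show "of_mat (\<rho> \<one>\<^bsub>Cl N\<^esub>) = 1"
    unfolding to_mat_inject[symmetric] one_sqm.rep_eq of_mat_inverse'
    using \<rho> by (auto simp: alg_hom_def ring_hom_def cmat_alg_def)
qed

text \<open>Commuting passes to products and inverses. Membership in the units is carried along in
  the induction because \<open>\<rho>\<close> is multiplicative on the carrier only.\<close>

lemma commutant_generate:
  assumes H: "H \<subseteq> Units (Cl N)"
  shows "commutant (generate (units_of (Cl N)) H) \<rho> = (commutant H \<rho> :: ('l::finite \<Rightarrow> 's) sqm set)"
proof
  show "commutant (generate (units_of (Cl N)) H) \<rho> \<subseteq> (commutant H \<rho> :: ('l \<Rightarrow> 's) sqm set)"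
    unfolding commutant_def using generate.incl by fast
  show "(commutant H \<rho> :: ('l \<Rightarrow> 's) sqm set) \<subseteq> commutant (generate (units_of (Cl N)) H) \<rho>"
  proof
    fix x :: "('l \<Rightarrow> 's) sqm" assume x: "x \<in> commutant H \<rho>"
    let ?T = "\<lambda>h. tens (\<lambda>_::'l. of_mat (\<rho> h))"
    have "h \<in> Units (Cl N) \<and> x * ?T h = ?T h * x" if "h \<in> generate (units_of (Cl N)) H" for h
      using that
    proof (induction rule: generate.induct)
      case one
      then show ?case by (simp add: units_of_one \<rho>_one)
    next
      case (incl h)
      then show ?case using H x by (auto simp: commutant_def)
    next
      case (inv h)
      then have h: "h \<in> Units (Cl N)" using H by blast
      have i: "inv\<^bsub>units_of (Cl N)\<^esub> h = inv\<^bsub>Cl N\<^esub> h" by (rule ClR.units_of_inv[OF h])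
      let ?i = "inv\<^bsub>Cl N\<^esub> h"
      have iu: "?i \<in> Units (Cl N)" using h by (rule ClR.Units_inv_Units)
      have "of_mat (\<rho> ?i) * of_mat (\<rho> h) = 1" "of_mat (\<rho> h) * of_mat (\<rho> ?i) = 1"
        using \<rho>_mult[of ?i h] \<rho>_mult[of h ?i] h iu \<rho>_one ClR.Units_l_inv[OF h] ClR.Units_r_inv[OF h]
        by (simp_all add: ClR.Units_closed)
      then have inv: "?T ?i * ?T h = 1" "?T h * ?T ?i = 1" by (simp_all add: tens_mult)
      have xh: "x * ?T h = ?T h * x" using x inv.hyps by (auto simp: commutant_def)
      have "x * ?T ?i = ?T ?i * ?T h * (x * ?T ?i)" by (simp add: inv)
      also have "\<dots> = ?T ?i * (?T h * x) * ?T ?i" by (simp only: mult.assoc)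
      also have "\<dots> = ?T ?i * x * (?T h * ?T ?i)" by (simp only: xh[symmetric] mult.assoc)
      finally show ?case using iu by (simp add: i inv)
    next
      case (eng h1 h2)
      then have "?T (h1 \<otimes>\<^bsub>Cl N\<^esub> h2) = ?T h1 * ?T h2"
        by (simp add: tens_mult \<rho>_mult ClR.Units_closed)
      moreover have "x * (?T h1 * ?T h2) = ?T h1 * ?T h2 * x"
        using eng.IH by (simp only: mult.assoc[symmetric]) (simp only: mult.assoc)
      ultimately have "x * ?T (h1 \<otimes>\<^bsub>Cl N\<^esub> h2) = ?T (h1 \<otimes>\<^bsub>Cl N\<^esub> h2) * x" by (simp only:)
      then show ?case using eng.IH ClR.Units_m_closed unfolding units_of_mult by blast
    qed
    then show "x \<in> commutant (generate (units_of (Cl N)) H) \<rho>" by (auto simp: commutant_def)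
  qed
qed

end

locale spin_rep = clifford_rep N \<rho> for N :: nat and \<rho> :: "nc_poly set \<Rightarrow> complex^'s::finite^'s" +
  fixes k :: nat
  assumes card_spinors: "CARD('s) = 2 ^ k" and N_k: "N = 2 * k \<or> N = 2 * k + 1"
begin

sublocale spinor_power N E k
proof -
  interpret clifford_family N E by (rule clifford_family_E)
  show "spinor_power N E k"
    by unfold_locales (rule card_spinors, rule N_k)
qed

lemma \<rho>_unit_vector: "of_mat (\<rho> (Cl.cls (vpoly x))) = vect x"
  using r_vpoly[of x] by (simp only: r_def vect_def)

lemma unit_vectors_closed: "unit_vectors N \<subseteq> Units (Cl N)"
  using unit_vector_unit by blast

lemma commutant_unit_vectors:
  "x \<in> commutant (unit_vectors N) \<rho> \<longleftrightarrow>
    (\<forall>y. unit_coords N y \<longrightarrow> x * tens (\<lambda>_. vect y) = tens (\<lambda>_. vect y) * x)"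
  unfolding commutant_def unit_vectors_eq \<rho>_unit_vector[symmetric] by blast

lemma commutant_unit_vector_products:
  "x \<in> commutant {v \<otimes>\<^bsub>Cl N\<^esub> w | v w. v \<in> unit_vectors N \<and> w \<in> unit_vectors N} \<rho> \<longleftrightarrow>
    (\<forall>y z. unit_coords N y \<longrightarrow> unit_coords N z \<longrightarrow> x * tens (\<lambda>_. vect y * vect z) = tens (\<lambda>_. vect y * vect z) * x)"
proof -
  have "of_mat (\<rho> (Cl.cls (vpoly y) \<otimes>\<^bsub>Cl N\<^esub> Cl.cls (vpoly z))) = vect y * vect z"
    if "unit_coords N y" "unit_coords N z" for y z
  proof -
    have "Cl.cls (vpoly y) \<in> Units (Cl N)" "Cl.cls (vpoly z) \<in> Units (Cl N)"
      using that unit_vectors_closed unfolding unit_vectors_eq by blast+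
    then show ?thesis by (simp only: \<rho>_mult ClR.Units_closed \<rho>_unit_vector)
  qed
  then show ?thesis
    unfolding commutant_def unit_vectors_eq by auto metis
qed

lemma commutant_Pin:
  assumes "even N"
  shows "commutant (Pin N) \<rho> = (galg {cas a b | a b. a \<noteq> b} :: ('l::finite \<Rightarrow> 's) sqm set)"
proof -
  have "x \<in> commutant (unit_vectors N) \<rho> \<longleftrightarrow> x \<in> galg {cas a b | a b. a \<noteq> b}" for x :: "('l \<Rightarrow> 's) sqm"
  proof
    assume "x \<in> commutant (unit_vectors N) \<rho>"
    then have x: "x * tens (\<lambda>_. vect y) = tens (\<lambda>_. vect y) * x" if "unit_coords N y" for y
      using that commutant_unit_vectors by blast
    show "x \<in> galg {cas a b | a b. a \<noteq> b}"
    proof (rule commutant_subset)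
      fix y z assume yz: "unit_coords N y" "unit_coords N z"
      have "x * (tens (\<lambda>_. vect y) * tens (\<lambda>_. vect z)) = tens (\<lambda>_. vect y) * x * tens (\<lambda>_. vect z)"
        by (simp only: mult.assoc[symmetric] x[OF yz(1)])
      also have "\<dots> = tens (\<lambda>_. vect y) * tens (\<lambda>_. vect z) * x"
        by (simp only: mult.assoc x[OF yz(2)])
      finally show "x * tens (\<lambda>_. vect y * vect z) = tens (\<lambda>_. vect y * vect z) * x"
        by (simp only: tens_mult)
    qed (rule x)
  next
    assume "x \<in> galg {cas a b | a b. a \<noteq> b}"
    then show "x \<in> commutant (unit_vectors N) \<rho>"
      using galg_cas_commute commutant_unit_vectors by blast
  qed
  then show ?thesis
    unfolding Pin_def commutant_generate[OF unit_vectors_closed] by blast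
qed

lemma commutant_Spin:
  assumes "odd N"
  shows "commutant (Spin N) \<rho> = (galg {cas a b | a b. a \<noteq> b} :: ('l::finite \<Rightarrow> 's) sqm set)"
proof -
  let ?H = "{v \<otimes>\<^bsub>Cl N\<^esub> w | v w. v \<in> unit_vectors N \<and> w \<in> unit_vectors N}"
  have H: "?H \<subseteq> Units (Cl N)" using unit_vectors_closed ClR.Units_m_closed by blast
  have "x \<in> commutant ?H \<rho> \<longleftrightarrow> x \<in> galg {cas a b | a b. a \<noteq> b}" for x :: "('l \<Rightarrow> 's) sqm"
  proof
    assume "x \<in> commutant ?H \<rho>"
    then show "x \<in> galg {cas a b | a b. a \<noteq> b}"
      unfolding commutant_unit_vector_products using assms by (intro commutant_subset) auto
  next
    assume x: "x \<in> galg {cas a b | a b. a \<noteq> b}"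
    have "x * tens (\<lambda>_. vect y * vect z) = tens (\<lambda>_. vect y * vect z) * x" if "unit_coords N y" "unit_coords N z" for y z
    proof -
      have "x * (tens (\<lambda>_. vect y) * tens (\<lambda>_. vect z)) = tens (\<lambda>_. vect y) * x * tens (\<lambda>_. vect z)"
        by (simp only: mult.assoc[symmetric] galg_cas_commute[OF x that(1)])
      also have "\<dots> = tens (\<lambda>_. vect y) * tens (\<lambda>_. vect z) * x"
        by (simp only: mult.assoc galg_cas_commute[OF x that(2)])
      finally show ?thesis by (simp only: tens_mult)
    qed
    then show "x \<in> commutant ?H \<rho>" unfolding commutant_unit_vector_products by blast
  qed
  then show ?thesis
    unfolding Spin_def commutant_generate[OF H] by blast
qed

end

lemma galg_eqI: "S \<subseteq> galg T \<Longrightarrow> T \<subseteq> galg S \<Longrightarrow> galg S = galg T"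
  using galg_least by blast

lemma galg_subset: "S \<subseteq> galg T \<Longrightarrow> galg S \<subseteq> galg T"
  using galg_least by blast

lemma subset_galg: "S \<subseteq> galg S"
  using galg_incl by blast

lemma galg_mono: "S \<subseteq> T \<Longrightarrow> galg S \<subseteq> galg T"
  using galg_least galg_incl by blast

section \<open>The quotients\<close>

lemma End_Pin_quotient:
  fixes \<rho> :: "nc_poly set \<Rightarrow> complex^'s::finite^'s"
  assumes s: "CARD('s) = 2 ^ k" and l: "CARD('l::finite) = l" and \<rho>: "\<rho> \<in> alg_hom (Cl (2 * k)) cmat_alg"
  shows "is_quotient_of (End_tensor_power (Pin (2 * k)) \<rho> :: (complex, complex^('l \<Rightarrow> 's)^('l \<Rightarrow> 's)) module) (U_alg l k)"
proof -
  let ?N = "2 * k"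
  interpret spin_rep ?N \<rho> k
    by unfold_locales (use \<rho> s in auto)
  obtain \<pi> :: "nat \<Rightarrow> 'l" where \<pi>: "bij_betw \<pi> {1..l} UNIV"
    using ex_bij_betw_nat_finite_1[of "UNIV :: 'l set"] l by auto
  interpret spinor_slots ?N E k \<pi> l by unfold_locales (rule \<pi>)
  let ?zs = "map of_int [- int k..int k] :: complex list"
  define D where "D n = of_complex (1/2) * (\<Sum>i=1..?N. u n i)" for n
  have D_eq: "D = (\<lambda>n. of_complex (1/2) * (\<Sum>i=1..?N. u n i))" by (rule ext) (rule D_def)
  have rels: "ev D r = 0" if "r \<in> D_rels l ?zs" for r
    unfolding D_eq
  proof (rule D_rels_satisfied[OF _ _ _ _ that])
    \<comment> \<open>The eigenvalues are \<open>k - m\<close> with \<open>m\<close> between 0 and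
      \<open>2 * k\<close>, exactly the integers from \<open>-k\<close> to \<open>k\<close>.\<close>
    show "of_nat ?N / 2 - of_nat m \<in> set ?zs" if "m \<le> ?N" for m
    proof -
      have "of_nat ?N / 2 - of_nat m = (of_int (int k - int m) :: complex)" by simp
      moreover have "int k - int m \<in> {- int k..int k}" using that by auto
      ultimately show ?thesis unfolding set_map set_upto by (rule image_eqI)
    qed
  qed (use u_involutions u_adjacent u_far in \<open>blast | simp only: even_mult_iff even_numeral simp_thms\<close>)+
  interpret U: presentation "{1..<l}" "D_rels l ?zs" by unfold_locales (rule D_rels_closed)
  have "galg (D ` {1..<l}) = galg {cas a b | a b :: 'l. a \<noteq> b}"
  proof (rule galg_eqI)
    show "D ` {1..<l} \<subseteq> galg {cas a b | a b :: 'l. a \<noteq> b}"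
    proof safe
      fix n assume n: "n \<in> {1..<l}"
      have "D n \<in> galg {c n}" unfolding D_def by (rule u_galg(1)[OF _ n]) simp
      moreover have "{c n} \<subseteq> {cas a b | a b :: 'l. a \<noteq> b}"
        using \<pi>_Suc_neq[OF n] unfolding c_def by blast
      ultimately show "D n \<in> galg {cas a b | a b :: 'l. a \<noteq> b}" using galg_mono by blast
    qed
    have "c ` {1..<l} \<subseteq> galg (D ` {1..<l})"
    proof safe
      fix n assume n: "n \<in> {1..<l}"
      have "c n \<in> galg {D n}" unfolding D_def by (rule u_galg(2)[OF _ n]) simp
      then show "c n \<in> galg (D ` {1..<l})" using galg_mono[of "{D n}" "D ` {1..<l}"] n by blast
    qed
    from galg_subset[OF this]
    show "{cas a b | a b :: 'l. a \<noteq> b} \<subseteq> galg (D ` {1..<l})"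
      by (rule order_trans[OF subset_galg order_trans[OF cas_adjacent']])
  qed
  then have "U.induced D ` carrier (U_alg l k) = commutant (Pin ?N) \<rho>"
    using U.induced_image[of D, OF rels] commutant_Pin[where 'l = 'l] by (simp add: U_alg_def D_alg_def)
  then show ?thesis
    unfolding U_alg_def D_alg_def
    by (intro End_is_quotient_of[OF U.ring_presented _ U.induced_hom[of D, OF rels]] U.smult_closed)
qed

section \<open>Generated subalgebras and the odd case\<close>

lemma generated_subalgebra_simps [simp]:
  "mult (generated_subalgebra A G) = mult A" "one (generated_subalgebra A G) = one A"
  "zero (generated_subalgebra A G) = zero A" "add (generated_subalgebra A G) = add A"
  "smult (generated_subalgebra A G) = smult A"
  by (simp_all add: generated_subalgebra_def)

lemma generated_subalgebra_least:
  "subalgebra_of B A \<Longrightarrow> G \<subseteq> B \<Longrightarrow> carrier (generated_subalgebra A G) \<subseteq> B"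
  by (auto simp: generated_subalgebra_def)

lemma subalgebra_of_generated:
  assumes "subalgebra_of (carrier A) A" "G \<subseteq> carrier A"
  shows "subalgebra_of (carrier (generated_subalgebra A G)) A" "G \<subseteq> carrier (generated_subalgebra A G)"
proof -
  have "carrier (generated_subalgebra A G) \<subseteq> carrier A"
    using assms by (rule generated_subalgebra_least)
  then show "subalgebra_of (carrier (generated_subalgebra A G)) A"
    unfolding subalgebra_of_def generated_subalgebra_def by auto
qed (auto simp: generated_subalgebra_def)

text \<open>Zero and negatives are not among the closure conditions of \<open>subalgebra_of\<close>;
  they come from multiplication by the scalar \<open>-1\<close>.\<close>

lemma (in presentation) ring_generated_subalgebra:
  assumes G: "G \<subseteq> carrier (presented_alg X R)"
  shows "ring (generated_subalgebra (presented_alg X R) G)"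
    "subalgebra_of (carrier (generated_subalgebra (presented_alg X R) G)) (presented_alg X R)"
    "G \<subseteq> carrier (generated_subalgebra (presented_alg X R) G)"
proof -
  let ?A = "presented_alg X R" and ?B = "generated_subalgebra (presented_alg X R) G"
  interpret A: ring ?A by (rule ring_presented)
  have whole: "subalgebra_of (carrier ?A) ?A"
    unfolding subalgebra_of_def using smult_closed by simp
  note B = subalgebra_of_generated[OF whole G]
  from B show "subalgebra_of (carrier ?B) ?A" "G \<subseteq> carrier ?B" .
  have sub: "carrier ?B \<subseteq> carrier ?A" and one: "\<one>\<^bsub>?A\<^esub> \<in> carrier ?B"
    and closed: "x \<in> carrier ?B \<Longrightarrow> y \<in> carrier ?B \<Longrightarrow> x \<oplus>\<^bsub>?A\<^esub> y \<in> carrier ?B"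
      "x \<in> carrier ?B \<Longrightarrow> y \<in> carrier ?B \<Longrightarrow> x \<otimes>\<^bsub>?A\<^esub> y \<in> carrier ?B"
      "x \<in> carrier ?B \<Longrightarrow> z \<odot>\<^bsub>?A\<^esub> x \<in> carrier ?B" for x y z
    using B(1) unfolding subalgebra_of_def by blast+
  have neg: "((- 1) \<odot>\<^bsub>?A\<^esub> x) \<oplus>\<^bsub>?A\<^esub> x = \<zero>\<^bsub>?A\<^esub>" if "x \<in> carrier ?A" for x
  proof -
    obtain p where p: "p \<in> carrier (free_alg X)" "x = cls p" using \<open>x \<in> carrier ?A\<close> unfolding carrier_presented by blast
    have "scal (- 1) * p + p = 0"
    proof -
      have "scal (- 1) = - 1" by (simp add: scal_def single_uminus)
      then show ?thesis by simp
    qed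
    then have "((- 1) \<odot>\<^bsub>?A\<^esub> x) \<oplus>\<^bsub>?A\<^esub> x = cls 0"
      using p cls_add[of "scal (- 1) * p" p] by (simp add: cls_smult free_alg_closed)
    moreover have "cls 0 = \<zero>\<^bsub>?A\<^esub>"
    proof -
      have "cls 0 \<oplus>\<^bsub>?A\<^esub> cls 0 = cls (0 + 0)"
        by (rule cls_add; rule free_alg_closed)
      then have "cls 0 \<oplus>\<^bsub>?A\<^esub> cls 0 = cls 0" by (simp only: add_0)
      moreover have "cls 0 \<in> carrier ?A"
        unfolding carrier_presented by (intro imageI free_alg_closed)
      ultimately show ?thesis by (metis A.add.l_cancel_one)
    qed
    ultimately show ?thesis by simp
  qed
  have zero: "\<zero>\<^bsub>?A\<^esub> \<in> carrier ?B"
    using neg[of "\<one>\<^bsub>?A\<^esub>"] closed(1)[OF closed(3)[OF one] one, of "- 1"] by simp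
  show "ring ?B"
  proof (rule ringI)
    show "abelian_group ?B"
    proof (rule abelian_groupI)
      fix x assume x: "x \<in> carrier ?B"
      show "\<exists>y\<in>carrier ?B. y \<oplus>\<^bsub>?B\<^esub> x = \<zero>\<^bsub>?B\<^esub>"
      proof
        show "(- 1) \<odot>\<^bsub>?A\<^esub> x \<in> carrier ?B" using closed(3)[OF x] .
        show "((- 1) \<odot>\<^bsub>?A\<^esub> x) \<oplus>\<^bsub>?B\<^esub> x = \<zero>\<^bsub>?B\<^esub>" using neg x sub by auto
      qed
    next
      fix x y assume "x \<in> carrier ?B" "y \<in> carrier ?B"
      then show "x \<oplus>\<^bsub>?B\<^esub> y = y \<oplus>\<^bsub>?B\<^esub> x" using sub A.a_comm[of x y] by auto
    qed (use sub zero closed in \<open>auto simp: A.a_assoc subset_iff\<close>)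
    show "Group.monoid ?B"
      by (rule monoidI) (use sub one closed in \<open>auto simp: A.m_assoc subset_iff\<close>)
  qed (use sub in \<open>auto simp: A.l_distr A.r_distr subset_iff\<close>)
qed

text \<open>The homomorphism \<open>\<phi>\<close> takes values in an algebra with an auxiliary
  tensor factor. The elements sent to matrices of the form \<open>kron y 1\<close> form a subalgebra
  containing \<open>G\<close>, and on it the auxiliary factor is stripped off, uniquely by
  \<open>kron_inject\<close>.\<close>

lemma End_is_quotient_of_generated:
  fixes \<rho> :: "'g \<Rightarrow> complex^'s::finite^'s" and Q :: "('l::finite \<Rightarrow> 's) sqm set"
    and \<phi> :: "'a \<Rightarrow> (('l \<Rightarrow> 's) \<times> 'm::finite) sqm"
    and A :: "(complex, 'a) module" and G :: "'a set"
  defines "B \<equiv> generated_subalgebra A G"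
  assumes A: "ring A" and smult: "\<And>z x. x \<in> carrier A \<Longrightarrow> z \<odot>\<^bsub>A\<^esub> x \<in> carrier A"
    and B: "ring B" "subalgebra_of (carrier B) A" "G \<subseteq> carrier B"
    and \<phi>: "\<phi> \<in> alg_hom A calg" and Q: "\<phi> ` G = (\<lambda>y. kron y 1) ` Q" and comm: "galg Q = commutant H \<rho>"
  shows "is_quotient_of (End_tensor_power H \<rho> :: (complex, complex^('l \<Rightarrow> 's)^('l \<Rightarrow> 's)) module) B"
proof -
  interpret A: ring A by fact
  have sub: "x \<in> carrier A" if "x \<in> carrier B" for x
    using B(2) that unfolding subalgebra_of_def by blast
  have one: "\<one>\<^bsub>A\<^esub> \<in> carrier B"
    and closed: "x \<in> carrier B \<Longrightarrow> y \<in> carrier B \<Longrightarrow> x \<oplus>\<^bsub>A\<^esub> y \<in> carrier B"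
      "x \<in> carrier B \<Longrightarrow> y \<in> carrier B \<Longrightarrow> x \<otimes>\<^bsub>A\<^esub> y \<in> carrier B"
      "x \<in> carrier B \<Longrightarrow> z \<odot>\<^bsub>A\<^esub> x \<in> carrier B" for x y z
    using B(2) unfolding subalgebra_of_def by blast+
  have hom: "\<phi> (x \<otimes>\<^bsub>A\<^esub> y) = \<phi> x * \<phi> y" "\<phi> (x \<oplus>\<^bsub>A\<^esub> y) = \<phi> x + \<phi> y" "\<phi> (z \<odot>\<^bsub>A\<^esub> x) = of_complex z * \<phi> x"
    if "x \<in> carrier A" "y \<in> carrier A" for x y z
    using \<phi> that by (auto simp: alg_hom_def ring_hom_def)
  have hom1: "\<phi> \<one>\<^bsub>A\<^esub> = 1"
    using \<phi> by (auto simp: alg_hom_def ring_hom_def)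
  define S where "S = {x \<in> carrier A. \<exists>y\<in>galg Q. \<phi> x = kron y 1}"
  have SI: "x \<in> S" if "x \<in> carrier A" "y \<in> galg Q" "\<phi> x = kron y 1" for x y
    using that unfolding S_def by blast
  have "carrier B \<subseteq> S"
    unfolding B_def
  proof (rule generated_subalgebra_least)
    show "subalgebra_of S A"
      unfolding subalgebra_of_def
    proof (intro conjI ballI allI)
      show "S \<subseteq> carrier A" by (auto simp: S_def)
      show "\<one>\<^bsub>A\<^esub> \<in> S" by (rule SI[OF A.one_closed galg_1]) (simp add: hom1)
    next
      fix x x' assume "x \<in> S" "x' \<in> S"
      then obtain y y' where y: "x \<in> carrier A" "x' \<in> carrier A" "y \<in> galg Q" "y' \<in> galg Q" "\<phi> x = kron y 1" "\<phi> x' = kron y' 1"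
        unfolding S_def by blast
      show "x \<oplus>\<^bsub>A\<^esub> x' \<in> S"
        by (rule SI[OF A.a_closed[OF y(1,2)] galg_add[OF y(3,4)]]) (simp add: hom y kron_add)
      show "x \<otimes>\<^bsub>A\<^esub> x' \<in> S"
        by (rule SI[OF A.m_closed[OF y(1,2)] galg_mult[OF y(3,4)]]) (simp add: hom y kron_mult)
    next
      fix z x assume "x \<in> S"
      then obtain y where y: "x \<in> carrier A" "y \<in> galg Q" "\<phi> x = kron y 1" unfolding S_def by blast
      show "z \<odot>\<^bsub>A\<^esub> x \<in> S"
        by (rule SI[OF smult[OF y(1)] galg_mult[OF galg_of_complex y(2)]]) (simp add: hom(3)[OF y(1,1)] y kron_scale)
    qed
    show "G \<subseteq> S"
    proof
      fix x assume x: "x \<in> G"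
      then have "\<phi> x \<in> (\<lambda>y. kron y 1) ` Q" using Q by blast
      then obtain y where "y \<in> Q" "\<phi> x = kron y 1" by blast
      then show "x \<in> S" using x B(3) sub by (intro SI[OF _ galg_incl]) auto
    qed
  qed
  then have "\<exists>y. y \<in> galg Q \<and> \<phi> x = kron y 1" if "x \<in> carrier B" for x using that unfolding S_def by blast
  then obtain h where h: "h x \<in> galg Q" "\<phi> x = kron (h x) 1" if "x \<in> carrier B" for x by metis
  have h_eq: "h x = y" if "x \<in> carrier B" "\<phi> x = kron y 1" for x y
    using h(2)[OF that(1)] that(2) kron_inject by metis
  have h_hom: "h (x \<otimes>\<^bsub>A\<^esub> y) = h x * h y" "h (x \<oplus>\<^bsub>A\<^esub> y) = h x + h y" "h (z \<odot>\<^bsub>A\<^esub> x) = of_complex z * h x"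
    if xy: "x \<in> carrier B" "y \<in> carrier B" for x y z
  proof -
    note hom' = hom[OF sub[OF xy(1)] sub[OF xy(2)]] h(2)[OF xy(1)] h(2)[OF xy(2)]
    show "h (x \<otimes>\<^bsub>A\<^esub> y) = h x * h y"
      by (rule h_eq[OF closed(2)[OF xy]]) (simp add: hom' kron_mult)
    show "h (x \<oplus>\<^bsub>A\<^esub> y) = h x + h y"
      by (rule h_eq[OF closed(1)[OF xy]]) (simp add: hom' kron_add)
    show "h (z \<odot>\<^bsub>A\<^esub> x) = of_complex z * h x"
      by (rule h_eq[OF closed(3)[OF xy(1)]]) (simp add: hom' kron_scale)
  qed
  have h_one: "h \<one>\<^bsub>A\<^esub> = 1" by (rule h_eq[OF one]) (simp add: hom1)
  have "h \<in> alg_hom B calg"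
    by (simp add: alg_hom_def ring_hom_def h_hom h_one B_def[symmetric] generated_subalgebra_simps[of A G, folded B_def])
  moreover have "h ` carrier B = galg Q"
  proof
    show "h ` carrier B \<subseteq> galg Q" using h(1) by blast
    show "galg Q \<subseteq> h ` carrier B"
    proof
      fix y assume "y \<in> galg Q"
      then show "y \<in> h ` carrier B"
      proof (induction rule: galg.induct)
        case (galg_of_complex z)
        have "h (z \<odot>\<^bsub>A\<^esub> \<one>\<^bsub>A\<^esub>) = of_complex z" by (simp add: h_hom(3)[OF one one] h_one)
        then show ?case using closed(3)[OF one] by (metis imageI)
      next
        case (galg_incl y)
        then have "kron y 1 \<in> \<phi> ` G" using Q by blast
        then obtain x where x: "x \<in> G" "\<phi> x = kron y 1" by (metis imageE)
        then show ?case using h_eq[of x y] B(3) by blast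
      next
        case (galg_add y y')
        then obtain x x' where x: "x \<in> carrier B" "x' \<in> carrier B" "y = h x" "y' = h x'" by blast
        then show ?case using closed(1)[OF x(1,2)] h_hom(2)[OF x(1,2)] by (metis imageI)
      next
        case (galg_mult y y')
        then obtain x x' where x: "x \<in> carrier B" "x' \<in> carrier B" "y = h x" "y' = h x'" by blast
        then show ?case using closed(2)[OF x(1,2)] h_hom(1)[OF x(1,2)] by (metis imageI)
      qed
    qed
  qed
  moreover have "z \<odot>\<^bsub>B\<^esub> x \<in> carrier B" if "x \<in> carrier B" for z x
    using closed(3)[OF that] by (simp add: generated_subalgebra_simps[of A G, folded B_def])
  ultimately show ?thesis
    using B(1) comm by (intro End_is_quotient_of) simp_all
qed

lemma End_Spin_quotient:
  fixes \<rho> :: "nc_poly set \<Rightarrow> complex^'s::finite^'s"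
  assumes s: "CARD('s) = 2 ^ k" and l: "CARD('l::finite) = l" and \<rho>: "\<rho> \<in> alg_hom (Cl (2 * k + 1)) cmat_alg"
  shows "is_quotient_of (End_tensor_power (Spin (2 * k + 1)) \<rho> :: (complex, complex^('l \<Rightarrow> 's)^('l \<Rightarrow> 's)) module) (Uo_alg l (k + 1))"
proof -
  let ?N = "2 * k + 1"
  have odd: "odd ?N" by simp
  interpret spin_rep ?N \<rho> k
    by unfold_locales (use \<rho> s in auto)
  obtain \<pi> :: "nat \<Rightarrow> 'l" where \<pi>: "bij_betw \<pi> {1..l} UNIV"
    using ex_bij_betw_nat_finite_1[of "UNIV :: 'l set"] l by auto
  interpret spinor_slots ?N E k \<pi> l by unfold_locales (rule \<pi>)
  let ?zs = "half_roots (k + 1)"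
  define D where "D n = of_complex (1/2) * (\<Sum>i=1..?N. w n i)" for n
  have D_eq: "D = (\<lambda>n. of_complex (1/2) * (\<Sum>i=1..?N. w n i))" by (rule ext) (rule D_def)
  have rels: "ev D r = 0" if "r \<in> D_rels l ?zs" for r
    unfolding D_eq
  proof (rule D_rels_satisfied[OF _ _ _ _ that])
    show "of_nat ?N / 2 - of_nat m \<in> set ?zs" if "m \<le> ?N" for m
    proof -
      \<comment> \<open>The eigenvalues are \<open>k + 1/2 - m\<close>; with \<open>k + 1\<close> in
        place of \<open>m\<close>, the list \<open>half_roots\<close> runs from
        \<open>-k - 1/2\<close> to \<open>k + 1/2\<close>.\<close>
      have "of_nat ?N / 2 - of_nat m = (of_int (int k + 1 - int m) - 1/2 :: complex)"
        by (simp add: field_simps)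
      moreover have "int k + 1 - int m \<in> {- int (k + 1) + 1..int (k + 1)}" using that by auto
      ultimately show ?thesis unfolding half_roots_def set_map set_upto by (rule image_eqI)
    qed
  qed (use w_involutions w_adjacent w_far in blast)+
  interpret P: presentation "{1..<l}" "D_rels l ?zs" by unfold_locales (rule D_rels_closed)
  let ?A = "presented_alg {1..<l} (D_rels l ?zs)"
  let ?G = "{P.cls (gen n ^ 2) | n. n \<in> {1..<l}}"
  let ?Q = "(\<lambda>n. of_complex (1/4) * (c n * c n)) ` {1..<l}"
  have gen2: "gen n ^ 2 \<in> carrier (free_alg {1..<l})" if "n \<in> {1..<l}" for n
    unfolding power2_eq_square using that by (intro free_alg_closed)
  have G: "?G \<subseteq> carrier ?A" using gen2 unfolding P.carrier_presented by blast
  have hom: "P.induced D \<in> alg_hom ?A calg" by (rule P.induced_hom[of D, OF rels])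
  have "P.induced D (P.cls (gen n ^ 2)) = kron (of_complex (1/4) * (c n * c n)) 1" if n: "n \<in> {1..<l}" for n
  proof -
    have "P.induced D (P.cls (gen n ^ 2)) = ev D (gen n ^ 2)"
      by (rule P.induced_cls[of D, OF rels gen2[OF n]])
    then show ?thesis using w_square[OF n] by (simp add: power2_eq_square ev_mult D_def)
  qed
  then have image: "P.induced D ` ?G = (\<lambda>y. kron y 1) ` ?Q"
    unfolding Setcompr_eq_image image_image by (intro image_cong) simp_all
  have "galg ?Q = galg {cas a b | a b :: 'l. a \<noteq> b}"
  proof (rule galg_eqI)
    show "?Q \<subseteq> galg {cas a b | a b :: 'l. a \<noteq> b}"
    proof safe
      fix n assume n: "n \<in> {1..<l}"
      have "c n \<in> galg {cas a b | a b :: 'l. a \<noteq> b}"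
        using \<pi>_Suc_neq[OF n] unfolding c_def by (intro galg_incl) blast
      then show "of_complex (1/4) * (c n * c n) \<in> galg {cas a b | a b :: 'l. a \<noteq> b}"
        by (intro galg_mult galg_of_complex)
    qed
    have "c ` {1..<l} \<subseteq> galg ?Q"
    proof safe
      fix n assume n: "n \<in> {1..<l}"
      \<comment> \<open>Undoes the factor 1/4 from squaring the normalized generators, after which
        \<open>c n\<close> is a polynomial in \<open>c n * c n\<close>.\<close>
      have "of_complex 4 * (of_complex (1/4) * (c n * c n)) \<in> galg ?Q"
        using n by (intro galg_mult[OF galg_of_complex] galg_incl) blast
      moreover have "of_complex 4 * (of_complex (1/4) * (c n * c n)) = c n * c n"
        by (simp only: mult.assoc[symmetric] of_complex_mult[symmetric]) simp
      ultimately have "{c n * c n} \<subseteq> galg ?Q" by simp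
      from galg_subset[OF this] show "c n \<in> galg ?Q" using c_galg_square[OF odd n] by blast
    qed
    from galg_subset[OF this]
    show "{cas a b | a b :: 'l. a \<noteq> b} \<subseteq> galg ?Q"
      by (rule order_trans[OF subset_galg order_trans[OF cas_adjacent']])
  qed
  then have comm: "galg ?Q = commutant (Spin ?N) \<rho>"
    using commutant_Spin[OF odd, where 'l = 'l] by simp
  show ?thesis
    unfolding Uo_alg_def D_alg_def
    by (rule End_is_quotient_of_generated[OF P.ring_presented _ P.ring_generated_subalgebra[OF G] hom image comm])
      (rule P.smult_closed)
qed

theorem corollary3p4:
  fixes l k :: nat
  assumes "l \<ge> 2" and "k \<ge> 1"
    and "CARD('l::finite) = l"
    and "CARD('s::finite) = 2 ^ k"
  shows "(\<forall>\<rho> :: nc_poly set \<Rightarrow> complex^'s^'s. simple_rep (Cl (2 * k)) \<rho> \<longrightarrow>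
           is_quotient_of
             (End_tensor_power (Pin (2 * k)) \<rho> :: (complex, complex^('l \<Rightarrow> 's)^('l \<Rightarrow> 's)) module)
             (U_alg l k))
       \<and> (\<forall>\<rho> :: nc_poly set \<Rightarrow> complex^'s^'s. simple_rep (Cl (2 * k + 1)) \<rho> \<longrightarrow>
           is_quotient_of
             (End_tensor_power (Spin (2 * k + 1)) \<rho> :: (complex, complex^('l \<Rightarrow> 's)^('l \<Rightarrow> 's)) module)
             (Uo_alg l (k + 1)))"
  using End_Pin_quotient[OF assms(4,3)] End_Spin_quotient[OF assms(4,3)]
  unfolding simple_rep_def by blast

end
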